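(* If M-CLP and M-CLP$^*$ are both feasible, then both have optimal solutions, and their optimal objective values are equal (there is no duality gap).
   Context: Let $A$ be a real $K\times J$ matrix, $\beta,b\in\mathbb{R}^K$, $\gamma,c\in\mathbb{R}^J$, $T>0$. M-CLP is the problem: maximize $\int_{0-}^T(\gamma+(T-t)c)^\top dU(t)$ (Lebesgue–Stieltjes, including the jump $U(0)$ at $0$) over $U:[0,T]\to\mathbb{R}^J$ nonnegative, non-decreasing, right-continuous with $U(0-)=0$, subject to $AU(t)\le\beta+bt$ for all $0\le t\le T$. M-CLP$^*$ is: minimize $\int_{0-}^T(\beta+(T-t)b)^\top dP(t)$ over $P:[0,T]\to\mathbb{R}^K$ nonnegative, non-decreasing, right-continuous with $P(0-)=0$, subject to $A^\top P(t)\ge\gamma+ct$ for all $0\le t\le T$. *)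

theory Defs
  imports "HOL-Analysis.Analysis"
begin

text \<open>Extension of a scalar function u given on [0,T] to all of the reals:
  0 strictly before time 0 (the convention u(0-) = 0) and constant u(T) after T.
  For u nondecreasing, right-continuous on [0,T] and nonnegative, this is a
  nondecreasing right-continuous function on the reals.\<close>
definition ext0 :: "real \<Rightarrow> (real \<Rightarrow> real) \<Rightarrow> real \<Rightarrow> real" where
  "ext0 T u t = (if t < 0 then 0 else if t \<le> T then u t else u T)"

text \<open>Lebesgue--Stieltjes integral over [0-,T] (including the jump u(0) - u(0-) = u(0) at 0)
  of f with respect to du.\<close>
definition LS_int :: "real \<Rightarrow> (real \<Rightarrow> real) \<Rightarrow> (real \<Rightarrow> real) \<Rightarrow> real" where
  "LS_int T u f = (\<integral>t\<in>{0..T}. f t \<partial>(interval_measure (ext0 T u)))"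

definition admissible :: "real \<Rightarrow> (real \<Rightarrow> real^'n) \<Rightarrow> bool" where
  "admissible T U \<longleftrightarrow>
     (\<forall>t\<in>{0..T}. \<forall>i. 0 \<le> U t $ i) \<and>
     (\<forall>s\<in>{0..T}. \<forall>t\<in>{0..T}. s \<le> t \<longrightarrow> (\<forall>i. U s $ i \<le> U t $ i)) \<and>
     (\<forall>t\<in>{0..<T}. ((\<lambda>s. U s) \<longlongrightarrow> U t) (at_right t))"

definition MCLP_feasible ::
  "real^'j^'k \<Rightarrow> real^'k \<Rightarrow> real^'k \<Rightarrow> real \<Rightarrow> (real \<Rightarrow> real^'j) \<Rightarrow> bool" where
  "MCLP_feasible A \<beta> b T U \<longleftrightarrow> admissible T U \<and>
     (\<forall>t\<in>{0..T}. \<forall>k. (A *v U t) $ k \<le> \<beta> $ k + b $ k * t)"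

definition MCLP_obj ::
  "real^'j \<Rightarrow> real^'j \<Rightarrow> real \<Rightarrow> (real \<Rightarrow> real^'j) \<Rightarrow> real" where
  "MCLP_obj \<gamma> c T U = (\<Sum>j\<in>UNIV. LS_int T (\<lambda>t. U t $ j) (\<lambda>t. \<gamma> $ j + (T - t) * c $ j))"

definition MCLP_dual_feasible ::
  "real^'j^'k \<Rightarrow> real^'j \<Rightarrow> real^'j \<Rightarrow> real \<Rightarrow> (real \<Rightarrow> real^'k) \<Rightarrow> bool" where
  "MCLP_dual_feasible A \<gamma> c T P \<longleftrightarrow> admissible T P \<and>
     (\<forall>t\<in>{0..T}. \<forall>j. (transpose A *v P t) $ j \<ge> \<gamma> $ j + c $ j * t)"

definition MCLP_dual_obj ::
  "real^'k \<Rightarrow> real^'k \<Rightarrow> real \<Rightarrow> (real \<Rightarrow> real^'k) \<Rightarrow> real" where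
  "MCLP_dual_obj \<beta> b T P = (\<Sum>k\<in>UNIV. LS_int T (\<lambda>t. P t $ k) (\<lambda>t. \<beta> $ k + (T - t) * b $ k))"

definition MCLP_optimal where
  "MCLP_optimal A \<beta> b \<gamma> c T U \<longleftrightarrow> MCLP_feasible A \<beta> b T U \<and>
     (\<forall>V. MCLP_feasible A \<beta> b T V \<longrightarrow> MCLP_obj \<gamma> c T V \<le> MCLP_obj \<gamma> c T U)"

definition MCLP_dual_optimal where
  "MCLP_dual_optimal A \<beta> b \<gamma> c T P \<longleftrightarrow> MCLP_dual_feasible A \<gamma> c T P \<and>
     (\<forall>Q. MCLP_dual_feasible A \<gamma> c T Q \<longrightarrow> MCLP_dual_obj \<beta> b T P \<le> MCLP_dual_obj \<beta> b T Q)"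

end

theory Submission
  imports Defs "HOL-Probability.Helly_Selection"
begin

text \<open>Sampling time on a uniform grid gives a pair of finite linear programs that are dual to each
  other under time reversal; their objectives differ from the continuous ones by Riemann sum errors,
  so weak duality follows by sampling. If the grid programs have optimal solutions bounded
  independently of the grid, Helly's selection theorem yields limits that are feasible and have equal
  objectives, hence are optimal.

  The uniform bound cannot come from a Slater condition. By Farkas' lemma it is equivalent to an error
  bound whose constant does not depend on the grid: a nondecreasing path that violates
  \<open>A V(t) \<le> \<theta> (\<beta> + b t)\<close> by at most \<open>\<xi>\<close> lies within \<open>C \<xi>\<close> of an exactly feasible nondecreasing path,
  uniformly also in \<open>\<theta>\<close>. Hoffman's error bound in fixed dimension gives this up to a lag in time, by
  moving at each step as much as possible from the path to its exact copy. The lag is compensated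
  separately near both ends of the time interval, and mixing in a small multiple of an affine feasible
  path creates the slack needed to combine the two repairs.\<close>

subsection \<open>Fourier--Motzkin elimination, Farkas' lemma and Hoffman's error bound\<close>

text \<open>The grid system asks for primal and dual feasibility, dual objective at most primal
  objective, and total mass at most \<open>M\<close>. A Farkas certificate of its infeasibility is,
  after reversing time, again a pair of grid paths: the multiplier \<open>\<theta>\<close> of the
  objective row scales both right-hand sides, and the multiplier \<open>\<zeta>\<close> of the mass
  row is a violation common to all rows. If \<open>M\<close> is built from the repair constants,
  repairing both paths costs at most \<open>M * \<zeta>\<close> in objective, and weak duality for
  the repaired pair contradicts the certificate. This is why the repair must be uniform in
  \<open>\<theta>\<close>, with \<open>\<theta> = 0\<close> included. Hoffman's bound cannot be
  applied to the grid program as a whole, since rows and columns grow with the grid and the constant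
  with them. It is applied only to two systems of fixed size: the choice of a single increment, and
  the pair of initial value and slope of an affine path. The second system suffices to describe
  feasibility at both ends of the interval, because the chord of a feasible path is
  feasible.\<close>

definition lin :: "'v set \<Rightarrow> ('v \<Rightarrow> real) \<Rightarrow> ('v \<Rightarrow> real) \<Rightarrow> real" where
  "lin V a x = (\<Sum>v\<in>V. a v * x v)"

text \<open>A pair \<open>(a, f)\<close> stands for the inequality \<open>lin V a x \<le> f\<close>.
  When \<open>fst p v > 0\<close> and \<open>fst q v < 0\<close>, both multipliers are positive and
  the coefficient of \<open>v\<close> cancels.\<close>

definition fm_combine :: "'v \<Rightarrow> ('v \<Rightarrow> real) \<times> real \<Rightarrow> ('v \<Rightarrow> real) \<times> real \<Rightarrow> ('v \<Rightarrow> real) \<times> real" where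
  "fm_combine v p q = (\<lambda>w. - fst q v * fst p w + fst p v * fst q w, - fst q v * snd p + fst p v * snd q)"

definition fm_elim :: "'v \<Rightarrow> (('v \<Rightarrow> real) \<times> real) set \<Rightarrow> (('v \<Rightarrow> real) \<times> real) set" where
  "fm_elim v S = {s \<in> S. fst s v = 0} \<union>
     (\<lambda>(p, q). fm_combine v p q) ` ({p \<in> S. fst p v > 0} \<times> {q \<in> S. fst q v < 0})"

lemma lin_insert: "finite V \<Longrightarrow> v \<notin> V \<Longrightarrow> lin (insert v V) a x = a v * x v + lin V a x"
  by (simp add: lin_def)

lemma lin_upd: "v \<notin> V \<Longrightarrow> lin V a (x(v := z)) = lin V a x"
  unfolding lin_def by (rule sum.cong) auto

lemma lin_combine: "lin V (fst (fm_combine v p q)) x = - fst q v * lin V (fst p) x + fst p v * lin V (fst q) x"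
  by (simp add: fm_combine_def lin_def sum_distrib_left sum.distrib[symmetric] algebra_simps sum_negf[symmetric])

lemma finite_fm_elim: "finite S \<Longrightarrow> finite (fm_elim v S)"
  by (simp add: fm_elim_def)

text \<open>A combined row inherits the violation \<open>e\<close> times the sum of its two
  multipliers; each is at most \<open>K / 2\<close>. The condition \<open>K \<ge> 1\<close> serves
  the rows that elimination keeps unchanged.\<close>

lemma fm_elim_violation:
  assumes V: "finite V" "v \<notin> V" and e: "e \<ge> 0" and K: "K \<ge> 1" "\<And>s. s \<in> S \<Longrightarrow> 2 * \<bar>fst s v\<bar> \<le> K"
    and viol: "\<And>s. s \<in> S \<Longrightarrow> lin (insert v V) (fst s) x \<le> snd s + e"
    and s: "s \<in> fm_elim v S"
  shows "lin V (fst s) x \<le> snd s + K * e"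
proof -
  consider "s \<in> S" "fst s v = 0"
    | p q where "p \<in> S" "q \<in> S" "fst p v > 0" "fst q v < 0" "s = fm_combine v p q"
    using s unfolding fm_elim_def by auto
  then show ?thesis
  proof cases
    case 1
    have "e \<le> K * e" using K(1) e mult_right_mono[of 1 K e] by simp
    then show ?thesis using viol[OF 1(1)] 1(2) lin_insert[OF V, of "fst s" x] by simp
  next
    case 2
    have p: "fst p v * x v + lin V (fst p) x \<le> snd p + e"
      using viol[OF 2(1)] lin_insert[OF V] by metis
    have q: "fst q v * x v + lin V (fst q) x \<le> snd q + e"
      using viol[OF 2(2)] lin_insert[OF V] by metis
    have "- fst q v * (fst p v * x v + lin V (fst p) x) \<le> - fst q v * (snd p + e)"
      using p 2(4) by (intro mult_left_mono) auto
    moreover have "fst p v * (fst q v * x v + lin V (fst q) x) \<le> fst p v * (snd q + e)"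
      using q 2(3) by (intro mult_left_mono) auto
    moreover have "(- fst q v + fst p v) * e \<le> K * e"
      using K(2)[OF 2(1)] K(2)[OF 2(2)] 2 e by (intro mult_right_mono) auto
    ultimately show ?thesis
      unfolding 2(5) lin_combine by (simp add: fm_combine_def algebra_simps)
  qed
qed

text \<open>The witness is the point nearest to \<open>z\<close> between \<open>Max L\<close> and
  \<open>Min U\<close>. The last conjunct records that a moved point sits at one of the bounds, so
  that the distance can be read off an active inequality.\<close>

lemma clip_between:
  fixes z :: real
  assumes "finite L" "finite U" "\<And>l u. l \<in> L \<Longrightarrow> u \<in> U \<Longrightarrow> l \<le> u"
  shows "\<exists>y. (\<forall>l\<in>L. l \<le> y) \<and> (\<forall>u\<in>U. y \<le> u) \<and> (y = z \<or> (y \<in> U \<and> y < z) \<or> (y \<in> L \<and> z < y))"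
proof -
  consider "\<exists>u\<in>U. u < z" | "\<exists>l\<in>L. z < l" | "\<forall>u\<in>U. z \<le> u" "\<forall>l\<in>L. l \<le> z" by force
  then show ?thesis
  proof cases
    case 1
    then have "U \<noteq> {}" by auto
    then have m: "Min U \<in> U" "\<And>u. u \<in> U \<Longrightarrow> Min U \<le> u" using assms(2) by auto
    moreover have "Min U < z" using 1 m(2) by force
    ultimately show ?thesis using assms(3) by (intro exI[of _ "Min U"]) auto
  next
    case 2
    then have "L \<noteq> {}" by auto
    then have m: "Max L \<in> L" "\<And>u. u \<in> L \<Longrightarrow> u \<le> Max L" using assms(1) by auto
    moreover have "z < Max L" using 2 m(2) by force
    ultimately show ?thesis using assms(3) by (intro exI[of _ "Max L"]) auto
  qed auto
qed

text \<open>The combined row of \<open>p\<close> and \<open>q\<close>, divided by the product of the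
  coefficients, says that the lower bound from \<open>q\<close> does not exceed the upper bound from
  \<open>p\<close>. The second conjunct measures the move away from \<open>z\<close> by the
  violation of one active row, which is what the error bound needs.\<close>

lemma fm_elim_extend:
  assumes V: "finite V" "v \<notin> V" and S: "finite S"
    and sat: "\<And>s. s \<in> fm_elim v S \<Longrightarrow> lin V (fst s) x \<le> snd s"
  shows "\<exists>y. (\<forall>s\<in>S. lin (insert v V) (fst s) (x(v := y)) \<le> snd s) \<and>
    (y = z \<or> (\<exists>s\<in>S. fst s v \<noteq> 0 \<and> \<bar>fst s v\<bar> * \<bar>y - z\<bar> = lin V (fst s) x + fst s v * z - snd s))"
proof -
  define bd where "bd s = (snd s - lin V (fst s) x) / fst s v" for s
  define P where "P = {p \<in> S. fst p v > 0}"
  define Q where "Q = {p \<in> S. fst p v < 0}"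
  have le: "bd q \<le> bd p" if "p \<in> P" "q \<in> Q" for p q
  proof -
    have "fm_combine v p q \<in> fm_elim v S"
      using that unfolding fm_elim_def P_def Q_def by (intro UnI2 image_eqI[where x="(p, q)"]) auto
    from sat[OF this] have *: "- fst q v * lin V (fst p) x + fst p v * lin V (fst q) x \<le> - fst q v * snd p + fst p v * snd q"
      unfolding lin_combine by (simp add: fm_combine_def)
    have "fst p v > 0" "fst q v < 0" using that by (auto simp: P_def Q_def)
    then show ?thesis using * by (simp add: bd_def divide_simps) (simp add: algebra_simps)
  qed
  obtain y where y: "\<forall>l\<in>bd ` Q. l \<le> y" "\<forall>u\<in>bd ` P. y \<le> u"
    "y = z \<or> (y \<in> bd ` P \<and> y < z) \<or> (y \<in> bd ` Q \<and> z < y)"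
    using clip_between[of "bd ` Q" "bd ` P" z] S le unfolding P_def Q_def by fastforce
  have "lin (insert v V) (fst s) (x(v := y)) \<le> snd s" if s: "s \<in> S" for s
  proof -
    consider "fst s v = 0" | "s \<in> P" | "s \<in> Q" using s by (force simp: P_def Q_def)
    then have "fst s v * y + lin V (fst s) x \<le> snd s"
    proof cases
      case 1
      then show ?thesis using sat[of s] s by (simp add: fm_elim_def)
    next
      case 2
      then have "y \<le> bd s" "fst s v > 0" using y(2) by (blast, simp add: P_def)
      then show ?thesis by (simp add: bd_def field_simps)
    next
      case 3
      then have "bd s \<le> y" "fst s v < 0" using y(1) by (blast, simp add: Q_def)
      then show ?thesis by (simp add: bd_def field_simps)
    qed
    then show ?thesis by (simp add: lin_insert[OF V] lin_upd[OF V(2)])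
  qed
  moreover have "\<bar>fst s v\<bar> * \<bar>y - z\<bar> = lin V (fst s) x + fst s v * z - snd s"
    if "s \<in> P \<and> y < z \<or> s \<in> Q \<and> z < y" "y = bd s" for s
  proof -
    have n: "fst s v \<noteq> 0" using that by (auto simp: P_def Q_def)
    have "\<bar>fst s v\<bar> * \<bar>y - z\<bar> = fst s v * (z - y)"
      using that by (auto simp: P_def Q_def abs_if algebra_simps)
    also have "\<dots> = fst s v * z - (snd s - lin V (fst s) x)"
      using n unfolding that(2) bd_def right_diff_distrib[of _ z] by simp
    finally show ?thesis by simp
  qed
  moreover have "s \<in> S \<and> fst s v \<noteq> 0" if "s \<in> P \<or> s \<in> Q" for s using that by (auto simp: P_def Q_def)
  ultimately show ?thesis using y(3) by (intro exI[of _ y]) blast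
qed

text \<open>\<open>K\<close> is an abstract convex cone of consequences of \<open>S\<close>.
  Restricting it to rows with zero coefficient at \<open>v\<close> carries the induction without any
  bookkeeping of multipliers.\<close>

lemma fm_alternative:
  assumes "finite V" "finite S" "S \<subseteq> K"
    and "\<And>p q r s. p \<in> K \<Longrightarrow> q \<in> K \<Longrightarrow> r \<ge> 0 \<Longrightarrow> s \<ge> 0 \<Longrightarrow>
        (\<lambda>w. r * fst p w + s * fst q w, r * snd p + s * snd q) \<in> K"
  shows "(\<exists>x. \<forall>s\<in>S. lin V (fst s) x \<le> snd s) \<or> (\<exists>s\<in>K. (\<forall>v\<in>V. fst s v = 0) \<and> snd s < 0)"
  using assms
proof (induction V arbitrary: S K rule: finite_induct)
  case empty
  show ?case
  proof (cases "\<forall>s\<in>S. 0 \<le> snd s")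
    case False
    then show ?thesis using empty.prems(2) by (intro disjI2) force
  qed (simp add: lin_def)
next
  case (insert v V)
  let ?K = "{s \<in> K. fst s v = 0}"
  have "fm_elim v S \<subseteq> ?K"
  proof
    fix s assume "s \<in> fm_elim v S"
    then consider "s \<in> S" "fst s v = 0"
      | p q where "p \<in> S" "q \<in> S" "fst p v > 0" "fst q v < 0" "s = fm_combine v p q"
      unfolding fm_elim_def by auto
    then show "s \<in> ?K"
    proof cases
      case 1
      then show ?thesis using insert.prems(2) by blast
    next
      case 2
      have "s \<in> K" unfolding 2(5) fm_combine_def
        using 2 insert.prems(2) by (intro insert.prems(3)) auto
      then show ?thesis by (simp add: 2(5) fm_combine_def)
    qed
  qed
  then have IH: "(\<exists>x. \<forall>s\<in>fm_elim v S. lin V (fst s) x \<le> snd s) \<or>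
      (\<exists>s\<in>?K. (\<forall>w\<in>V. fst s w = 0) \<and> snd s < 0)"
    by (intro insert.IH finite_fm_elim[OF insert.prems(1)]) (simp_all add: insert.prems(3))
  show ?case
  proof (cases "\<exists>x. \<forall>s\<in>fm_elim v S. lin V (fst s) x \<le> snd s")
    case True
    then obtain x where x: "\<And>s. s \<in> fm_elim v S \<Longrightarrow> lin V (fst s) x \<le> snd s" by blast
    from fm_elim_extend[OF insert.hyps insert.prems(1) x] show ?thesis by blast
  next
    case False
    then obtain s where "s \<in> K" "fst s v = 0" "\<forall>w\<in>V. fst s w = 0" "snd s < 0" using IH by blast
    then show ?thesis by (intro disjI2 bexI[of _ s]) simp_all
  qed
qed

lemma farkas:
  fixes a :: "'i \<Rightarrow> 'v \<Rightarrow> real" and f :: "'i \<Rightarrow> real"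
  assumes V: "finite V" and I: "finite I"
    and none: "\<nexists>x. \<forall>i\<in>I. (\<Sum>v\<in>V. a i v * x v) \<le> f i"
  obtains y where "\<And>i. i \<in> I \<Longrightarrow> y i \<ge> 0" "\<And>v. v \<in> V \<Longrightarrow> (\<Sum>i\<in>I. y i * a i v) = 0"
    "(\<Sum>i\<in>I. y i * f i) < 0"
proof -
  let ?S = "(\<lambda>i. (a i, f i)) ` I"
  \<comment> \<open>Taking the cone of explicit nonnegative combinations turns a contradictory row
    into the multipliers sought.\<close>
  define K where "K = {((\<lambda>w. \<Sum>i\<in>I. y i * a i w), (\<Sum>i\<in>I. y i * f i)) | y. \<forall>i\<in>I. y i \<ge> 0}"
  have SK: "?S \<subseteq> K"
  proof
    fix s assume "s \<in> ?S"
    then obtain i where i: "i \<in> I" "s = (a i, f i)" by auto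
    show "s \<in> K" unfolding K_def mem_Collect_eq
      using i I by (intro exI[of _ "\<lambda>l. if l = i then 1 else 0"])
        (auto simp: if_distrib[of "\<lambda>z. z * _"] cong: if_cong)
  qed
  have KK: "(\<lambda>w. r * fst p w + s * fst q w, r * snd p + s * snd q) \<in> K"
    if pq: "p \<in> K" "q \<in> K" and rs: "r \<ge> 0" "s \<ge> 0" for p q and r s :: real
  proof -
    obtain y z where yz: "\<forall>i\<in>I. y i \<ge> 0" "\<forall>i\<in>I. z i \<ge> 0"
      "p = ((\<lambda>w. \<Sum>i\<in>I. y i * a i w), (\<Sum>i\<in>I. y i * f i))"
      "q = ((\<lambda>w. \<Sum>i\<in>I. z i * a i w), (\<Sum>i\<in>I. z i * f i))"
      using pq unfolding K_def by auto
    show ?thesis unfolding K_def mem_Collect_eq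
      using yz rs by (intro exI[of _ "\<lambda>i. r * y i + s * z i"])
        (auto simp: sum_distrib_left sum.distrib[symmetric] algebra_simps)
  qed
  have "\<not> (\<exists>x. \<forall>s\<in>?S. lin V (fst s) x \<le> snd s)"
    using none by (auto simp: lin_def)
  then obtain s where "s \<in> K" "\<forall>v\<in>V. fst s v = 0" "snd s < 0"
    using fm_alternative[OF V _ SK KK] I by blast
  then show ?thesis using that unfolding K_def by (smt (verit) fst_conv mem_Collect_eq snd_conv)
qed

text \<open>Hoffman's error bound, by Fourier--Motzkin elimination: the eliminated coordinate is
  clipped to the interval the remaining inequalities allow.\<close>
lemma hoffman_sets:
  assumes "finite V" "finite Cs"
  shows "\<exists>C\<ge>0. \<forall>S x0 e. finite S \<and> fst ` S \<subseteq> Cs \<and> e \<ge> 0 \<and> (\<exists>x. \<forall>s\<in>S. lin V (fst s) x \<le> snd s) \<and>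
     (\<forall>s\<in>S. lin V (fst s) x0 \<le> snd s + e) \<longrightarrow>
     (\<exists>x. (\<forall>s\<in>S. lin V (fst s) x \<le> snd s) \<and> (\<forall>v\<in>V. \<bar>x v - x0 v\<bar> \<le> C * e))"
  using assms
proof (induction V arbitrary: Cs rule: finite_induct)
  case empty
  show ?case by (intro exI[of _ 0]) auto
next
  case (insert v V)
  \<comment> \<open>All coefficient vectors that one elimination can produce from \<open>Cs\<close>.
    The set is finite and independent of right-hand sides, so the induction hypothesis gives one
    constant for all systems.\<close>
  define Cs' where "Cs' = Cs \<union> (\<lambda>(p, q) w. - q v * p w + p v * q w) ` (Cs \<times> Cs)"
  have finCs': "finite Cs'" unfolding Cs'_def using insert.prems by auto
  from insert.IH[OF finCs'] obtain C where C: "C \<ge> 0"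
    "\<forall>S x0 e. finite S \<and> fst ` S \<subseteq> Cs' \<and> e \<ge> 0 \<and> (\<exists>x. \<forall>s\<in>S. lin V (fst s) x \<le> snd s) \<and>
     (\<forall>s\<in>S. lin V (fst s) x0 \<le> snd s + e) \<longrightarrow>
     (\<exists>x. (\<forall>s\<in>S. lin V (fst s) x \<le> snd s) \<and> (\<forall>v\<in>V. \<bar>x v - x0 v\<bar> \<le> C * e))"
    by (elim exE conjE)
  define K where "K = 1 + (\<Sum>p\<in>Cs. 2 * \<bar>p v\<bar>)"
  have K: "K \<ge> 1" "\<And>p. p \<in> Cs \<Longrightarrow> 2 * \<bar>p v\<bar> \<le> K"
  proof -
    show "K \<ge> 1" unfolding K_def by (simp add: sum_nonneg)
    show "2 * \<bar>p v\<bar> \<le> K" if "p \<in> Cs" for p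
      using member_le_sum[of p Cs "\<lambda>p. 2 * \<bar>p v\<bar>"] that insert.prems unfolding K_def by simp
  qed
  \<comment> \<open>The active row bounds the move of the clipped coordinate: its violation is at
    most \<open>e\<close> plus the effect of moving the other coordinates, and this is divided by
    \<open>\<bar>p v\<bar>\<close>. For \<open>p v = 0\<close> the quotient is 0, so the sum over
    \<open>Cs\<close> is still an upper bound.\<close>
  define B where "B p = (1 + (\<Sum>w\<in>V. \<bar>p w\<bar>) * (C * K)) / \<bar>p v\<bar>" for p
  have Bnn: "B p \<ge> 0" for p unfolding B_def using C K by (simp add: sum_nonneg)
  define C' where "C' = C * K + (\<Sum>p\<in>Cs. B p)"
  have C'nn: "C' \<ge> 0" using C(1) K(1) Bnn by (simp add: C'_def sum_nonneg)
  show ?case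
  proof (intro exI[of _ C'] conjI C'nn allI impI, elim conjE)
    fix S :: "(('a \<Rightarrow> real) \<times> real) set" and x0 e
    assume S: "finite S" "fst ` S \<subseteq> Cs" and e: "e \<ge> 0"
      and ex: "\<exists>x. \<forall>s\<in>S. lin (insert v V) (fst s) x \<le> snd s"
      and viol: "\<forall>s\<in>S. lin (insert v V) (fst s) x0 \<le> snd s + e"
    let ?S = "fm_elim v S"
    have S': "finite ?S" by (rule finite_fm_elim[OF S(1)])
    have sub: "fst ` ?S \<subseteq> Cs'"
    proof
      fix a assume "a \<in> fst ` ?S"
      then consider s where "s \<in> S" "a = fst s"
        | p q where "p \<in> S" "q \<in> S" "a = fst (fm_combine v p q)"
        unfolding fm_elim_def by auto
      then show "a \<in> Cs'"
      proof cases
        case 1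
        then show ?thesis using S(2) by (auto simp: Cs'_def)
      next
        case 2
        have "fst p \<in> Cs" "fst q \<in> Cs" using 2 S(2) by auto
        then show ?thesis unfolding Cs'_def 2(3) fm_combine_def
          by (intro UnI2 image_eqI[where x="(fst p, fst q)"]) auto
      qed
    qed
    have KS: "2 * \<bar>fst s v\<bar> \<le> K" if "s \<in> S" for s using K(2) S(2) that by auto
    obtain x where x: "\<forall>s\<in>S. lin (insert v V) (fst s) x \<le> snd s" using ex by blast
    \<comment> \<open>Violation 0 turns the violation lemma into the statement that exact solutions
      survive elimination.\<close>
    have "lin V (fst s) x \<le> snd s + K * 0" if "s \<in> ?S" for s
      using x by (intro fm_elim_violation[OF insert.hyps order_refl K(1) KS _ that]) simp_all
    then have ex': "\<exists>x. \<forall>s\<in>?S. lin V (fst s) x \<le> snd s"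
      by (intro exI[of _ x] ballI) simp
    have viol': "\<forall>s\<in>?S. lin V (fst s) x0 \<le> snd s + K * e"
      using viol by (intro ballI fm_elim_violation[OF insert.hyps e K(1) KS]) simp_all
    have Ke: "K * e \<ge> 0" using K(1) e by simp
    have "\<exists>x. (\<forall>s\<in>?S. lin V (fst s) x \<le> snd s) \<and> (\<forall>v\<in>V. \<bar>x v - x0 v\<bar> \<le> C * (K * e))"
      by (rule C(2)[THEN spec, THEN spec, THEN spec, THEN mp]) (intro conjI S' sub Ke ex' viol')
    then obtain y where y': "\<forall>s\<in>?S. lin V (fst s) y \<le> snd s" "\<forall>w\<in>V. \<bar>y w - x0 w\<bar> \<le> C * (K * e)"
      by (elim exE conjE)
    have y: "lin V (fst s) y \<le> snd s" if "s \<in> ?S" for s using y'(1) that by (rule bspec)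
    have yd: "\<bar>y w - x0 w\<bar> \<le> C * (K * e)" if "w \<in> V" for w using y'(2) that by (rule bspec)
    obtain z where z: "\<forall>s\<in>S. lin (insert v V) (fst s) (y(v := z)) \<le> snd s"
      "z = x0 v \<or> (\<exists>s\<in>S. fst s v \<noteq> 0 \<and> \<bar>fst s v\<bar> * \<bar>z - x0 v\<bar> = lin V (fst s) y + fst s v * x0 v - snd s)"
      using fm_elim_extend[OF insert.hyps S(1) y, of "x0 v"] by blast
    have "\<bar>z - x0 v\<bar> \<le> (\<Sum>p\<in>Cs. B p) * e" using z(2)
    proof
      assume "z = x0 v"
      then show ?thesis using e Bnn by (simp add: sum_nonneg)
    next
      assume "\<exists>s\<in>S. fst s v \<noteq> 0 \<and> \<bar>fst s v\<bar> * \<bar>z - x0 v\<bar> = lin V (fst s) y + fst s v * x0 v - snd s"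
      then obtain s where s: "s \<in> S" "fst s v \<noteq> 0"
        "\<bar>fst s v\<bar> * \<bar>z - x0 v\<bar> = lin V (fst s) y + fst s v * x0 v - snd s" by blast
      have "lin V (fst s) y - lin V (fst s) x0 = (\<Sum>w\<in>V. fst s w * (y w - x0 w))"
        by (simp add: lin_def sum_subtractf algebra_simps)
      also have "\<dots> \<le> (\<Sum>w\<in>V. \<bar>fst s w\<bar> * (C * (K * e)))"
      proof (rule sum_mono)
        fix w assume w: "w \<in> V"
        have "fst s w * (y w - x0 w) \<le> \<bar>fst s w\<bar> * \<bar>y w - x0 w\<bar>"
          by (metis abs_ge_self abs_mult)
        also have "\<dots> \<le> \<bar>fst s w\<bar> * (C * (K * e))" by (intro mult_left_mono yd w) auto
        finally show "fst s w * (y w - x0 w) \<le> \<bar>fst s w\<bar> * (C * (K * e))" .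
      qed
      finally have "lin V (fst s) y + fst s v * x0 v - snd s \<le> e + (\<Sum>w\<in>V. \<bar>fst s w\<bar>) * (C * (K * e))"
        using bspec[OF viol s(1)] by (simp add: lin_insert[OF insert.hyps] sum_distrib_right)
      then have "\<bar>fst s v\<bar> * \<bar>z - x0 v\<bar> \<le> (1 + (\<Sum>w\<in>V. \<bar>fst s w\<bar>) * (C * K)) * e"
        unfolding s(3) by (simp add: algebra_simps)
      then have "\<bar>z - x0 v\<bar> \<le> B (fst s) * e"
        using s(2) by (simp add: B_def field_simps)
      also have "\<dots> \<le> (\<Sum>p\<in>Cs. B p) * e"
        using s(1) S(2) insert.prems Bnn e by (intro mult_right_mono member_le_sum) auto
      finally show ?thesis .
    qed
    then have "\<bar>z - x0 v\<bar> \<le> C' * e" using C(1) K(1) e by (simp add: C'_def algebra_simps add_increasing)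
    moreover have "C * (K * e) \<le> C' * e" using e Bnn by (simp add: C'_def algebra_simps sum_nonneg)
    ultimately show "\<exists>x. (\<forall>s\<in>S. lin (insert v V) (fst s) x \<le> snd s) \<and> (\<forall>w\<in>insert v V. \<bar>x w - x0 w\<bar> \<le> C' * e)"
      using z(1) order_trans[OF yd] insert.hyps(2) by (intro exI[of _ "y(v := z)"]) (auto simp del: fun_upd_apply simp: fun_upd_def)
  qed
qed

lemma hoffman:
  fixes a :: "'i \<Rightarrow> 'v::finite \<Rightarrow> real"
  assumes I: "finite I"
  obtains C where "C \<ge> 0" "\<And>f x0 e. \<lbrakk>e \<ge> 0; \<exists>x. \<forall>i\<in>I. (\<Sum>v\<in>UNIV. a i v * x v) \<le> f i;
      \<forall>i\<in>I. (\<Sum>v\<in>UNIV. a i v * x0 v) \<le> f i + e\<rbrakk> \<Longrightarrow>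
     \<exists>x. (\<forall>i\<in>I. (\<Sum>v\<in>UNIV. a i v * x v) \<le> f i) \<and> (\<forall>v. \<bar>x v - x0 v\<bar> \<le> C * e)"
proof -
  from hoffman_sets[OF finite[of "UNIV :: 'v set"] finite_imageI[OF I, of a]]
  obtain C where C: "C \<ge> 0" and H: "\<forall>S x0 e. finite S \<and> fst ` S \<subseteq> a ` I \<and> e \<ge> 0 \<and> (\<exists>x. \<forall>s\<in>S. lin UNIV (fst s) x \<le> snd s) \<and>
     (\<forall>s\<in>S. lin UNIV (fst s) x0 \<le> snd s + e) \<longrightarrow>
     (\<exists>x. (\<forall>s\<in>S. lin UNIV (fst s) x \<le> snd s) \<and> (\<forall>v\<in>UNIV. \<bar>x v - x0 v\<bar> \<le> C * e))"
    by (elim exE conjE)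
  show ?thesis
  proof (rule that[OF C])
    fix f x0 and e :: real
    assume *: "e \<ge> 0" "\<exists>x. \<forall>i\<in>I. (\<Sum>v\<in>UNIV. a i v * x v) \<le> f i"
      "\<forall>i\<in>I. (\<Sum>v\<in>UNIV. a i v * x0 v) \<le> f i + e"
    then show "\<exists>x. (\<forall>i\<in>I. (\<Sum>v\<in>UNIV. a i v * x v) \<le> f i) \<and> (\<forall>v. \<bar>x v - x0 v\<bar> \<le> C * e)"
      using H[THEN spec[of _ "(\<lambda>i. (a i, f i)) ` I"], THEN spec[of _ x0], THEN spec[of _ e]] I
      by (simp add: lin_def image_image)
  qed
qed

subsection \<open>Following an approximately feasible path\<close>

lemma sum_UNIV_option:
  fixes g :: "'a::finite option \<Rightarrow> real"
  shows "(\<Sum>v\<in>UNIV. g v) = g None + (\<Sum>j\<in>UNIV. g (Some j))"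
  by (simp add: UNIV_option_conv sum.reindex)

text \<open>The bounds \<open>l\<close> and \<open>u\<close> are right-hand sides of rows with
  coefficients 1 and -1, so the constant depends on \<open>a\<close> alone.\<close>

lemma hoffman_box:
  fixes a :: "'r \<Rightarrow> 'v::finite \<Rightarrow> real"
  assumes R: "finite R"
  obtains C where "C \<ge> 0" "\<And>f l u x0 e. \<lbrakk>e \<ge> 0;
      \<exists>x. (\<forall>q\<in>R. (\<Sum>v\<in>UNIV. a q v * x v) \<le> f q) \<and> (\<forall>v. l v \<le> x v \<and> x v \<le> u v);
      \<forall>q\<in>R. (\<Sum>v\<in>UNIV. a q v * x0 v) \<le> f q + e; \<forall>v. l v - e \<le> x0 v \<and> x0 v \<le> u v + e\<rbrakk> \<Longrightarrow>
     \<exists>x. (\<forall>q\<in>R. (\<Sum>v\<in>UNIV. a q v * x v) \<le> f q) \<and> (\<forall>v. l v \<le> x v \<and> x v \<le> u v) \<and>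
       (\<forall>v. \<bar>x v - x0 v\<bar> \<le> C * e)"
proof -
  define M :: "'r + 'v \<times> bool \<Rightarrow> 'v \<Rightarrow> real" where
    "M i = (case i of Inl q \<Rightarrow> a q | Inr (v, s) \<Rightarrow> (\<lambda>w. if w = v then (if s then 1 else - 1) else 0))" for i
  let ?I = "Inl ` R \<union> Inr ` UNIV :: ('r + 'v \<times> bool) set"
  have M1: "(\<Sum>w\<in>UNIV. M (Inl q) w * x w) = (\<Sum>v\<in>UNIV. a q v * x v)" for q x
    by (simp add: M_def)
  have M2: "(\<Sum>w\<in>UNIV. M (Inr (v, s)) w * x w) = (if s then x v else - x v)" for v s x
    by (simp add: M_def if_distrib[of "\<lambda>z. z * _"] cong: if_cong)
  have finI: "finite ?I" using R by simp
  obtain C where C: "C \<ge> 0" and H: "\<And>f x0 e. \<lbrakk>e \<ge> 0; \<exists>x. \<forall>i\<in>?I. (\<Sum>v\<in>UNIV. M i v * x v) \<le> f i;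
      \<forall>i\<in>?I. (\<Sum>v\<in>UNIV. M i v * x0 v) \<le> f i + e\<rbrakk> \<Longrightarrow>
     \<exists>x. (\<forall>i\<in>?I. (\<Sum>v\<in>UNIV. M i v * x v) \<le> f i) \<and> (\<forall>v. \<bar>x v - x0 v\<bar> \<le> C * e)"
    using that by (rule hoffman[OF finI, of M])
  show ?thesis
  proof (rule that[OF C])
    fix f l u x0 and e :: real
    assume e: "e \<ge> 0"
      and ex: "\<exists>x. (\<forall>q\<in>R. (\<Sum>v\<in>UNIV. a q v * x v) \<le> f q) \<and> (\<forall>v. l v \<le> x v \<and> x v \<le> u v)"
      and viol: "\<forall>q\<in>R. (\<Sum>v\<in>UNIV. a q v * x0 v) \<le> f q + e" "\<forall>v. l v - e \<le> x0 v \<and> x0 v \<le> u v + e"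
    define g where "g i = (case i of Inl q \<Rightarrow> f q | Inr (v, s) \<Rightarrow> if s then u v else - l v)" for i
    have iff: "(\<forall>i\<in>?I. (\<Sum>v\<in>UNIV. M i v * x v) \<le> g i + d) \<longleftrightarrow>
       (\<forall>q\<in>R. (\<Sum>v\<in>UNIV. a q v * x v) \<le> f q + d) \<and> (\<forall>v. l v - d \<le> x v \<and> x v \<le> u v + d)" for x d
    proof -
      have "(\<forall>i\<in>Inr ` UNIV. (\<Sum>v\<in>UNIV. M i v * x v) \<le> g i + d) \<longleftrightarrow>
        (\<forall>v s. (if s then x v else - x v) \<le> g (Inr (v, s)) + d)"
        by (auto simp: M2)
      also have "\<dots> \<longleftrightarrow> (\<forall>v. l v - d \<le> x v \<and> x v \<le> u v + d)"
        unfolding g_def by (simp add: all_bool_eq) (smt (verit))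
      finally show ?thesis unfolding ball_Un by (simp add: M1 g_def)
    qed
    obtain x where "\<forall>i\<in>?I. (\<Sum>v\<in>UNIV. M i v * x v) \<le> g i" "\<forall>v. \<bar>x v - x0 v\<bar> \<le> C * e"
      using H[OF e, of g x0] iff[of _ 0] iff[of _ e] ex viol by (simp only: add_0_right diff_zero) blast
    then show "\<exists>x. (\<forall>q\<in>R. (\<Sum>v\<in>UNIV. a q v * x v) \<le> f q) \<and> (\<forall>v. l v \<le> x v \<and> x v \<le> u v) \<and>
       (\<forall>v. \<bar>x v - x0 v\<bar> \<le> C * e)"
      using iff[of x 0] by (intro exI[of _ x]) simp
  qed
qed

text \<open>Hoffman's bound is used twice. With the elapsed parameter as an extra unknown
  \<open>None\<close>, zero is feasible, and the bound gives a solution whose parameter is close to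
  \<open>\<rho>\<close>. Scaling it down reaches a prescribed parameter \<open>s\<close>, but may
  destroy closeness of the other coordinates; a second application with \<open>None\<close> pinned
  to \<open>s\<close> restores it.\<close>

lemma extract_step:
  fixes a :: "'r \<Rightarrow> 'j::finite \<Rightarrow> real" and b :: "'r \<Rightarrow> real"
  assumes R: "finite R"
  obtains L C where "L \<ge> 0" "C \<ge> 0" "\<And>D r \<rho> y. \<lbrakk>D \<ge> 0; \<And>j. r j \<ge> 0; \<rho> \<ge> 0; \<And>q. q \<in> R \<Longrightarrow> y q \<ge> 0;
      \<And>q. q \<in> R \<Longrightarrow> (\<Sum>j\<in>UNIV. a q j * r j) \<le> b q * \<rho> + y q + D\<rbrakk> \<Longrightarrow>
      \<exists>x. (\<forall>j. 0 \<le> x j \<and> x j \<le> r j \<and> r j - x j \<le> C * D) \<and>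
        (\<forall>q\<in>R. (\<Sum>j\<in>UNIV. a q j * x j) \<le> b q * max 0 (\<rho> - L * D) + y q)"
proof -
  define M where "M q v = (case v of None \<Rightarrow> - b q | Some j \<Rightarrow> a q j)" for q v
  have M: "(\<Sum>v\<in>UNIV. M q v * x v) = (\<Sum>j\<in>UNIV. a q j * x (Some j)) - b q * x None" for q x
    by (simp add: M_def sum_UNIV_option)
  obtain C where C: "C \<ge> 0" and H: "\<And>f l u x0 e. \<lbrakk>e \<ge> 0;
      \<exists>x. (\<forall>q\<in>R. (\<Sum>v\<in>UNIV. M q v * x v) \<le> f q) \<and> (\<forall>v. l v \<le> x v \<and> x v \<le> u v);
      \<forall>q\<in>R. (\<Sum>v\<in>UNIV. M q v * x0 v) \<le> f q + e; \<forall>v. l v - e \<le> x0 v \<and> x0 v \<le> u v + e\<rbrakk> \<Longrightarrow>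
     \<exists>x. (\<forall>q\<in>R. (\<Sum>v\<in>UNIV. M q v * x v) \<le> f q) \<and> (\<forall>v. l v \<le> x v \<and> x v \<le> u v) \<and>
       (\<forall>v. \<bar>x v - x0 v\<bar> \<le> C * e)"
    using that by (rule hoffman_box[OF R, of M])
  show ?thesis
  proof (rule that[of C "C * (1 + C)"])
    fix D :: real and r \<rho> y
    assume D: "D \<ge> 0" and r: "\<And>j. r j \<ge> 0" and \<rho>: "\<rho> \<ge> 0" and y: "\<And>q. q \<in> R \<Longrightarrow> y q \<ge> 0"
      and viol: "\<And>q. q \<in> R \<Longrightarrow> (\<Sum>j\<in>UNIV. a q j * r j) \<le> b q * \<rho> + y q + D"
    define x0 where "x0 v = (case v of None \<Rightarrow> \<rho> | Some j \<Rightarrow> r j)" for v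
    have x0: "x0 None = \<rho>" "x0 (Some j) = r j" for j by (simp_all add: x0_def)
    have x0nn: "x0 v \<ge> 0" for v using r \<rho> by (cases v) (auto simp: x0)
    have Mx0: "\<forall>q\<in>R. (\<Sum>v\<in>UNIV. M q v * x0 v) \<le> y q + D"
      unfolding M x0 using viol by (simp add: algebra_simps)
    have "\<exists>x. (\<forall>q\<in>R. (\<Sum>v\<in>UNIV. M q v * x v) \<le> y q) \<and> (\<forall>v. 0 \<le> x v \<and> x v \<le> x0 v) \<and>
        (\<forall>v. \<bar>x v - x0 v\<bar> \<le> C * D)"
    proof (rule H[OF D _ Mx0])
      show "\<exists>x. (\<forall>q\<in>R. (\<Sum>v\<in>UNIV. M q v * x v) \<le> y q) \<and> (\<forall>v. 0 \<le> x v \<and> x v \<le> x0 v)"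
        using y x0nn by (intro exI[of _ "\<lambda>_. 0"]) simp
      have "- D \<le> x0 v" for v using D x0nn[of v] by linarith
      then show "\<forall>v. 0 - D \<le> x0 v \<and> x0 v \<le> x0 v + D" using D by simp
    qed
    then obtain x where x: "\<forall>q\<in>R. (\<Sum>v\<in>UNIV. M q v * x v) \<le> y q" "\<forall>v. 0 \<le> x v \<and> x v \<le> x0 v"
        "\<forall>v. \<bar>x v - x0 v\<bar> \<le> C * D"
      by (elim exE conjE)
    \<comment> \<open>A lower bound for \<open>x None\<close> that does not depend on the solution
      found.\<close>
    define s where "s = max 0 (\<rho> - C * D)"
    have s: "0 \<le> s" "s \<le> x None" "s \<le> \<rho>" "\<rho> - s \<le> C * D"
      using x(2)[rule_format, of None] x(3)[rule_format, of None] \<rho> C D by (auto simp: s_def x0)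
    \<comment> \<open>If \<open>x None = 0\<close> then \<open>s = 0\<close>, so the default factor
      0 also satisfies \<open>t * x None = s\<close>.\<close>
    define t where "t = (if x None = 0 then 0 else s / x None)"
    have t: "0 \<le> t" "t \<le> 1" "t * x None = s"
      using s by (auto simp: t_def)
    define l u where "l v = (case v of None \<Rightarrow> s | Some j \<Rightarrow> 0)"
      and "u v = (case v of None \<Rightarrow> s | Some j \<Rightarrow> r j)" for v
    \<comment> \<open>scaling \<open>x\<close> keeps the constraints since \<open>y \<ge> 0\<close>, and makes the last coordinate exactly \<open>s\<close>\<close>
    have "\<forall>q\<in>R. (\<Sum>v\<in>UNIV. M q v * (t * x v)) \<le> y q"
    proof
      fix q assume q: "q \<in> R"
      have "(\<Sum>v\<in>UNIV. M q v * (t * x v)) = t * (\<Sum>v\<in>UNIV. M q v * x v)"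
        by (simp add: sum_distrib_left algebra_simps)
      also have "\<dots> \<le> t * y q" using x(1) q t by (intro mult_left_mono) auto
      also have "\<dots> \<le> y q" using y[OF q] t by (simp add: mult_left_le_one_le)
      finally show "(\<Sum>v\<in>UNIV. M q v * (t * x v)) \<le> y q" .
    qed
    moreover have "l v \<le> t * x v \<and> t * x v \<le> u v" for v
    proof (cases v)
      case None
      then show ?thesis using t by (simp add: l_def u_def)
    next
      case (Some j)
      have "t * x v \<le> x v" using t x(2) by (simp add: mult_left_le_one_le)
      then show ?thesis using t x(2)[rule_format, of v] Some by (simp add: l_def u_def x0)
    qed
    ultimately have ex: "\<exists>x. (\<forall>q\<in>R. (\<Sum>v\<in>UNIV. M q v * x v) \<le> y q) \<and> (\<forall>v. l v \<le> x v \<and> x v \<le> u v)"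
      by (intro exI[of _ "\<lambda>v. t * x v"]) simp
    \<comment> \<open>The target point misses the rows by at most \<open>D\<close> and the pinned
      coordinate by at most \<open>C * D\<close>. The sum of the two is the violation in the second
      application, hence the constant \<open>C * (1 + C)\<close>.\<close>
    have e: "0 \<le> (1 + C) * D" "D \<le> (1 + C) * D" "C * D \<le> (1 + C) * D"
      using C D by (auto simp: algebra_simps)
    have 1: "\<forall>q\<in>R. (\<Sum>v\<in>UNIV. M q v * x0 v) \<le> y q + (1 + C) * D"
      using Mx0 e by (metis add_left_mono order_trans)
    have 2: "l v - (1 + C) * D \<le> x0 v \<and> x0 v \<le> u v + (1 + C) * D" for v
    proof (cases v)
      case None
      then show ?thesis using s e unfolding l_def u_def option.case x0 None by linarith
    next
      case (Some j)
      then show ?thesis using e r[of j] unfolding l_def u_def option.case x0 Some by linarith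
    qed
    have "\<exists>x. (\<forall>q\<in>R. (\<Sum>v\<in>UNIV. M q v * x v) \<le> y q) \<and> (\<forall>v. l v \<le> x v \<and> x v \<le> u v) \<and>
        (\<forall>v. \<bar>x v - x0 v\<bar> \<le> C * ((1 + C) * D))"
      by (rule H[OF e(1) ex 1]) (intro allI 2)
    then obtain z where z: "\<forall>q\<in>R. (\<Sum>v\<in>UNIV. M q v * z v) \<le> y q" "\<And>v. l v \<le> z v \<and> z v \<le> u v"
       "\<And>v. \<bar>z v - x0 v\<bar> \<le> C * ((1 + C) * D)"
      by metis
    have "z None = s" using z(2)[of None] by (simp add: l_def u_def)
    then show "\<exists>x. (\<forall>j. 0 \<le> x j \<and> x j \<le> r j \<and> r j - x j \<le> C * (1 + C) * D) \<and>
        (\<forall>q\<in>R. (\<Sum>j\<in>UNIV. a q j * x j) \<le> b q * max 0 (\<rho> - C * D) + y q)"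
      using z(1)[unfolded M] z(2)[of "Some _"] z(3)[of "Some _"]
      by (intro exI[of _ "\<lambda>j. z (Some j)"]) (auto simp: l_def u_def x0 s_def abs_le_iff algebra_simps)
  qed (use C in auto)
qed

text \<open>At each step as much as possible of the residual \<open>V i - k i\<close> is moved to \<open>k\<close>, so errors do not
  accumulate; the price is the lag \<open>L * D\<close> in the parameter \<open>\<sigma>\<close> of the right-hand side.\<close>
lemma follow_path:
  fixes a :: "'r \<Rightarrow> 'j::finite \<Rightarrow> real" and b :: "'r \<Rightarrow> real"
  assumes R: "finite R"
  obtains L C where "L \<ge> 0" "C \<ge> 0" "\<And>D g V \<sigma>. \<lbrakk>D \<ge> 0; \<And>q. q \<in> R \<Longrightarrow> g q \<ge> 0;
      \<And>j. V 0 j \<ge> 0; \<And>i j. V i j \<le> V (Suc i) j; \<sigma> 0 \<ge> 0; \<And>i::nat. \<sigma> i \<le> \<sigma> (Suc i);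
      \<And>i q. q \<in> R \<Longrightarrow> (\<Sum>j\<in>UNIV. a q j * V i j) \<le> g q + b q * \<sigma> i + D\<rbrakk> \<Longrightarrow>
      \<exists>k. (\<forall>i j. 0 \<le> k i j \<and> k i j \<le> k (Suc i) j \<and> k i j \<le> V i j \<and> V i j - k i j \<le> C * D) \<and>
        (\<forall>i. \<forall>q\<in>R. (\<Sum>j\<in>UNIV. a q j * k i j) \<le> g q + b q * max 0 (\<sigma> i - L * D))"
proof (rule extract_step[OF R, of a b])
  fix L C :: real
  assume L: "L \<ge> 0" and C: "C \<ge> 0" and step: "\<And>D r \<rho> y. \<lbrakk>D \<ge> 0; \<And>j. r j \<ge> 0; \<rho> \<ge> 0; \<And>q. q \<in> R \<Longrightarrow> y q \<ge> 0;
      \<And>q. q \<in> R \<Longrightarrow> (\<Sum>j\<in>UNIV. a q j * r j) \<le> b q * \<rho> + y q + D\<rbrakk> \<Longrightarrow>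
      \<exists>x. (\<forall>j. 0 \<le> x j \<and> x j \<le> r j \<and> r j - x j \<le> C * D) \<and>
        (\<forall>q\<in>R. (\<Sum>j\<in>UNIV. a q j * x j) \<le> b q * max 0 (\<rho> - L * D) + y q)"
  show thesis
  proof (rule that[OF L C])
    fix D :: real and g V and \<sigma> :: "nat \<Rightarrow> real"
    assume D: "D \<ge> 0" and g: "\<And>q. q \<in> R \<Longrightarrow> g q \<ge> 0" and V0: "\<And>j. V 0 j \<ge> 0"
      and V: "\<And>i j. V i j \<le> V (Suc i) j" and \<sigma>0: "\<sigma> 0 \<ge> 0" and \<sigma>: "\<And>i. \<sigma> i \<le> \<sigma> (Suc i)"
      and viol: "\<And>i q. q \<in> R \<Longrightarrow> (\<Sum>j\<in>UNIV. a q j * V i j) \<le> g q + b q * \<sigma> i + D"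
    let ?P = "\<lambda>i k. (\<forall>j. 0 \<le> k j \<and> k j \<le> V i j \<and> V i j - k j \<le> C * D) \<and>
      (\<forall>q\<in>R. (\<Sum>j\<in>UNIV. a q j * k j) \<le> g q + b q * max 0 (\<sigma> i - L * D))"
    have ex0: "\<exists>k. ?P 0 k"
      using step[OF D V0 \<sigma>0 g, of "\<lambda>q. q"] viol[of _ 0]
      by (simp add: algebra_simps)
    have exS: "\<exists>k'. ?P (Suc i) k' \<and> (\<forall>j. k j \<le> k' j)" if k: "?P i k" for i k
    proof -
      \<comment> \<open>The amount of the parameter already used by \<open>k\<close>; the step
        starts from there and not from \<open>\<sigma> i\<close>.\<close>
      define \<kappa> where "\<kappa> = max 0 (\<sigma> i - L * D)"
      define r where "r j = V (Suc i) j - k j" for j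
      define y where "y q = g q + b q * \<kappa> - (\<Sum>j\<in>UNIV. a q j * k j)" for q
      have \<sigma>i: "\<sigma> i \<ge> 0" by (rule order_trans[OF \<sigma>0]) (simp add: lift_Suc_mono_le[of \<sigma>] \<sigma>)
      have \<kappa>: "\<kappa> \<le> \<sigma> i" using L D \<sigma>i by (simp add: \<kappa>_def)
      have r: "r j \<ge> 0" for j using k V[of i j] unfolding r_def by (meson diff_ge_0_iff_ge order_trans)
      have \<rho>: "\<sigma> (Suc i) - \<kappa> \<ge> 0" using \<kappa> \<sigma>[of i] by simp
      have y: "y q \<ge> 0" if "q \<in> R" for q using k that by (auto simp: y_def \<kappa>_def)
      have ar: "(\<Sum>j\<in>UNIV. a q j * r j) \<le> b q * (\<sigma> (Suc i) - \<kappa>) + y q + D" if "q \<in> R" for q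
        using viol[OF that, of "Suc i"] by (simp add: r_def y_def sum_subtractf algebra_simps)
      obtain x where x: "\<forall>j. 0 \<le> x j \<and> x j \<le> r j \<and> r j - x j \<le> C * D"
        "\<forall>q\<in>R. (\<Sum>j\<in>UNIV. a q j * x j) \<le> b q * max 0 (\<sigma> (Suc i) - \<kappa> - L * D) + y q"
        using step[OF D r \<rho> y ar] by blast
      \<comment> \<open>The lag of the new step is again counted from
        \<open>\<sigma> (Suc i)\<close>, so successive lags coincide instead of adding up.\<close>
      have "\<kappa> + max 0 (\<sigma> (Suc i) - \<kappa> - L * D) = max 0 (\<sigma> (Suc i) - L * D)"
        using \<sigma>[of i] by (auto simp: \<kappa>_def max_def)
      then have \<kappa>': "b q * max 0 (\<sigma> (Suc i) - \<kappa> - L * D) = b q * max 0 (\<sigma> (Suc i) - L * D) - b q * \<kappa>" for q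
        by (metis add_diff_cancel_left' right_diff_distrib)
      have "?P (Suc i) (\<lambda>j. k j + x j)"
      proof (intro conjI allI ballI)
        fix j
        show "0 \<le> k j + x j" using k x(1) by simp
        show "k j + x j \<le> V (Suc i) j" "V (Suc i) j - (k j + x j) \<le> C * D"
          using x(1)[rule_format, of j] by (auto simp: r_def)
      next
        fix q assume "q \<in> R"
        then show "(\<Sum>j\<in>UNIV. a q j * (k j + x j)) \<le> g q + b q * max 0 (\<sigma> (Suc i) - L * D)"
          using x(2) \<kappa>'[of q] by (fastforce simp: y_def distrib_left sum.distrib)
      qed
      then show ?thesis using x(1) by (intro exI[of _ "\<lambda>j. k j + x j"]) simp
    qed
    have "\<exists>k. \<forall>i. ?P i (k i) \<and> (\<forall>j. k i j \<le> k (Suc i) j)"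
      by (rule dependent_nat_choice[of ?P "\<lambda>i k k'. \<forall>j. k j \<le> k' j", OF ex0 exS])
    then show "\<exists>k. (\<forall>i j. 0 \<le> k i j \<and> k i j \<le> k (Suc i) j \<and> k i j \<le> V i j \<and> V i j - k i j \<le> C * D) \<and>
        (\<forall>i. \<forall>q\<in>R. (\<Sum>j\<in>UNIV. a q j * k i j) \<le> g q + b q * max 0 (\<sigma> i - L * D))"
      by blast
  qed
qed

text \<open>Matrices are plain functions so that the negated transpose
  \<open>\<lambda>j k. - A k j\<close> is one as well, and every result below applies to primal and
  dual alike.\<close>

definition app :: "('k \<Rightarrow> 'j::finite \<Rightarrow> real) \<Rightarrow> ('j \<Rightarrow> real) \<Rightarrow> 'k \<Rightarrow> real" where
  "app A x k = (\<Sum>j\<in>UNIV. A k j * x j)"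

lemma app_add: "app A (\<lambda>j. x j + y j) k = app A x k + app A y k"
  by (simp add: app_def sum.distrib algebra_simps)

lemma app_diff: "app A (\<lambda>j. x j - y j) k = app A x k - app A y k"
  by (simp add: app_def sum_subtractf algebra_simps)

lemma app_scale: "app A (\<lambda>j. c * x j) k = c * app A x k"
  by (simp add: app_def sum_distrib_left algebra_simps)

lemma app_uminus: "app (\<lambda>k j. - A k j) x k = - app A x k"
  by (simp add: app_def sum_negf)

lemmas app_simps = app_add app_diff app_scale

definition entry_sum :: "('k::finite \<Rightarrow> 'j::finite \<Rightarrow> real) \<Rightarrow> real" where
  "entry_sum A = (\<Sum>k\<in>UNIV. \<Sum>j\<in>UNIV. \<bar>A k j\<bar>)"

lemma entry_sum_nonneg: "entry_sum A \<ge> 0"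
  by (simp add: entry_sum_def sum_nonneg)

lemma abs_app_le:
  assumes "\<And>j. \<bar>x j\<bar> \<le> e" "e \<ge> 0"
  shows "\<bar>app A x k\<bar> \<le> entry_sum A * e"
proof -
  have "\<bar>app A x k\<bar> \<le> (\<Sum>j\<in>UNIV. \<bar>A k j\<bar> * e)"
    unfolding app_def using assms by (intro order_trans[OF sum_abs] sum_mono) (simp add: abs_mult mult_left_mono)
  also have "\<dots> = (\<Sum>j\<in>UNIV. \<bar>A k j\<bar>) * e" by (simp add: sum_distrib_right)
  also have "\<dots> \<le> entry_sum A * e"
    unfolding entry_sum_def
    by (intro mult_right_mono assms member_le_sum[of k UNIV "\<lambda>k. \<Sum>j\<in>UNIV. \<bar>A k j\<bar>"]) (auto simp: sum_nonneg)
  finally show ?thesis .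
qed

text \<open>On rows where the direction \<open>x1\<close> pays for the progress of \<open>\<sigma>\<close>, the lag of \<open>follow_path\<close> can be
  made up by adding a multiple of \<open>x1\<close>.\<close>
lemma follow_path_exact:
  fixes A :: "'k::finite \<Rightarrow> 'j::finite \<Rightarrow> real"
  assumes x1: "\<And>j. x1 j \<ge> 0" and Ax1: "\<And>k. k \<in> I \<Longrightarrow> app A x1 k \<le> b k"
  obtains C where "C \<ge> 0" "\<And>e g W \<sigma>. \<lbrakk>e \<ge> 0; \<And>k. k \<in> I \<Longrightarrow> g k \<ge> 0; \<And>j. W 0 j \<ge> - e;
      \<And>i j. W i j \<le> W (Suc i) j; \<And>i j. x1 j = 0 \<Longrightarrow> W i j \<le> 2 * e;
      \<sigma> 0 \<ge> 0; \<And>i::nat. \<sigma> i \<le> \<sigma> (Suc i); \<And>i k. k \<in> I \<Longrightarrow> app A (W i) k \<le> g k + b k * \<sigma> i + e\<rbrakk> \<Longrightarrow>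
      \<exists>Y. (\<forall>j. Y 0 j \<ge> 0) \<and> (\<forall>i j. Y i j \<le> Y (Suc i) j) \<and> (\<forall>i j. \<bar>Y i j - W i j\<bar> \<le> C * e) \<and>
        (\<forall>i. \<forall>k\<in>I. app A (Y i) k \<le> g k + b k * \<sigma> i) \<and> (\<forall>i j. x1 j = 0 \<longrightarrow> Y i j = 0)"
proof -
  \<comment> \<open>The row \<open>Inr i\<close> bounds coordinate \<open>i\<close> by 0 at all
    times. It is imposed where \<open>x1 i = 0\<close>: there no multiple of \<open>x1\<close> could
    correct anything, and the result has to vanish.\<close>
  define a' where "a' q = (case q of Inl k \<Rightarrow> A k | Inr i \<Rightarrow> (\<lambda>j. if j = i then 1 else 0))" for q :: "'k + 'j"
  define b' where "b' q = (case q of Inl k \<Rightarrow> b k | Inr i \<Rightarrow> 0)" for q :: "'k + 'j"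
  have a'1: "(\<Sum>j\<in>UNIV. a' (Inl k) j * x j) = app A x k" for k x by (simp add: a'_def app_def)
  have a'2: "(\<Sum>j\<in>UNIV. a' (Inr i) j * x j) = x i" for i x
    by (simp add: a'_def if_distrib[of "\<lambda>z. z * _"] cong: if_cong)
  have fR: "finite (Inl ` I \<union> Inr ` {j. x1 j = 0} :: ('k + 'j) set)" (is "finite ?R") by simp
  show ?thesis
  proof (rule follow_path[OF fR, of a' b'])
    fix L C :: real
    assume L: "L \<ge> 0" and C: "C \<ge> 0"
      and follow: "\<And>D g V \<sigma>. \<lbrakk>D \<ge> 0; \<And>q. q \<in> ?R \<Longrightarrow> g q \<ge> 0;
      \<And>j. V 0 j \<ge> 0; \<And>i j. V i j \<le> V (Suc i) j; \<sigma> 0 \<ge> 0; \<And>i::nat. \<sigma> i \<le> \<sigma> (Suc i);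
      \<And>i q. q \<in> ?R \<Longrightarrow> (\<Sum>j\<in>UNIV. a' q j * V i j) \<le> g q + b' q * \<sigma> i + D\<rbrakk> \<Longrightarrow>
      \<exists>k. (\<forall>i j. 0 \<le> k i j \<and> k i j \<le> k (Suc i) j \<and> k i j \<le> V i j \<and> V i j - k i j \<le> C * D) \<and>
        (\<forall>i. \<forall>q\<in>?R. (\<Sum>j\<in>UNIV. a' q j * k i j) \<le> g q + b' q * max 0 (\<sigma> i - L * D))"
    \<comment> \<open>The path is shifted by \<open>e\<close> to become nonnegative. The shift
      raises the violation of the matrix rows to at most \<open>e + entry_sum A * e\<close>, and
      that of the coordinate rows to \<open>3 * e\<close>.\<close>
    define D0 where "D0 = 3 + entry_sum A"
    have D0: "D0 \<ge> 3" by (simp add: D0_def entry_sum_nonneg)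
    define B where "B = (\<Sum>j\<in>UNIV. x1 j)"
    have B: "x1 j \<le> B" "B \<ge> 0" for j
      using x1 member_le_sum[of j UNIV x1] by (auto simp: B_def sum_nonneg)
    \<comment> \<open>The three summands pay for the shift, for the residual left by
      \<open>follow_path\<close>, and for the compensation along \<open>x1\<close>.\<close>
    have Cnn: "1 + C * D0 + L * D0 * B \<ge> 0" using C L D0 B by (simp add: add_nonneg_nonneg)
    show thesis
    proof (rule that[OF Cnn])
      fix e g W and \<sigma> :: "nat \<Rightarrow> real"
      assume e: "e \<ge> 0" and g: "\<And>k. k \<in> I \<Longrightarrow> g k \<ge> 0" and W0: "\<And>j. W 0 j \<ge> - e"
        and W: "\<And>i j. W i j \<le> W (Suc i) j" and WN: "\<And>i j. x1 j = 0 \<Longrightarrow> W i j \<le> 2 * e"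
        and \<sigma>0: "\<sigma> 0 \<ge> 0" and \<sigma>: "\<And>i::nat. \<sigma> i \<le> \<sigma> (Suc i)"
        and viol: "\<And>i k. k \<in> I \<Longrightarrow> app A (W i) k \<le> g k + b k * \<sigma> i + e"
      define D where "D = D0 * e"
      have D: "D \<ge> 0" "3 * e \<le> D" using D0 e by (auto simp: D_def mult_right_mono)
      define g' where "g' q = (case q of Inl k \<Rightarrow> g k | Inr i \<Rightarrow> 0)" for q :: "'k + 'j"
      have "\<exists>k. (\<forall>i j. 0 \<le> k i j \<and> k i j \<le> k (Suc i) j \<and> k i j \<le> W i j + e \<and> W i j + e - k i j \<le> C * D) \<and>
        (\<forall>i. \<forall>q\<in>?R. (\<Sum>j\<in>UNIV. a' q j * k i j) \<le> g' q + b' q * max 0 (\<sigma> i - L * D))"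
      proof (rule follow[OF D(1) _ _ _ \<sigma>0 \<sigma>])
        show "g' q \<ge> 0" if "q \<in> ?R" for q using that g by (auto simp: g'_def)
        show "0 \<le> W 0 j + e" for j using W0[of j] by simp
        show "W i j + e \<le> W (Suc i) j + e" for i j using W by simp
        fix i q assume "q \<in> ?R"
        then consider k where "k \<in> I" "q = Inl k" | j where "x1 j = 0" "q = Inr j" by auto
        then show "(\<Sum>j\<in>UNIV. a' q j * (W i j + e)) \<le> g' q + b' q * \<sigma> i + D"
        proof cases
          case 1
          have "\<bar>app A (\<lambda>_. e) k\<bar> \<le> entry_sum A * e" using e by (intro abs_app_le) auto
          moreover have "D = 3 * e + entry_sum A * e" by (simp add: D_def D0_def algebra_simps)
          ultimately show ?thesis unfolding 1(2) a'1 app_add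
            using viol[OF 1(1), of i] e by (simp add: g'_def b'_def)
        next
          case 2
          then show ?thesis unfolding 2(2) a'2 using WN[OF 2(1), of i] D by (simp add: g'_def b'_def)
        qed
      qed
      then obtain k where k: "\<forall>i j. 0 \<le> k i j \<and> k i j \<le> k (Suc i) j \<and> k i j \<le> W i j + e \<and> W i j + e - k i j \<le> C * D"
        and ak: "\<forall>i. \<forall>q\<in>?R. (\<Sum>j\<in>UNIV. a' q j * k i j) \<le> g' q + b' q * max 0 (\<sigma> i - L * D)"
        by (elim exE conjE)
      have LD: "L * D \<ge> 0" using L D by simp
      have \<sigma>nn: "\<sigma> i \<ge> 0" for i by (rule order_trans[OF \<sigma>0]) (simp add: lift_Suc_mono_le[of \<sigma>] \<sigma>)
      \<comment> \<open>The missing parameter: it complements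
        \<open>max 0 (\<sigma> i - L * D)\<close> to \<open>\<sigma> i\<close> and is itself
        nondecreasing, so adding \<open>lg i * x1\<close> keeps the path monotone.\<close>
      define lg where "lg i = min (\<sigma> i) (L * D)" for i
      have lg: "0 \<le> lg i" "lg i \<le> L * D" "lg i \<le> lg (Suc i)" "max 0 (\<sigma> i - L * D) + lg i = \<sigma> i" for i
        using \<sigma>nn[of i] LD \<sigma>[of i] by (auto simp: lg_def)
      define Y where "Y i j = k i j + lg i * x1 j" for i j
      show "\<exists>Y. (\<forall>j. Y 0 j \<ge> 0) \<and> (\<forall>i j. Y i j \<le> Y (Suc i) j) \<and>
          (\<forall>i j. \<bar>Y i j - W i j\<bar> \<le> (1 + C * D0 + L * D0 * B) * e) \<and>
          (\<forall>i. \<forall>k\<in>I. app A (Y i) k \<le> g k + b k * \<sigma> i) \<and> (\<forall>i j. x1 j = 0 \<longrightarrow> Y i j = 0)"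
      proof (intro exI[of _ Y] conjI allI ballI impI)
        fix j show "Y 0 j \<ge> 0" using k lg(1) x1 by (simp add: Y_def)
      next
        fix i j
        show "Y i j \<le> Y (Suc i) j"
          unfolding Y_def using k lg(3) x1 by (intro add_mono mult_right_mono) auto
        have "lg i * x1 j \<le> L * D * B" by (intro mult_mono lg B x1 LD)
        moreover have "0 \<le> lg i * x1 j" using lg x1 by simp
        moreover have "k i j \<le> W i j + e" "W i j + e - k i j \<le> C * D" using k by auto
        moreover have "(1 + C * D0 + L * D0 * B) * e = e + C * D + L * D * B"
          by (simp add: D_def algebra_simps)
        moreover have "0 \<le> C * D" "0 \<le> L * D * B" using C D LD B by auto
        ultimately show "\<bar>Y i j - W i j\<bar> \<le> (1 + C * D0 + L * D0 * B) * e"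
          unfolding Y_def abs_le_iff using e by linarith
      next
        fix i k' assume k': "k' \<in> I"
        have "app A (k i) k' \<le> g k' + b k' * max 0 (\<sigma> i - L * D)"
          using ak[rule_format, of "Inl k'" i] k' by (simp add: a'1 g'_def b'_def)
        moreover have "lg i * app A x1 k' \<le> lg i * b k'" using lg Ax1[OF k'] by (intro mult_left_mono)
        moreover have "b k' * max 0 (\<sigma> i - L * D) + lg i * b k' = b k' * \<sigma> i"
          using lg(4)[of i] by (metis distrib_left mult.commute)
        ultimately show "app A (Y i) k' \<le> g k' + b k' * \<sigma> i"
          unfolding Y_def app_simps by linarith
      next
        fix i j assume j: "x1 j = 0"
        have "k i j \<le> 0" using ak[rule_format, of "Inr j" i] j by (simp add: a'2 g'_def b'_def)
        then show "Y i j = 0" using k j by (simp add: Y_def order_antisym)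
      qed
    qed
  qed
qed

text \<open>With rate 0 the right-hand side does not see the lag, so no compensating direction is
  required.\<close>

lemma follow_path_homogeneous:
  fixes A :: "'k::finite \<Rightarrow> 'j::finite \<Rightarrow> real"
  obtains C where "C \<ge> 0" "\<And>D V. \<lbrakk>D \<ge> 0; \<And>j. V 0 j \<ge> 0; \<And>(i::nat) j. V i j \<le> V (Suc i) j;
      \<And>i k. app A (V i) k \<le> D\<rbrakk> \<Longrightarrow>
      \<exists>h. (\<forall>j. h 0 j \<ge> 0) \<and> (\<forall>i j. h i j \<le> h (Suc i) j) \<and> (\<forall>i j. \<bar>h i j - V i j\<bar> \<le> C * D) \<and>
        (\<forall>i k. app A (h i) k \<le> 0)"
proof (rule follow_path[OF finite[of UNIV], of A "\<lambda>_. 0"])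
  fix L C :: real
  assume C: "C \<ge> 0"
    and follow: "\<And>D g V \<sigma>. \<lbrakk>D \<ge> 0; \<And>q::'k. q \<in> UNIV \<Longrightarrow> g q \<ge> 0;
      \<And>j. V 0 j \<ge> 0; \<And>i j. V i j \<le> V (Suc i) j; \<sigma> 0 \<ge> 0; \<And>i::nat. \<sigma> i \<le> \<sigma> (Suc i);
      \<And>i q. q \<in> UNIV \<Longrightarrow> (\<Sum>j\<in>UNIV. A q j * V i j) \<le> g q + 0 * \<sigma> i + D\<rbrakk> \<Longrightarrow>
      \<exists>k. (\<forall>i j. 0 \<le> k i j \<and> k i j \<le> k (Suc i) j \<and> k i j \<le> V i j \<and> V i j - k i j \<le> C * D) \<and>
        (\<forall>i. \<forall>q\<in>UNIV. (\<Sum>j\<in>UNIV. A q j * k i j) \<le> g q + 0 * max 0 (\<sigma> i - L * D))"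
  show thesis
  proof (rule that[OF C])
    fix D V assume D: "D \<ge> 0" and V: "\<And>j. V 0 j \<ge> 0" "\<And>(i::nat) j. V i j \<le> V (Suc i) j"
      and AV: "\<And>i k. app A (V i) k \<le> D"
    have "\<exists>k. (\<forall>i j. 0 \<le> k i j \<and> k i j \<le> k (Suc i) j \<and> k i j \<le> V i j \<and> V i j - k i j \<le> C * D) \<and>
        (\<forall>i. \<forall>q\<in>UNIV. (\<Sum>j\<in>UNIV. A q j * k i j) \<le> 0 + 0 * max 0 (0 - L * D))"
      by (rule follow[where \<sigma> = "\<lambda>_. 0" and g = "\<lambda>_. 0"]) (use D V AV in \<open>simp_all add: app_def\<close>)
    then show "\<exists>h. (\<forall>j. h 0 j \<ge> 0) \<and> (\<forall>i j. h i j \<le> h (Suc i) j) \<and> (\<forall>i j. \<bar>h i j - V i j\<bar> \<le> C * D) \<and>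
        (\<forall>i k. app A (h i) k \<le> 0)"
      by (elim ex_forward) (auto simp: app_def)
  qed
qed

subsection \<open>Repairing an approximately feasible path\<close>

text \<open>Both sides of the constraint on \<open>x0 + t * x1\<close> are affine in
  \<open>t\<close>, so the two ends of the interval suffice; \<open>x1 \<ge> 0\<close> makes the
  path nondecreasing.\<close>

definition affine_feasible ::
    "('k \<Rightarrow> 'j::finite \<Rightarrow> real) \<Rightarrow> ('k \<Rightarrow> real) \<Rightarrow> ('k \<Rightarrow> real) \<Rightarrow> real \<Rightarrow> ('j \<Rightarrow> real) \<Rightarrow> ('j \<Rightarrow> real) \<Rightarrow> bool" where
  "affine_feasible A \<beta> b T x0 x1 \<longleftrightarrow> (\<forall>j. 0 \<le> x0 j \<and> 0 \<le> x1 j) \<and> (\<forall>k. app A x0 k \<le> \<beta> k) \<and>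
     (\<forall>k. app A x0 k + T * app A x1 k \<le> \<beta> k + T * b k)"

text \<open>The average of two feasible pairs is feasible, and the support of its slope is the union
  of the two supports. Finitely many averages therefore reach a slope that is positive wherever any
  feasible slope is.\<close>

lemma affine_feasible_max_support:
  assumes "affine_feasible A \<beta> b T x0 x1"
  obtains y0 y1 where "affine_feasible A \<beta> b T y0 y1"
    "\<And>z0 z1 j. affine_feasible A \<beta> b T z0 z1 \<Longrightarrow> y1 j = 0 \<Longrightarrow> z1 j = 0"
proof -
  let ?F = "affine_feasible A \<beta> b T"
  have "\<exists>y0 y1. ?F y0 y1 \<and> (\<forall>j\<in>S. \<forall>z0 z1. ?F z0 z1 \<longrightarrow> y1 j = 0 \<longrightarrow> z1 j = 0)" if "finite S" for S
    using that
  proof (induction S rule: finite_induct)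
    case empty
    then show ?case using assms by blast
  next
    case (insert i S)
    then obtain y0 y1 where y: "?F y0 y1" "\<forall>j\<in>S. \<forall>z0 z1. ?F z0 z1 \<longrightarrow> y1 j = 0 \<longrightarrow> z1 j = 0" by blast
    show ?case
    proof (cases "\<forall>z0 z1. ?F z0 z1 \<longrightarrow> z1 i = 0")
      case True
      then show ?thesis using y by (intro exI[of _ y0] exI[of _ y1]) simp
    next
      case False
      then obtain z0 z1 where z: "?F z0 z1" "z1 i \<noteq> 0" by blast
      define w0 where "w0 j = (1/2) * y0 j + (1/2) * z0 j" for j
      define w1 where "w1 j = (1/2) * y1 j + (1/2) * z1 j" for j
      have nn: "0 \<le> y1 j" "0 \<le> z1 j" for j using y(1) z(1) by (auto simp: affine_feasible_def)
      have zero: "w1 j = 0 \<Longrightarrow> y1 j = 0 \<and> z1 j = 0" for j using nn[of j] by (simp add: w1_def)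
      have "?F w0 w1"
        unfolding affine_feasible_def
      proof (intro conjI allI)
        fix j show "0 \<le> w0 j" "0 \<le> w1 j"
          using y(1) z(1) by (auto simp: affine_feasible_def w0_def w1_def add_nonneg_nonneg)
      next
        fix k
        have 1: "app A y0 k \<le> \<beta> k" "app A y0 k + T * app A y1 k \<le> \<beta> k + T * b k"
          using y(1) by (auto simp: affine_feasible_def)
        have 2: "app A z0 k \<le> \<beta> k" "app A z0 k + T * app A z1 k \<le> \<beta> k + T * b k"
          using z(1) by (auto simp: affine_feasible_def)
        show "app A w0 k \<le> \<beta> k" using 1 2 unfolding w0_def app_simps by linarith
        have "T * app A w1 k = (1/2) * (T * app A y1 k) + (1/2) * (T * app A z1 k)"
          unfolding w1_def app_simps by (simp add: algebra_simps)
        then show "app A w0 k + T * app A w1 k \<le> \<beta> k + T * b k"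
          using 1 2 unfolding w0_def app_simps by linarith
      qed
      moreover have "z1' j = 0" if "j \<in> insert i S" "?F z0' z1'" "w1 j = 0" for j z0' z1'
      proof (cases "j = i")
        case True
        then show ?thesis using zero[of i] z(2) that(3) by simp
      next
        case False
        then show ?thesis using y(2) zero[OF that(3)] that by blast
      qed
      ultimately show ?thesis by blast
    qed
  qed
  from this[of UNIV] show ?thesis using that by auto
qed

lemma sum_UNIV_Plus:
  fixes g :: "'a::finite + 'b::finite \<Rightarrow> real"
  shows "(\<Sum>v\<in>UNIV. g v) = (\<Sum>a\<in>UNIV. g (Inl a)) + (\<Sum>b\<in>UNIV. g (Inr b))"
  using sum.Plus[of UNIV UNIV g] by (simp add: comp_def)

text \<open>Only the rows at times \<open>0\<close> and \<open>T\<close> occur, and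
  \<open>\<theta>\<close> enters the right-hand side alone; hence a single constant for all
  \<open>\<theta>\<close>.\<close>

lemma affine_feasible_error_bound:
  fixes A :: "'k::finite \<Rightarrow> 'j::finite \<Rightarrow> real"
  assumes ex: "affine_feasible A \<beta> b T x0 x1"
  obtains C where "C \<ge> 0" "\<And>\<theta> \<xi> v0 v1. \<lbrakk>\<theta> \<ge> 0; \<xi> \<ge> 0; \<And>j. v0 j \<ge> 0; \<And>j. v1 j \<ge> 0;
      \<And>k. app A v0 k \<le> \<theta> * \<beta> k + \<xi>; \<And>k. app A v0 k + T * app A v1 k \<le> \<theta> * (\<beta> k + T * b k) + \<xi>\<rbrakk> \<Longrightarrow>
      \<exists>z0 z1. affine_feasible A (\<lambda>k. \<theta> * \<beta> k) (\<lambda>k. \<theta> * b k) T z0 z1 \<and>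
        (\<forall>j. \<bar>z0 j - v0 j\<bar> \<le> C * \<xi>) \<and> (\<forall>j. \<bar>z1 j - v1 j\<bar> \<le> C * \<xi>)"
proof -
  define M where "M q v = (case q of (k, s) \<Rightarrow> (case v of Inl j \<Rightarrow> A k j | Inr j \<Rightarrow> (if s then T * A k j else 0)))"
    for q :: "'k \<times> bool" and v :: "'j + 'j"
  have M: "(\<Sum>v\<in>UNIV. M (k, s) v * x v) =
      app A (\<lambda>j. x (Inl j)) k + (if s then T * app A (\<lambda>j. x (Inr j)) k else 0)" for k s x
    unfolding sum_UNIV_Plus
    by (simp add: M_def app_def sum_distrib_left algebra_simps)
  show ?thesis
  proof (rule hoffman_box[OF finite[of UNIV], of M])
    fix C :: real
    assume C: "C \<ge> 0" and H: "\<And>f l u x0 e. \<lbrakk>e \<ge> 0;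
      \<exists>x. (\<forall>q\<in>UNIV. (\<Sum>v\<in>UNIV. M q v * x v) \<le> f q) \<and> (\<forall>v. l v \<le> x v \<and> x v \<le> u v);
      \<forall>q\<in>UNIV. (\<Sum>v\<in>UNIV. M q v * x0 v) \<le> f q + e; \<forall>v. l v - e \<le> x0 v \<and> x0 v \<le> u v + e\<rbrakk> \<Longrightarrow>
     \<exists>x. (\<forall>q\<in>UNIV. (\<Sum>v\<in>UNIV. M q v * x v) \<le> f q) \<and> (\<forall>v. l v \<le> x v \<and> x v \<le> u v) \<and>
       (\<forall>v. \<bar>x v - x0 v\<bar> \<le> C * e)"
    show thesis
    proof (rule that[OF C])
      fix \<theta> \<xi> :: real and v0 v1
      assume \<theta>: "\<theta> \<ge> 0" and \<xi>: "\<xi> \<ge> 0" and v: "\<And>j. v0 j \<ge> 0" "\<And>j. v1 j \<ge> 0"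
        and viol: "\<And>k. app A v0 k \<le> \<theta> * \<beta> k + \<xi>"
          "\<And>k. app A v0 k + T * app A v1 k \<le> \<theta> * (\<beta> k + T * b k) + \<xi>"
      define f where "f q = (case q of (k, s) \<Rightarrow> \<theta> * (\<beta> k + (if s then T * b k else 0)))" for q :: "'k \<times> bool"
      define y where "y v = (case v of Inl j \<Rightarrow> \<theta> * x0 j | Inr j \<Rightarrow> \<theta> * x1 j)" for v
      define w where "w v = (case v of Inl j \<Rightarrow> v0 j | Inr j \<Rightarrow> v1 j)" for v
      have feas: "app A x0 k \<le> \<beta> k" "app A x0 k + T * app A x1 k \<le> \<beta> k + T * b k" for k
        using ex by (auto simp: affine_feasible_def)
      have w: "w v \<ge> 0" for v using v by (simp add: w_def split: sum.split)
      \<comment> \<open>The upper bounds \<open>max (y v) (w v)\<close> merely fit the box format: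
        they admit the exact solution \<open>y\<close> as well as the given point
        \<open>w\<close>.\<close>
      have "\<exists>x. (\<forall>q\<in>UNIV. (\<Sum>v\<in>UNIV. M q v * x v) \<le> f q) \<and> (\<forall>v. 0 \<le> x v \<and> x v \<le> max (y v) (w v)) \<and>
       (\<forall>v. \<bar>x v - w v\<bar> \<le> C * \<xi>)"
      proof (rule H[OF \<xi>])
        show "\<exists>x. (\<forall>q\<in>UNIV. (\<Sum>v\<in>UNIV. M q v * x v) \<le> f q) \<and> (\<forall>v. 0 \<le> x v \<and> x v \<le> max (y v) (w v))"
        proof (intro exI[of _ y] conjI ballI allI)
          fix q :: "'k \<times> bool"
          obtain k s where q: "q = (k, s)" by force
          have "\<theta> * app A x0 k \<le> \<theta> * \<beta> k" using feas \<theta> by (intro mult_left_mono) auto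
          moreover have "\<theta> * (app A x0 k + T * app A x1 k) \<le> \<theta> * (\<beta> k + T * b k)"
            using feas \<theta> by (intro mult_left_mono) auto
          ultimately show "(\<Sum>v\<in>UNIV. M q v * y v) \<le> f q"
            unfolding q M by (simp add: y_def f_def app_simps algebra_simps)
        next
          fix v show "0 \<le> y v" using \<theta> ex by (auto simp: y_def affine_feasible_def split: sum.split)
        qed simp
        show "\<forall>q\<in>UNIV. (\<Sum>v\<in>UNIV. M q v * w v) \<le> f q + \<xi>"
        proof
          fix q :: "'k \<times> bool"
          obtain k s where q: "q = (k, s)" by force
          show "(\<Sum>v\<in>UNIV. M q v * w v) \<le> f q + \<xi>"
            unfolding q M using viol[of k] by (simp add: w_def f_def)
        qed
        show "\<forall>v. 0 - \<xi> \<le> w v \<and> w v \<le> max (y v) (w v) + \<xi>"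
        proof
          fix v show "0 - \<xi> \<le> w v \<and> w v \<le> max (y v) (w v) + \<xi>" using w[of v] \<xi> by linarith
        qed
      qed
      then obtain x where x: "\<forall>q. (\<Sum>v\<in>UNIV. M q v * x v) \<le> f q" "\<forall>v. 0 \<le> x v" "\<forall>v. \<bar>x v - w v\<bar> \<le> C * \<xi>"
        by blast
      have "app A (\<lambda>j. x (Inl j)) k \<le> \<theta> * \<beta> k" for k
        using x(1)[rule_format, of "(k, False)"] unfolding M by (simp add: f_def)
      moreover have "app A (\<lambda>j. x (Inl j)) k + T * app A (\<lambda>j. x (Inr j)) k \<le> \<theta> * \<beta> k + T * (\<theta> * b k)" for k
        using x(1)[rule_format, of "(k, True)"] unfolding M by (simp add: f_def algebra_simps)
      ultimately have "affine_feasible A (\<lambda>k. \<theta> * \<beta> k) (\<lambda>k. \<theta> * b k) T (\<lambda>j. x (Inl j)) (\<lambda>j. x (Inr j))"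
        using x(2) by (simp add: affine_feasible_def)
      moreover have "\<bar>x (Inl j) - v0 j\<bar> \<le> C * \<xi>" "\<bar>x (Inr j) - v1 j\<bar> \<le> C * \<xi>" for j
        using x(3)[rule_format, of "Inl j"] x(3)[rule_format, of "Inr j"] by (simp_all add: w_def)
      ultimately show "\<exists>z0 z1. affine_feasible A (\<lambda>k. \<theta> * \<beta> k) (\<lambda>k. \<theta> * b k) T z0 z1 \<and>
        (\<forall>j. \<bar>z0 j - v0 j\<bar> \<le> C * \<xi>) \<and> (\<forall>j. \<bar>z1 j - v1 j\<bar> \<le> C * \<xi>)" by blast
    qed
  qed
qed

text \<open>\<open>F\<close> repairs the rows that are tight for the reference path \<open>x0 + t * x1\<close> at time \<open>0\<close>; \<open>G\<close> does the
  same for time \<open>T\<close>, by following the time-reversed complement \<open>Z - V\<close>.\<close>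
lemma repair_at_ends:
  fixes A :: "'k::finite \<Rightarrow> 'j::finite \<Rightarrow> real"
  assumes T: "T > 0" and feas: "affine_feasible A \<beta> b T x0 x1"
    and supp: "\<And>z0 z1 j. affine_feasible A \<beta> b T z0 z1 \<Longrightarrow> x1 j = 0 \<Longrightarrow> z1 j = 0"
  obtains C where "C \<ge> 0" "\<And>\<theta> \<xi> V t n. \<lbrakk>\<theta> \<ge> 0; \<xi> \<ge> 0; t 0 = 0; \<And>i::nat. t i \<le> t (Suc i); \<And>i. i \<ge> n \<Longrightarrow> t i = T;
      \<And>j. V 0 j \<ge> 0; \<And>i j. V i j \<le> V (Suc i) j; \<And>i. i \<ge> n \<Longrightarrow> V i = V n;
      \<And>i k. app A (V i) k \<le> \<theta> * (\<beta> k + b k * t i) + \<xi>\<rbrakk> \<Longrightarrow>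
      \<exists>F G. (\<forall>j. F 0 j \<ge> 0) \<and> (\<forall>i j. F i j \<le> F (Suc i) j \<and> G i j \<le> G (Suc i) j) \<and>
        (\<forall>i j. \<bar>F i j - V i j\<bar> \<le> C * \<xi> \<and> \<bar>G i j - V i j\<bar> \<le> C * \<xi>) \<and>
        (\<forall>i k. app A x0 k = \<beta> k \<longrightarrow> app A (F i) k \<le> \<theta> * (\<beta> k + b k * t i)) \<and>
        (\<forall>i k. app A x0 k + T * app A x1 k = \<beta> k + T * b k \<longrightarrow> app A (G i) k \<le> \<theta> * (\<beta> k + b k * t i)) \<and>
        (\<forall>i i' j. x1 j = 0 \<longrightarrow> F i j = G i' j)"
proof (rule affine_feasible_error_bound[OF feas])
  fix C1 :: real
  assume C1: "C1 \<ge> 0" and bound: "\<And>\<theta> \<xi> v0 v1. \<lbrakk>\<theta> \<ge> 0; \<xi> \<ge> 0; \<And>j. v0 j \<ge> 0; \<And>j. v1 j \<ge> 0;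
      \<And>k. app A v0 k \<le> \<theta> * \<beta> k + \<xi>; \<And>k. app A v0 k + T * app A v1 k \<le> \<theta> * (\<beta> k + T * b k) + \<xi>\<rbrakk> \<Longrightarrow>
      \<exists>z0 z1. affine_feasible A (\<lambda>k. \<theta> * \<beta> k) (\<lambda>k. \<theta> * b k) T z0 z1 \<and>
        (\<forall>j. \<bar>z0 j - v0 j\<bar> \<le> C1 * \<xi>) \<and> (\<forall>j. \<bar>z1 j - v1 j\<bar> \<le> C1 * \<xi>)"
  have x1: "0 \<le> x1 j" for j using feas by (simp add: affine_feasible_def)
  define I0 where "I0 = {k. app A x0 k = \<beta> k}"
  define IT where "IT = {k. app A x0 k + T * app A x1 k = \<beta> k + T * b k}"
  have feas_k: "app A x0 k \<le> \<beta> k" "app A x0 k + T * app A x1 k \<le> \<beta> k + T * b k" for k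
    using feas by (auto simp: affine_feasible_def)
  \<comment> \<open>A row tight at \<open>0\<close> and satisfied at \<open>T\<close> cannot grow
    faster than its right-hand side; a row tight at \<open>T\<close> and satisfied at
    \<open>0\<close> cannot grow more slowly. These are the hypotheses of
    \<open>follow_path_exact\<close> for \<open>A\<close> and for \<open>- A\<close>.\<close>
  have pay0: "app A x1 k \<le> b k" if "k \<in> I0" for k
    using feas_k(2)[of k] that T by (simp add: I0_def)
  have payT: "app (\<lambda>k j. - A k j) x1 k \<le> - b k" if "k \<in> IT" for k
  proof -
    have "T * b k \<le> T * app A x1 k" using feas_k(1)[of k] that by (simp add: IT_def)
    then show ?thesis using T by (simp add: app_uminus)
  qed
  show thesis
  proof (rule follow_path_exact[where b = b, OF x1 pay0], assumption)
    fix CF :: real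
    assume CF: "CF \<ge> 0" and forward: "\<And>e g W \<sigma>. \<lbrakk>e \<ge> 0; \<And>k. k \<in> I0 \<Longrightarrow> g k \<ge> 0; \<And>j. W 0 j \<ge> - e;
      \<And>i j. W i j \<le> W (Suc i) j; \<And>i j. x1 j = 0 \<Longrightarrow> W i j \<le> 2 * e;
      \<sigma> 0 \<ge> 0; \<And>i::nat. \<sigma> i \<le> \<sigma> (Suc i); \<And>i k. k \<in> I0 \<Longrightarrow> app A (W i) k \<le> g k + b k * \<sigma> i + e\<rbrakk> \<Longrightarrow>
      \<exists>Y. (\<forall>j. Y 0 j \<ge> 0) \<and> (\<forall>i j. Y i j \<le> Y (Suc i) j) \<and> (\<forall>i j. \<bar>Y i j - W i j\<bar> \<le> CF * e) \<and>
        (\<forall>i. \<forall>k\<in>I0. app A (Y i) k \<le> g k + b k * \<sigma> i) \<and> (\<forall>i j. x1 j = 0 \<longrightarrow> Y i j = 0)"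
    show thesis
    proof (rule follow_path_exact[where A = "\<lambda>k j. - A k j" and b = "\<lambda>k. - b k", OF x1 payT], assumption)
      fix CG :: real
      assume CG: "CG \<ge> 0" and backward: "\<And>e g W \<sigma>. \<lbrakk>e \<ge> 0; \<And>k. k \<in> IT \<Longrightarrow> g k \<ge> 0; \<And>j. W 0 j \<ge> - e;
        \<And>i j. W i j \<le> W (Suc i) j; \<And>i j. x1 j = 0 \<Longrightarrow> W i j \<le> 2 * e;
        \<sigma> 0 \<ge> 0; \<And>i::nat. \<sigma> i \<le> \<sigma> (Suc i); \<And>i k. k \<in> IT \<Longrightarrow> app (\<lambda>k j. - A k j) (W i) k \<le> g k + - b k * \<sigma> i + e\<rbrakk> \<Longrightarrow>
        \<exists>Y. (\<forall>j. Y 0 j \<ge> 0) \<and> (\<forall>i j. Y i j \<le> Y (Suc i) j) \<and> (\<forall>i j. \<bar>Y i j - W i j\<bar> \<le> CG * e) \<and>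
          (\<forall>i. \<forall>k\<in>IT. app (\<lambda>k j. - A k j) (Y i) k \<le> g k + - b k * \<sigma> i) \<and> (\<forall>i j. x1 j = 0 \<longrightarrow> Y i j = 0)"
      \<comment> \<open>The summands cover the violation \<open>\<xi>\<close>, the displacement of
        the initial value by the error bound, and that of the total growth over length
        \<open>T\<close>.\<close>
      define C2 where "C2 = 1 + C1 + T * C1"
      have C2: "C2 \<ge> 1" using C1 T by (simp add: C2_def)
      show thesis
      proof (rule that[of "(CF + CG) * C2"])
        show "0 \<le> (CF + CG) * C2" using CF CG C2 by simp
        fix \<theta> \<xi> :: real and V t and n :: nat
        assume \<theta>: "\<theta> \<ge> 0" and \<xi>: "\<xi> \<ge> 0" and t0: "t 0 = 0" and t: "\<And>i::nat. t i \<le> t (Suc i)"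
          and tn: "\<And>i. i \<ge> n \<Longrightarrow> t i = T" and V0: "\<And>j. V 0 j \<ge> 0" and V: "\<And>i j. V i j \<le> V (Suc i) j"
          and Vn: "\<And>i. i \<ge> n \<Longrightarrow> V i = V n"
          and viol: "\<And>i k. app A (V i) k \<le> \<theta> * (\<beta> k + b k * t i) + \<xi>"
        have V0le: "V 0 j \<le> V i j" for i j using lift_Suc_mono_le[of "\<lambda>i. V i j" 0 i, OF V] by simp
        have Vle: "V i j \<le> V n j" for i j
        proof (cases "i \<le> n")
          case True
          then show ?thesis using lift_Suc_mono_le[of "\<lambda>i. V i j" i n, OF V] by simp
        next
          case False
          then show ?thesis using Vn[of i] by simp
        qed
        \<comment> \<open>Subtraction truncates: for \<open>i > n\<close> the double reversal yields
          \<open>n\<close>, which is harmless since path and grid are constant from \<open>n\<close>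
          on.\<close>
        have rev: "V (n - (n - i)) = V i" "t (n - (n - i)) = t i" for i
        proof -
          have "n - (n - i) = i \<or> n \<le> i \<and> n - (n - i) = n" by linarith
          then show "V (n - (n - i)) = V i" "t (n - (n - i)) = t i" by (metis Vn tn order_refl)+
        qed
        \<comment> \<open>The chord of \<open>V\<close> has violation at most \<open>\<xi>\<close>
          at both ends, so the error bound replaces it by an exactly feasible affine path
          \<open>z0 + t * z1\<close>.\<close>
        define v1 where "v1 j = (1 / T) * (V n j - V 0 j)" for j
        have v1: "T * v1 j = V n j - V 0 j" "v1 j \<ge> 0" for j
          using T V0le[of j n] by (auto simp: v1_def)
        have Tv1: "T * app A v1 k = app A (V n) k - app A (V 0) k" for k
          unfolding v1_def app_simps using T by simp
        obtain z0 z1 where z: "affine_feasible A (\<lambda>k. \<theta> * \<beta> k) (\<lambda>k. \<theta> * b k) T z0 z1"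
          and z0: "\<And>j. \<bar>z0 j - V 0 j\<bar> \<le> C1 * \<xi>" and z1: "\<And>j. \<bar>z1 j - v1 j\<bar> \<le> C1 * \<xi>"
        proof -
          have "app A (V 0) k \<le> \<theta> * \<beta> k + \<xi>" for k using viol[of 0 k] t0 by simp
          moreover have "app A (V 0) k + T * app A v1 k \<le> \<theta> * (\<beta> k + T * b k) + \<xi>" for k
            using viol[of n k] tn[of n] by (simp add: Tv1 algebra_simps)
          ultimately have "\<exists>z0 z1. affine_feasible A (\<lambda>k. \<theta> * \<beta> k) (\<lambda>k. \<theta> * b k) T z0 z1 \<and>
            (\<forall>j. \<bar>z0 j - V 0 j\<bar> \<le> C1 * \<xi>) \<and> (\<forall>j. \<bar>z1 j - v1 j\<bar> \<le> C1 * \<xi>)"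
            by (intro bound \<theta> \<xi> V0 v1(2))
          then show ?thesis using that by blast
        qed
        have z1N: "z1 j = 0" if "x1 j = 0" for j
        proof -
          \<comment> \<open>Adding the reference path before normalizing avoids a division by
            \<open>\<theta>\<close>, which may be 0, and yields a feasible pair for the unscaled
            data to which maximality of the support applies.\<close>
          let ?c = "1 / (1 + \<theta>)"
          have c: "?c * (1 + \<theta>) = 1" "?c \<ge> 0" using \<theta> by auto
          have "affine_feasible A \<beta> b T (\<lambda>j. ?c * (x0 j + z0 j)) (\<lambda>j. ?c * (x1 j + z1 j))"
            unfolding affine_feasible_def app_simps
          proof (intro conjI allI)
            fix j show "0 \<le> ?c * (x0 j + z0 j)" "0 \<le> ?c * (x1 j + z1 j)"
              using c(2) feas z by (auto simp: affine_feasible_def)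
          next
            fix k
            have 1: "app A z0 k \<le> \<theta> * \<beta> k" "app A z0 k + T * app A z1 k \<le> \<theta> * \<beta> k + T * (\<theta> * b k)"
              using z by (auto simp: affine_feasible_def)
            have "?c * (app A x0 k + app A z0 k) \<le> ?c * ((1 + \<theta>) * \<beta> k)"
              using 1 feas_k[of k] by (intro mult_left_mono c) (simp add: algebra_simps)
            then show "?c * (app A x0 k + app A z0 k) \<le> \<beta> k"
              unfolding mult.assoc[symmetric] c(1) by simp
            have "?c * ((app A x0 k + app A z0 k) + T * (app A x1 k + app A z1 k)) \<le> ?c * ((1 + \<theta>) * (\<beta> k + T * b k))"
              using 1 feas_k[of k] by (intro mult_left_mono c) (simp add: algebra_simps)
            then have "?c * ((app A x0 k + app A z0 k) + T * (app A x1 k + app A z1 k)) \<le> \<beta> k + T * b k"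
              unfolding mult.assoc[symmetric] c(1) by simp
            then show "?c * (app A x0 k + app A z0 k) + T * (?c * (app A x1 k + app A z1 k)) \<le> \<beta> k + T * b k"
              by (simp only: distrib_left mult.left_commute)
          qed
          from supp[OF this that] show ?thesis using \<theta> that by simp
        qed
        have z_k: "app A z0 k \<le> \<theta> * \<beta> k" "app A z0 k + T * app A z1 k \<le> \<theta> * \<beta> k + T * (\<theta> * b k)" for k
          using z by (auto simp: affine_feasible_def)
        have znn: "z0 j \<ge> 0" for j using z by (auto simp: affine_feasible_def)
        define Z where "Z j = z0 j + T * z1 j" for j
        have AZ: "app A Z k = app A z0 k + T * app A z1 k" for k unfolding Z_def app_simps ..
        define e where "e = C2 * \<xi>"
        have e: "e \<ge> 0" "\<xi> \<le> e" "C1 * \<xi> + T * (C1 * \<xi>) \<le> e" "C1 * \<xi> \<le> e"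
        proof -
          have "e = \<xi> + C1 * \<xi> + T * (C1 * \<xi>)" by (simp add: e_def C2_def algebra_simps)
          moreover have "0 \<le> C1 * \<xi>" "0 \<le> T * (C1 * \<xi>)" using C1 \<xi> T by auto
          ultimately show "e \<ge> 0" "\<xi> \<le> e" "C1 * \<xi> + T * (C1 * \<xi>) \<le> e" "C1 * \<xi> \<le> e" using \<xi> by linarith+
        qed
        have Tz1: "T * z1 j \<le> V n j - V 0 j + T * (C1 * \<xi>)" "V n j - V 0 j \<le> T * z1 j + T * (C1 * \<xi>)" for j
        proof -
          have "z1 j \<le> v1 j + C1 * \<xi>" "v1 j \<le> z1 j + C1 * \<xi>" using z1[of j] by auto
          then have "T * z1 j \<le> T * (v1 j + C1 * \<xi>)" "T * v1 j \<le> T * (z1 j + C1 * \<xi>)"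
            using T by (auto intro: mult_left_mono)
          then show "T * z1 j \<le> V n j - V 0 j + T * (C1 * \<xi>)" "V n j - V 0 j \<le> T * z1 j + T * (C1 * \<xi>)"
            using v1(1)[of j] by (auto simp: algebra_simps)
        qed
        \<comment> \<open>What is followed is the part of \<open>V\<close> beyond \<open>z0\<close>;
          the slack of \<open>z0\<close> at time \<open>0\<close> plays the part of
          \<open>g\<close>, and \<open>\<theta> * t i\<close> is the parameter.\<close>
        have "\<exists>Y. (\<forall>j. Y 0 j \<ge> 0) \<and> (\<forall>i j. Y i j \<le> Y (Suc i) j) \<and> (\<forall>i j. \<bar>Y i j - (V i j - z0 j)\<bar> \<le> CF * e) \<and>
          (\<forall>i. \<forall>k\<in>I0. app A (Y i) k \<le> (\<theta> * \<beta> k - app A z0 k) + b k * (\<theta> * t i)) \<and> (\<forall>i j. x1 j = 0 \<longrightarrow> Y i j = 0)"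
        proof (rule forward[OF e(1)])
          show "0 \<le> \<theta> * \<beta> k - app A z0 k" for k using z_k[of k] by simp
          show "- e \<le> V 0 j - z0 j" for j using z0[of j] e(4) by linarith
          show "V i j - z0 j \<le> V (Suc i) j - z0 j" for i j using V by simp
          show "V i j - z0 j \<le> 2 * e" if "x1 j = 0" for i j
            using Vle[of i j] Tz1(2)[of j] z1N[OF that] z0[of j] e by simp
          show "0 \<le> \<theta> * t 0" by (simp add: t0)
          show "\<theta> * t i \<le> \<theta> * t (Suc i)" for i using t \<theta> by (simp add: mult_left_mono)
          show "app A (\<lambda>j. V i j - z0 j) k \<le> \<theta> * \<beta> k - app A z0 k + b k * (\<theta> * t i) + e" for i k
            unfolding app_simps using viol[of i k] e(2) by (simp add: algebra_simps)
        qed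
        then obtain Y where Y: "\<And>j. Y 0 j \<ge> 0" "\<And>i j. Y i j \<le> Y (Suc i) j" "\<And>i j. \<bar>Y i j - (V i j - z0 j)\<bar> \<le> CF * e"
          "\<And>i k. k \<in> I0 \<Longrightarrow> app A (Y i) k \<le> (\<theta> * \<beta> k - app A z0 k) + b k * (\<theta> * t i)" "\<And>i j. x1 j = 0 \<Longrightarrow> Y i j = 0"
          by blast
        \<comment> \<open>Read backwards from \<open>T\<close>, the path \<open>Z - V\<close> is
          nondecreasing, and upper bounds on \<open>app A\<close> of \<open>V\<close> become upper
          bounds for the matrix \<open>- A\<close> with rate \<open>- b\<close>; \<open>g\<close> is
          now the slack of \<open>Z\<close> at \<open>T\<close>.\<close>
        have "\<exists>Y. (\<forall>j. Y 0 j \<ge> 0) \<and> (\<forall>i j. Y i j \<le> Y (Suc i) j) \<and> (\<forall>i j. \<bar>Y i j - (Z j - V (n - i) j)\<bar> \<le> CG * e) \<and>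
          (\<forall>i. \<forall>k\<in>IT. app (\<lambda>k j. - A k j) (Y i) k \<le> (\<theta> * \<beta> k + T * (\<theta> * b k) - app A Z k) + - b k * (\<theta> * (T - t (n - i)))) \<and>
          (\<forall>i j. x1 j = 0 \<longrightarrow> Y i j = 0)"
        proof (rule backward[OF e(1)])
          show "0 \<le> \<theta> * \<beta> k + T * (\<theta> * b k) - app A Z k" for k using z_k[of k] by (simp add: AZ)
          show "- e \<le> Z j - V (n - 0) j" for j using z0[of j] Tz1(2)[of j] e(3) by (simp add: Z_def)
          have mono: "f (n - Suc i) \<le> f (n - i)" if "\<And>i. f i \<le> f (Suc i)" for f :: "nat \<Rightarrow> real" and i
            using lift_Suc_mono_le[of f "n - Suc i" "n - i", OF that] by simp
          show "Z j - V (n - i) j \<le> Z j - V (n - Suc i) j" for i j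
            using mono[of "\<lambda>i. V i j" i] V by simp
          show "Z j - V (n - i) j \<le> 2 * e" if "x1 j = 0" for i j
            using V0le[of j "n - i"] z1N[OF that] z0[of j] e by (simp add: Z_def)
          show "0 \<le> \<theta> * (T - t (n - 0))" using tn[of n] by simp
          show "\<theta> * (T - t (n - i)) \<le> \<theta> * (T - t (n - Suc i))" for i
            using mono[of t i] t \<theta> by (intro mult_left_mono) auto
          show "app (\<lambda>k j. - A k j) (\<lambda>j. Z j - V (n - i) j) k \<le>
             \<theta> * \<beta> k + T * (\<theta> * b k) - app A Z k + - b k * (\<theta> * (T - t (n - i))) + e" for i k
            unfolding app_uminus app_simps using viol[of "n - i" k] e(2) by (simp add: algebra_simps)
        qed
        then obtain Y' where Y': "\<And>j. Y' 0 j \<ge> 0" "\<And>i j. Y' i j \<le> Y' (Suc i) j" "\<And>i j. \<bar>Y' i j - (Z j - V (n - i) j)\<bar> \<le> CG * e"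
          "\<And>i k. k \<in> IT \<Longrightarrow> app (\<lambda>k j. - A k j) (Y' i) k \<le> (\<theta> * \<beta> k + T * (\<theta> * b k) - app A Z k) + - b k * (\<theta> * (T - t (n - i)))"
          "\<And>i j. x1 j = 0 \<Longrightarrow> Y' i j = 0"
          by blast
        define F where "F i j = z0 j + Y i j" for i j
        define G where "G i j = Z j - Y' (n - i) j" for i j
        have Ce: "(CF + CG) * C2 * \<xi> = CF * e + CG * e" by (simp add: e_def algebra_simps)
        have Cee: "0 \<le> CF * e" "0 \<le> CG * e" using CF CG e by auto
        show "\<exists>F G. (\<forall>j. F 0 j \<ge> 0) \<and> (\<forall>i j. F i j \<le> F (Suc i) j \<and> G i j \<le> G (Suc i) j) \<and>
          (\<forall>i j. \<bar>F i j - V i j\<bar> \<le> (CF + CG) * C2 * \<xi> \<and> \<bar>G i j - V i j\<bar> \<le> (CF + CG) * C2 * \<xi>) \<and>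
          (\<forall>i k. app A x0 k = \<beta> k \<longrightarrow> app A (F i) k \<le> \<theta> * (\<beta> k + b k * t i)) \<and>
          (\<forall>i k. app A x0 k + T * app A x1 k = \<beta> k + T * b k \<longrightarrow> app A (G i) k \<le> \<theta> * (\<beta> k + b k * t i)) \<and>
          (\<forall>i i' j. x1 j = 0 \<longrightarrow> F i j = G i' j)"
        proof (rule exI[of _ F], rule exI[of _ G], intro conjI allI impI)
          show "0 \<le> F 0 j" for j using Y(1) znn by (simp add: F_def)
          show "F i j \<le> F (Suc i) j" for i j using Y(2) by (simp add: F_def)
          show "G i j \<le> G (Suc i) j" for i j
            using lift_Suc_mono_le[of "\<lambda>i. Y' i j" "n - Suc i" "n - i"] Y'(2) by (simp add: G_def)
          show "\<bar>F i j - V i j\<bar> \<le> (CF + CG) * C2 * \<xi>" for i j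
            using Y(3)[of i j] Cee unfolding Ce F_def by (simp add: abs_le_iff)
          show "\<bar>G i j - V i j\<bar> \<le> (CF + CG) * C2 * \<xi>" for i j
            using Y'(3)[of "n - i" j] Cee unfolding Ce G_def rev by (simp add: abs_le_iff)
          show "app A (F i) k \<le> \<theta> * (\<beta> k + b k * t i)" if "app A x0 k = \<beta> k" for i k
            using Y(4)[of k i] that unfolding F_def app_simps I0_def by (simp add: algebra_simps)
          show "app A (G i) k \<le> \<theta> * (\<beta> k + b k * t i)"
            if "app A x0 k + T * app A x1 k = \<beta> k + T * b k" for i k
            using Y'(4)[of k "n - i"] that unfolding G_def app_simps IT_def rev app_uminus by (simp add: algebra_simps)
          \<comment> \<open>In such a coordinate \<open>z1\<close>, \<open>Y\<close> and
            \<open>Y'\<close> all vanish, which leaves the constant \<open>z0 j\<close> in both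
            repairs.\<close>
          show "F i j = G i' j" if "x1 j = 0" for i i' j
            using Y(5) Y'(5) that z1N by (simp add: F_def G_def Z_def)
        qed
      qed
    qed
  qed
qed

text \<open>Shifting weight from \<open>F\<close> to \<open>G\<close> lowers the combination by at
  most the shifted weight times the distance of \<open>F\<close> and \<open>G\<close>; growth of
  either only raises it.\<close>

lemma convex_combination_increment:
  fixes F F' G G' w w' :: real
  assumes "F \<le> F'" "G \<le> G'" "0 \<le> w" "w \<le> w'" "w' \<le> 1" "\<bar>F - G\<bar> \<le> d"
  shows "(1 - w) * F + w * G - (w' - w) * d \<le> (1 - w') * F' + w' * G'"
proof -
  have "(1 - w') * F \<le> (1 - w') * F'" "w' * G \<le> w' * G'"
    using assms by (auto intro: mult_left_mono)
  moreover have "(w' - w) * (F - G) \<le> (w' - w) * d"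
    using assms by (intro mult_left_mono) auto
  ultimately show ?thesis by (simp add: algebra_simps)
qed

text \<open>\<open>F\<close> is used near \<open>0\<close>, \<open>G\<close> near \<open>T\<close>, with a linear transition on the middle third. Replacing a
  fraction \<open>a / \<theta>\<close> of the path by the reference path \<open>x0 + t * x1\<close> creates slack of order \<open>a\<close>
  on the rows that are not repaired and absorbs the decrease caused by the transition. This
  fraction of \<open>V\<close> may be large, but it is, up to a bounded error, a homogeneous path \<open>h\<close>, which can
  be kept.\<close>
lemma repair_path:
  fixes A :: "'k::finite \<Rightarrow> 'j::finite \<Rightarrow> real"
  assumes T: "T > 0" and ex: "affine_feasible A \<beta> b T w0 w1"
  obtains C where "C \<ge> 0" "\<And>\<theta> \<xi> V t n. \<lbrakk>\<theta> \<ge> 0; \<xi> \<ge> 0; t 0 = 0; \<And>i::nat. t i \<le> t (Suc i); \<And>i. i \<ge> n \<Longrightarrow> t i = T;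
      \<And>j. V 0 j \<ge> 0; \<And>i j. V i j \<le> V (Suc i) j; \<And>i. i \<ge> n \<Longrightarrow> V i = V n;
      \<And>i k. app A (V i) k \<le> \<theta> * (\<beta> k + b k * t i) + \<xi>\<rbrakk> \<Longrightarrow>
      \<exists>V'. (\<forall>j. V' 0 j \<ge> 0) \<and> (\<forall>i j. V' i j \<le> V' (Suc i) j) \<and>
        (\<forall>i k. app A (V' i) k \<le> \<theta> * (\<beta> k + b k * t i)) \<and> (\<forall>i j. \<bar>V' i j - V i j\<bar> \<le> C * \<xi>)"
proof (rule affine_feasible_max_support[OF ex])
  fix x0 x1
  assume feas: "affine_feasible A \<beta> b T x0 x1"
    and supp: "\<And>z0 z1 j. affine_feasible A \<beta> b T z0 z1 \<Longrightarrow> x1 j = 0 \<Longrightarrow> z1 j = 0"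
  show thesis
  proof (rule repair_at_ends[OF T feas], rule supp, assumption, assumption)
    fix C3 :: real
    assume C3: "C3 \<ge> 0" and ends: "\<And>\<theta> \<xi> V t n. \<lbrakk>\<theta> \<ge> 0; \<xi> \<ge> 0; t 0 = 0; \<And>i::nat. t i \<le> t (Suc i); \<And>i. i \<ge> n \<Longrightarrow> t i = T;
      \<And>j. V 0 j \<ge> 0; \<And>i j. V i j \<le> V (Suc i) j; \<And>i. i \<ge> n \<Longrightarrow> V i = V n;
      \<And>i k. app A (V i) k \<le> \<theta> * (\<beta> k + b k * t i) + \<xi>\<rbrakk> \<Longrightarrow>
      \<exists>F G. (\<forall>j. F 0 j \<ge> 0) \<and> (\<forall>i j. F i j \<le> F (Suc i) j \<and> G i j \<le> G (Suc i) j) \<and>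
        (\<forall>i j. \<bar>F i j - V i j\<bar> \<le> C3 * \<xi> \<and> \<bar>G i j - V i j\<bar> \<le> C3 * \<xi>) \<and>
        (\<forall>i k. app A x0 k = \<beta> k \<longrightarrow> app A (F i) k \<le> \<theta> * (\<beta> k + b k * t i)) \<and>
        (\<forall>i k. app A x0 k + T * app A x1 k = \<beta> k + T * b k \<longrightarrow> app A (G i) k \<le> \<theta> * (\<beta> k + b k * t i)) \<and>
        (\<forall>i i' j. x1 j = 0 \<longrightarrow> F i j = G i' j)"
    show thesis
    proof (rule follow_path_homogeneous[of A])
      fix Ch :: real
      assume Ch: "Ch \<ge> 0" and hom: "\<And>D V. \<lbrakk>D \<ge> 0; \<And>j. V 0 j \<ge> 0; \<And>(i::nat) j. V i j \<le> V (Suc i) j;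
        \<And>i k. app A (V i) k \<le> D\<rbrakk> \<Longrightarrow>
        \<exists>h. (\<forall>j. h 0 j \<ge> 0) \<and> (\<forall>i j. h i j \<le> h (Suc i) j) \<and> (\<forall>i j. \<bar>h i j - V i j\<bar> \<le> Ch * D) \<and>
          (\<forall>i k. app A (h i) k \<le> 0)"
      define p where "p k = \<beta> k - app A x0 k" for k
      define q where "q k = (\<beta> k + T * b k) - (app A x0 k + T * app A x1 k)" for k
      have pq: "p k \<ge> 0" "q k \<ge> 0" for k using feas by (auto simp: p_def q_def affine_feasible_def)
      have x: "x0 j \<ge> 0" "x1 j \<ge> 0" for j using feas by (auto simp: affine_feasible_def)
      \<comment> \<open>Any point within \<open>C3 * \<xi>\<close> of \<open>V i\<close> violates
        each row by at most \<open>E * \<xi>\<close>.\<close>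
      define E where "E = 1 + entry_sum A * C3"
      have E: "E \<ge> 1" using C3 by (simp add: E_def entry_sum_nonneg)
      \<comment> \<open>A sum meets all the required lower bounds at once; terms with denominator 0
        vanish. The 3 inverts the factor 1/3 that \<open>p\<close> or \<open>q\<close> keeps in the
        slack; the 6 is the rise rate \<open>3 / T\<close> of the weight times the distance
        \<open>2 * C3 * \<xi>\<close> between \<open>F\<close> and \<open>G\<close>.\<close>
      define m where "m = 1 + (\<Sum>j\<in>UNIV. 6 * C3 / (T * x1 j)) + (\<Sum>k\<in>UNIV. 3 * E / p k) + (\<Sum>k\<in>UNIV. 3 * E / q k)"
      have nn: "0 \<le> 6 * C3 / (T * x1 j)" "0 \<le> 3 * E / p k" "0 \<le> 3 * E / q k" for j k
        using C3 T x E pq by auto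
      have nns: "0 \<le> (\<Sum>j\<in>UNIV. 6 * C3 / (T * x1 j))" "0 \<le> (\<Sum>k\<in>UNIV. 3 * E / p k)" "0 \<le> (\<Sum>k\<in>UNIV. 3 * E / q k)"
        by (intro sum_nonneg nn)+
      have m1: "m \<ge> 1" using nns by (simp add: m_def)
      have mx: "6 * C3 / T \<le> m * x1 j" if "x1 j \<noteq> 0" for j
      proof -
        have "6 * C3 / (T * x1 j) \<le> m"
          using member_le_sum[of j UNIV "\<lambda>j. 6 * C3 / (T * x1 j)"] nn nns by (simp add: m_def)
        then show ?thesis using that x(2)[of j] T by (simp add: divide_simps mult_ac)
      qed
      have mp: "3 * E \<le> m * p k" if "p k \<noteq> 0" for k
      proof -
        have "3 * E / p k \<le> m"
          using member_le_sum[of k UNIV "\<lambda>k. 3 * E / p k"] nn nns by (simp add: m_def)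
        then show ?thesis using that pq(1)[of k] by (simp add: divide_simps)
      qed
      have mq: "3 * E \<le> m * q k" if "q k \<noteq> 0" for k
      proof -
        have "3 * E / q k \<le> m"
          using member_le_sum[of k UNIV "\<lambda>k. 3 * E / q k"] nn nns by (simp add: m_def)
        then show ?thesis using that pq(2)[of k] by (simp add: divide_simps)
      qed
      define Bf where "Bf = (\<Sum>k\<in>UNIV. \<bar>\<beta> k\<bar> + T * \<bar>b k\<bar>)"
      have Bf0: "Bf \<ge> 0" using T by (simp add: Bf_def sum_nonneg)
      have Bf: "\<beta> k + b k * s \<le> Bf" if "0 \<le> s" "s \<le> T" for k s
      proof -
        have "b k * s \<le> \<bar>b k\<bar> * T" using that by (intro mult_mono) auto
        then have "\<beta> k + b k * s \<le> \<bar>\<beta> k\<bar> + T * \<bar>b k\<bar>" by (simp add: mult.commute)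
        also have "\<dots> \<le> Bf" unfolding Bf_def using T by (intro member_le_sum[where f="\<lambda>k. \<bar>\<beta> k\<bar> + T * \<bar>b k\<bar>"]) auto
        finally show ?thesis .
      qed
      define Bx where "Bx = (\<Sum>j\<in>UNIV. x0 j + T * x1 j)"
      have Bx0: "Bx \<ge> 0" using x T by (simp add: Bx_def sum_nonneg)
      have Bx: "x0 j + s * x1 j \<le> Bx" if "0 \<le> s" "s \<le> T" for j s
      proof -
        have "x0 j + s * x1 j \<le> x0 j + T * x1 j" using that x by (simp add: mult_right_mono)
        also have "\<dots> \<le> Bx" unfolding Bx_def using T x by (intro member_le_sum[where f="\<lambda>j. x0 j + T * x1 j"]) auto
        finally show ?thesis .
      qed
      \<comment> \<open>One summand each for the blended repair, for the homogeneous part, and for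
        the added multiple of the reference path.\<close>
      define CC where "CC = C3 + Ch * (m * Bf + 1) + m * Bx"
      have CC: "CC \<ge> 0" using C3 Ch m1 Bf0 Bx0 by (simp add: CC_def add_nonneg_nonneg)
      show thesis
      proof (rule that[OF CC])
        fix \<theta> \<xi> :: real and V t and n :: nat
        assume \<theta>: "\<theta> \<ge> 0" and \<xi>: "\<xi> \<ge> 0" and t0: "t 0 = 0" and t: "\<And>i::nat. t i \<le> t (Suc i)"
          and tn: "\<And>i. i \<ge> n \<Longrightarrow> t i = T" and V0: "\<And>j. V 0 j \<ge> 0" and V: "\<And>i j. V i j \<le> V (Suc i) j"
          and Vn: "\<And>i. i \<ge> n \<Longrightarrow> V i = V n"
          and viol: "\<And>i k. app A (V i) k \<le> \<theta> * (\<beta> k + b k * t i) + \<xi>"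
        have ti: "0 \<le> t i" "t i \<le> T" for i
        proof -
          show "0 \<le> t i" using lift_Suc_mono_le[of t 0 i, OF t] t0 by simp
          have "t i \<le> t (max i n)" using lift_Suc_mono_le[of t i "max i n", OF t] by simp
          then show "t i \<le> T" using tn[of "max i n"] by simp
        qed
        define f where "f i k = \<beta> k + b k * t i" for i k
        have fB: "f i k \<le> Bf" for i k unfolding f_def using Bf[OF ti[of i]] by simp
        define a where "a = m * \<xi>"
        have a: "a \<ge> 0" using m1 \<xi> by (simp add: a_def)
        define X where "X i j = x0 j + t i * x1 j" for i j
        have X: "0 \<le> X i j" "X i j \<le> Bx" for i j using x ti Bx by (auto simp: X_def)
        define sl where "sl i k = f i k - app A (X i) k" for i k
        \<comment> \<open>The slack of the reference path interpolates linearly between its values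
          \<open>p\<close> at time \<open>0\<close> and \<open>q\<close> at time
          \<open>T\<close>.\<close>
        have sl_eq: "sl i k = (1 - t i / T) * p k + (t i / T) * q k" for i k
          unfolding sl_def X_def app_simps using T by (simp add: f_def p_def q_def field_simps)
        have ratio: "0 \<le> t i / T" "t i / T \<le> 1" for i using ti T by auto
        have sl_ge: "(1 - t i / T) * p k \<le> sl i k" "(t i / T) * q k \<le> sl i k" for i k
          using mult_nonneg_nonneg[OF ratio(1) pq(2), of i k]
            mult_nonneg_nonneg[of "1 - t i / T", OF _ pq(1), of k] ratio(2)[of i]
          unfolding sl_eq by linarith+
        have sl: "sl i k \<ge> 0" for i k
          using order_trans[OF mult_nonneg_nonneg[OF ratio(1) pq(2)] sl_ge(2)] .
        \<comment> \<open>If \<open>c * \<theta> \<le> a\<close>, the right-hand sides for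
          \<open>c * V\<close> are of order \<open>\<xi>\<close>, so \<open>c * V\<close> is an
          approximate homogeneous path however large it is.\<close>
        have h_exists: "\<exists>h. (\<forall>j. h 0 j \<ge> 0) \<and> (\<forall>i j. h i j \<le> h (Suc i) j) \<and>
            (\<forall>i j. \<bar>h i j - c * V i j\<bar> \<le> Ch * ((m * Bf + 1) * \<xi>)) \<and> (\<forall>i k. app A (h i) k \<le> 0)"
          if c: "0 \<le> c" "c \<le> 1" "c * \<theta> \<le> a" for c
        proof (rule hom)
          show "0 \<le> (m * Bf + 1) * \<xi>" using m1 Bf0 \<xi> by simp
          show "0 \<le> c * V 0 j" for j using c V0 by simp
          show "c * V i j \<le> c * V (Suc i) j" for i j using c V by (simp add: mult_left_mono)
          show "app A (\<lambda>j. c * V i j) k \<le> (m * Bf + 1) * \<xi>" for i k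
          proof -
            have "c * app A (V i) k \<le> c * (\<theta> * f i k + \<xi>)" using viol[of i k] c by (intro mult_left_mono) (auto simp: f_def)
            also have "\<dots> = (c * \<theta>) * f i k + c * \<xi>" by (simp add: algebra_simps)
            also have "(c * \<theta>) * f i k \<le> (c * \<theta>) * Bf" using fB c \<theta> by (intro mult_left_mono) auto
            also have "(c * \<theta>) * Bf \<le> a * Bf" using c Bf0 by (intro mult_right_mono) auto
            also have "c * \<xi> \<le> \<xi>" using c \<xi> by (simp add: mult_left_le_one_le)
            finally show ?thesis unfolding app_simps by (simp add: a_def algebra_simps)
          qed
        qed
        have CC\<xi>: "CC * \<xi> = C3 * \<xi> + Ch * ((m * Bf + 1) * \<xi>) + a * Bx"
          by (simp add: CC_def a_def algebra_simps)
        show "\<exists>V'. (\<forall>j. V' 0 j \<ge> 0) \<and> (\<forall>i j. V' i j \<le> V' (Suc i) j) \<and>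
          (\<forall>i k. app A (V' i) k \<le> \<theta> * (\<beta> k + b k * t i)) \<and> (\<forall>i j. \<bar>V' i j - V i j\<bar> \<le> CC * \<xi>)"
        proof (cases "\<theta> \<le> a")
          \<comment> \<open>For such small \<open>\<theta>\<close>, including 0, all of
            \<open>V\<close> counts as homogeneous, and the right-hand side is used only by
            \<open>\<theta> * X\<close>.\<close>
          case True
          then have "\<exists>h. (\<forall>j. h 0 j \<ge> 0) \<and> (\<forall>i j. h i j \<le> h (Suc i) j) \<and>
            (\<forall>i j. \<bar>h i j - 1 * V i j\<bar> \<le> Ch * ((m * Bf + 1) * \<xi>)) \<and> (\<forall>i k. app A (h i) k \<le> 0)"
            by (intro h_exists) auto
          then obtain h where h: "\<And>j. h 0 j \<ge> 0" "\<And>i j. h i j \<le> h (Suc i) j"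
            "\<And>i j. \<bar>h i j - 1 * V i j\<bar> \<le> Ch * ((m * Bf + 1) * \<xi>)" "\<And>i k. app A (h i) k \<le> 0" by blast
          define V' where "V' i j = h i j + \<theta> * X i j" for i j
          show ?thesis
          proof (intro exI[of _ V'] conjI allI)
            show "0 \<le> V' 0 j" for j using h \<theta> X by (simp add: V'_def)
            show "V' i j \<le> V' (Suc i) j" for i j
              unfolding V'_def X_def using h \<theta> x t by (intro add_mono mult_left_mono mult_right_mono) auto
            show "app A (V' i) k \<le> \<theta> * (\<beta> k + b k * t i)" for i k
            proof -
              have "\<theta> * app A (X i) k \<le> \<theta> * f i k" using sl[of i k] \<theta> by (intro mult_left_mono) (auto simp: sl_def)
              then show ?thesis unfolding V'_def app_simps using h(4)[of i k] by (simp add: f_def)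
            qed
            show "\<bar>V' i j - V i j\<bar> \<le> CC * \<xi>" for i j
            proof -
              have "\<theta> * X i j \<le> a * Bx" using True \<theta> X a by (intro mult_mono) auto
              moreover have "0 \<le> \<theta> * X i j" "0 \<le> C3 * \<xi>" using \<theta> X C3 \<xi> by auto
              ultimately show ?thesis unfolding CC\<xi> V'_def using h(3)[of i j] by (simp add: abs_le_iff)
            qed
          qed
        next
          case False
          then have \<theta>a: "a < \<theta>" "\<theta> > 0" using a by auto
          define c where "c = a / \<theta>"
          have c: "0 \<le> c" "c \<le> 1" "c * \<theta> = a" using \<theta>a a by (auto simp: c_def)
          have "\<exists>h. (\<forall>j. h 0 j \<ge> 0) \<and> (\<forall>i j. h i j \<le> h (Suc i) j) \<and>
            (\<forall>i j. \<bar>h i j - c * V i j\<bar> \<le> Ch * ((m * Bf + 1) * \<xi>)) \<and> (\<forall>i k. app A (h i) k \<le> 0)"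
            using c by (intro h_exists) auto
          then obtain h where h: "\<And>j. h 0 j \<ge> 0" "\<And>i j. h i j \<le> h (Suc i) j"
            "\<And>i j. \<bar>h i j - c * V i j\<bar> \<le> Ch * ((m * Bf + 1) * \<xi>)" "\<And>i k. app A (h i) k \<le> 0" by blast
          have "\<exists>F G. (\<forall>j. F 0 j \<ge> 0) \<and> (\<forall>i j. F i j \<le> F (Suc i) j \<and> G i j \<le> G (Suc i) j) \<and>
            (\<forall>i j. \<bar>F i j - V i j\<bar> \<le> C3 * \<xi> \<and> \<bar>G i j - V i j\<bar> \<le> C3 * \<xi>) \<and>
            (\<forall>i k. app A x0 k = \<beta> k \<longrightarrow> app A (F i) k \<le> \<theta> * (\<beta> k + b k * t i)) \<and>
            (\<forall>i k. app A x0 k + T * app A x1 k = \<beta> k + T * b k \<longrightarrow> app A (G i) k \<le> \<theta> * (\<beta> k + b k * t i)) \<and>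
            (\<forall>i i' j. x1 j = 0 \<longrightarrow> F i j = G i' j)"
            by (rule ends[OF \<theta> \<xi> t0 t tn V0 V Vn viol])
          then obtain F G where FG_all: "\<forall>j. F 0 j \<ge> 0" "\<forall>i j. F i j \<le> F (Suc i) j \<and> G i j \<le> G (Suc i) j"
            "\<forall>i j. \<bar>F i j - V i j\<bar> \<le> C3 * \<xi> \<and> \<bar>G i j - V i j\<bar> \<le> C3 * \<xi>"
            "\<forall>i k. app A x0 k = \<beta> k \<longrightarrow> app A (F i) k \<le> \<theta> * (\<beta> k + b k * t i)"
            "\<forall>i k. app A x0 k + T * app A x1 k = \<beta> k + T * b k \<longrightarrow> app A (G i) k \<le> \<theta> * (\<beta> k + b k * t i)"
            "\<forall>i i' j. x1 j = 0 \<longrightarrow> F i j = G i' j"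
            by (elim exE conjE)
          have F0: "F 0 j \<ge> 0" for j using FG_all(1) by simp
          have FG: "F i j \<le> F (Suc i) j" "G i j \<le> G (Suc i) j" for i j using FG_all(2) by auto
          have dist: "\<bar>F i j - V i j\<bar> \<le> C3 * \<xi>" "\<bar>G i j - V i j\<bar> \<le> C3 * \<xi>" for i j
            using FG_all(3) by auto
          have F: "app A (F i) k \<le> \<theta> * f i k" if "app A x0 k = \<beta> k" for i k
            using FG_all(4) that by (simp add: f_def)
          have G: "app A (G i) k \<le> \<theta> * f i k" if "app A x0 k + T * app A x1 k = \<beta> k + T * b k" for i k
            using FG_all(5) that by (simp add: f_def)
          have FGN: "F i j = G i' j" if "x1 j = 0" for i i' j using FG_all(6) that by blast
          have near: "app A W k \<le> \<theta> * f i k + E * \<xi>" if "\<And>j. \<bar>W j - V i j\<bar> \<le> C3 * \<xi>" for W i k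
          proof -
            have "\<bar>app A (\<lambda>j. W j - V i j) k\<bar> \<le> entry_sum A * (C3 * \<xi>)"
              using that C3 \<xi> by (intro abs_app_le) auto
            then show ?thesis using viol[of i k] unfolding app_simps by (simp add: f_def E_def algebra_simps)
          qed
          have E\<xi>: "E * \<xi> \<le> a * (r * y)" if "3 * E \<le> m * y" "1 / 3 \<le> r" "0 \<le> y" for r y
          proof -
            have "3 * (E * \<xi>) \<le> a * y" using mult_right_mono[OF that(1) \<xi>] by (simp add: a_def algebra_simps)
            moreover have "a * ((1 / 3) * y) \<le> a * (r * y)" using that a by (intro mult_left_mono mult_right_mono) auto
            ultimately show ?thesis by simp
          qed
          define w where "w i = max 0 (min 1 (3 * (t i / T) - 1))" for i
          have w: "0 \<le> w i" "w i \<le> 1" for i by (auto simp: w_def)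
          have w_incr: "w i \<le> w (Suc i)" "w (Suc i) - w i \<le> 3 * ((t (Suc i) - t i) / T)" for i
          proof -
            have "t i / T \<le> t (Suc i) / T" using t T by (simp add: divide_right_mono)
            then show "w i \<le> w (Suc i)" "w (Suc i) - w i \<le> 3 * ((t (Suc i) - t i) / T)"
              by (auto simp: w_def diff_divide_distrib)
          qed
          \<comment> \<open>Where \<open>F\<close> has positive weight, \<open>p\<close> contributes
            at least a third of its value to the slack; likewise \<open>q\<close> where
            \<open>G\<close> has positive weight.\<close>
          have w_cases: "w i \<noteq> 1 \<Longrightarrow> t i / T \<le> 2 / 3" "w i \<noteq> 0 \<Longrightarrow> 1 / 3 \<le> t i / T" for i
            unfolding w_def by linarith+
          define Y where "Y i j = (1 - w i) * F i j + w i * G i j" for i j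
          \<comment> \<open>Rows with \<open>p k = 0\<close> are exact for \<open>F\<close>; the
            others miss by at most \<open>E * \<xi>\<close>, which \<open>a * sl i k\<close>
            covers.\<close>
          have AF: "(1 - w i) * app A (F i) k \<le> (1 - w i) * (\<theta> * f i k + a * sl i k)" for i k
          proof (cases "w i = 1")
            case False
            then have r: "1 / 3 \<le> 1 - t i / T" using w_cases(1)[of i] by simp
            have "app A (F i) k \<le> \<theta> * f i k + a * sl i k"
            proof (cases "p k = 0")
              case True
              then show ?thesis using F[of k i] sl[of i k] a by (simp add: p_def add_increasing2)
            next
              case False
              have "E * \<xi> \<le> a * ((1 - t i / T) * p k)" by (rule E\<xi>[OF mp[OF False] r pq(1)])
              also have "\<dots> \<le> a * sl i k" by (intro mult_left_mono sl_ge a)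
              finally show ?thesis using near[OF dist(1), of i k] by linarith
            qed
            then show ?thesis using w by (intro mult_left_mono) auto
          qed simp
          have AG: "w i * app A (G i) k \<le> w i * (\<theta> * f i k + a * sl i k)" for i k
          proof (cases "w i = 0")
            case False
            then have r: "1 / 3 \<le> t i / T" by (rule w_cases(2))
            have "app A (G i) k \<le> \<theta> * f i k + a * sl i k"
            proof (cases "q k = 0")
              case True
              then show ?thesis using G[of k i] sl[of i k] a by (simp add: q_def add_increasing2)
            next
              case False
              have "E * \<xi> \<le> a * ((t i / T) * q k)" by (rule E\<xi>[OF mq[OF False] r pq(2)])
              also have "\<dots> \<le> a * sl i k" by (intro mult_left_mono sl_ge a)
              finally show ?thesis using near[OF dist(2), of i k] by linarith
            qed
            then show ?thesis using w by (intro mult_left_mono) auto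
          qed simp
          have AY: "app A (Y i) k \<le> \<theta> * f i k + a * sl i k" for i k
            using AF[of i k] AG[of i k] unfolding Y_def app_simps by (simp add: algebra_simps)
          have Yd: "\<bar>Y i j - V i j\<bar> \<le> C3 * \<xi>" for i j
          proof -
            have "Y i j - V i j = (1 - w i) * (F i j - V i j) + w i * (G i j - V i j)"
              by (simp add: Y_def algebra_simps)
            also have "\<bar>\<dots>\<bar> \<le> (1 - w i) * \<bar>F i j - V i j\<bar> + w i * \<bar>G i j - V i j\<bar>"
              using w[of i] abs_triangle_ineq[of "(1 - w i) * (F i j - V i j)" "w i * (G i j - V i j)"]
              by (simp add: abs_mult)
            also have "\<dots> \<le> (1 - w i) * (C3 * \<xi>) + w i * (C3 * \<xi>)"
              using w[of i] dist by (intro add_mono mult_left_mono) auto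
            finally show ?thesis by (simp add: algebra_simps)
          qed
          \<comment> \<open>A decrease can come only from the transition. Where
            \<open>x1 j = 0\<close> both repairs agree and are constant; elsewhere the growth of
            \<open>a * X\<close> outweighs it by the choice of \<open>m\<close>.\<close>
          have Y_incr: "Y i j - Y (Suc i) j \<le> a * ((t (Suc i) - t i) * x1 j)" for i j
          proof (cases "x1 j = 0")
            case True
            have "F i j = G 0 j" "G i j = G 0 j" "F (Suc i) j = G 0 j" "G (Suc i) j = G 0 j"
              using FGN[OF True] by metis+
            then show ?thesis using True by (simp add: Y_def algebra_simps)
          next
            case False
            have "\<bar>F i j - G i j\<bar> \<le> 2 * (C3 * \<xi>)" using dist[of i j] by linarith
            then have "Y i j - Y (Suc i) j \<le> (w (Suc i) - w i) * (2 * (C3 * \<xi>))"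
              using convex_combination_increment[OF FG(1) FG(2) w(1) w_incr(1) w(2)] unfolding Y_def by (smt (verit))
            also have "\<dots> \<le> (3 * ((t (Suc i) - t i) / T)) * (2 * (C3 * \<xi>))"
              using w_incr C3 \<xi> by (intro mult_right_mono) auto
            also have "\<dots> = ((t (Suc i) - t i) * \<xi>) * (6 * C3 / T)" by simp
            also have "\<dots> \<le> ((t (Suc i) - t i) * \<xi>) * (m * x1 j)"
              using mx[OF False] t \<xi> by (intro mult_left_mono) auto
            also have "\<dots> = a * ((t (Suc i) - t i) * x1 j)" by (simp add: a_def)
            finally show ?thesis .
          qed
          \<comment> \<open>The right-hand sides add up exactly:
            \<open>(1 - c) * \<theta> + 0 + a = \<theta>\<close>, because
            \<open>c * \<theta> = a\<close>.\<close>
          define V' where "V' i j = (1 - c) * Y i j + h i j + a * X i j" for i j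
          show ?thesis
          proof (intro exI[of _ V'] conjI allI)
            show "0 \<le> V' 0 j" for j
            proof -
              \<comment> \<open>At step 0 only \<open>F\<close> contributes; nothing is known about
                the sign of \<open>G\<close> there.\<close>
              have "w 0 = 0" by (simp add: w_def t0)
              then show ?thesis using c F0 h(1) a X by (simp add: V'_def Y_def)
            qed
            show "V' i j \<le> V' (Suc i) j" for i j
            proof -
              define d where "d = a * ((t (Suc i) - t i) * x1 j)"
              have d: "d \<ge> 0" using a t x by (simp add: d_def)
              have "(1 - c) * (Y i j - Y (Suc i) j) \<le> (1 - c) * d"
                using Y_incr[of i j] c by (intro mult_left_mono) (auto simp: d_def)
              also have "\<dots> \<le> d" using c d by (simp add: mult_left_le_one_le)
              finally have "(1 - c) * Y i j - (1 - c) * Y (Suc i) j \<le> d" by (simp add: right_diff_distrib)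
              moreover have "a * X (Suc i) j = a * X i j + d" by (simp add: X_def d_def algebra_simps)
              ultimately show ?thesis unfolding V'_def using h(2)[of i j] by linarith
            qed
            show "app A (V' i) k \<le> \<theta> * (\<beta> k + b k * t i)" for i k
            proof -
              have "(1 - c) * app A (Y i) k \<le> (1 - c) * (\<theta> * f i k + a * sl i k)"
                using AY c by (intro mult_left_mono) auto
              also have "\<dots> = \<theta> * f i k - (c * \<theta>) * f i k + a * sl i k - c * (a * sl i k)"
                by (simp add: algebra_simps)
              also have "\<dots> \<le> \<theta> * f i k - a * f i k + a * sl i k"
                using c a sl[of i k] by simp
              finally have "(1 - c) * app A (Y i) k \<le> \<theta> * f i k - a * f i k + a * sl i k" .
              moreover have "a * app A (X i) k = a * f i k - a * sl i k" by (simp add: sl_def algebra_simps)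
              ultimately show ?thesis unfolding V'_def app_simps using h(4)[of i k] by (simp add: f_def)
            qed
            show "\<bar>V' i j - V i j\<bar> \<le> CC * \<xi>" for i j
            proof -
              have eq: "V' i j - V i j = (1 - c) * (Y i j - V i j) + (h i j - c * V i j) + a * X i j"
                by (simp add: V'_def algebra_simps)
              have "\<bar>(1 - c) * (Y i j - V i j)\<bar> \<le> 1 * (C3 * \<xi>)"
                unfolding abs_mult using c Yd by (intro mult_mono) auto
              moreover have "a * X i j \<le> a * Bx" "0 \<le> a * X i j" using X a by (auto intro: mult_left_mono)
              ultimately show ?thesis unfolding CC\<xi> eq using h(3)[of i j] by linarith
            qed
          qed
        qed
      qed
    qed
  qed
qed

subsection \<open>The discretized problem\<close>

lemma farkas_nonneg:
  fixes a :: "'i \<Rightarrow> 'v \<Rightarrow> real" and f :: "'i \<Rightarrow> real"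
  assumes V: "finite V" and I: "finite I"
    and none: "\<nexists>x. (\<forall>v\<in>V. x v \<ge> 0) \<and> (\<forall>i\<in>I. (\<Sum>v\<in>V. a i v * x v) \<le> f i)"
  obtains y where "\<And>i. i \<in> I \<Longrightarrow> y i \<ge> 0" "\<And>v. v \<in> V \<Longrightarrow> (\<Sum>i\<in>I. y i * a i v) \<ge> 0"
    "(\<Sum>i\<in>I. y i * f i) < 0"
proof -
  define a' where "a' q v = (case q of Inl i \<Rightarrow> a i v | Inr w \<Rightarrow> if v = w then - 1 else 0)" for q :: "'i + 'v" and v
  define f' where "f' q = (case q of Inl i \<Rightarrow> f i | Inr w \<Rightarrow> 0)" for q :: "'i + 'v"
  have a'1: "(\<Sum>v\<in>V. a' (Inl i) v * x v) = (\<Sum>v\<in>V. a i v * x v)" for i x by (simp add: a'_def)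
  have a'2: "(\<Sum>v\<in>V. a' (Inr w) v * x v) = - x w" if "w \<in> V" for w x
    using V that by (simp add: a'_def if_distrib[of "\<lambda>z. z * _"] cong: if_cong)
  have fin: "finite (I <+> V)" using I V by simp
  have none': "\<nexists>x. \<forall>q\<in>I <+> V. (\<Sum>v\<in>V. a' q v * x v) \<le> f' q"
  proof
    assume "\<exists>x. \<forall>q\<in>I <+> V. (\<Sum>v\<in>V. a' q v * x v) \<le> f' q"
    then obtain x where x: "\<forall>q\<in>I <+> V. (\<Sum>v\<in>V. a' q v * x v) \<le> f' q" by blast
    have "x v \<ge> 0" if "v \<in> V" for v
      using x[rule_format, OF InrI[OF that]] unfolding a'2[OF that] by (simp add: f'_def)
    moreover have "(\<Sum>v\<in>V. a i v * x v) \<le> f i" if "i \<in> I" for i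
      using x[rule_format, OF InlI[OF that]] unfolding a'1 by (simp add: f'_def)
    ultimately show False using none by blast
  qed
  obtain y where y: "\<And>q. q \<in> I <+> V \<Longrightarrow> y q \<ge> 0" "\<And>v. v \<in> V \<Longrightarrow> (\<Sum>q\<in>I <+> V. y q * a' q v) = 0"
    "(\<Sum>q\<in>I <+> V. y q * f' q) < 0"
    using farkas[OF V fin none'] by blast
  show ?thesis
  proof (rule that[of "\<lambda>i. y (Inl i)"])
    show "y (Inl i) \<ge> 0" if "i \<in> I" for i using y(1) that by auto
    show "(\<Sum>i\<in>I. y (Inl i) * a i v) \<ge> 0" if v: "v \<in> V" for v
    proof -
      have "(\<Sum>i\<in>I. y (Inl i) * a i v) = y (Inr v)"
        using y(2)[OF v] v V I
        by (simp add: sum.Plus a'_def if_distrib[of "\<lambda>z. _ * z"] cong: if_cong)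
      then show ?thesis using y(1) v by auto
    qed
    show "(\<Sum>i\<in>I. y (Inl i) * f i) < 0" using y(3) V I by (simp add: sum.Plus f'_def)
  qed
qed

section \<open>Grid programs, their objective and their weak duality\<close>

text \<open>The \<open>min\<close> freezes time at \<open>T\<close> from step \<open>n\<close> on,
  to match paths indexed by all of \<open>nat\<close>.\<close>

definition grid :: "real \<Rightarrow> nat \<Rightarrow> nat \<Rightarrow> real" where
  "grid T n i = T * real (min i n) / real n"

text \<open>Integration by parts turns the Stieltjes objective into \<open>g * U(T)\<close> plus
  \<open>c\<close> times the time integral of \<open>U\<close>; here that integral is a left Riemann
  sum.\<close>

definition grid_obj :: "('j::finite \<Rightarrow> real) \<Rightarrow> ('j \<Rightarrow> real) \<Rightarrow> real \<Rightarrow> nat \<Rightarrow> (nat \<Rightarrow> 'j \<Rightarrow> real) \<Rightarrow> real" where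
  "grid_obj g c T n V = (\<Sum>j\<in>UNIV. g j * V n j + c j * (T / real n * (\<Sum>i<n. V i j)))"

lemma sum_partial_sums:
  "(\<Sum>i<n. \<Sum>l\<le>i. u l) = (\<Sum>l\<le>n. (real n - real l) * u l)"
proof (induction n)
  case (Suc n)
  have "(\<Sum>l\<le>Suc n. (real (Suc n) - real l) * u l) = (\<Sum>l\<le>n. (real n - real l) * u l + u l)"
    by (simp add: algebra_simps)
  also have "\<dots> = (\<Sum>i<Suc n. \<Sum>l\<le>i. u l)" by (simp only: sum.distrib Suc.IH[symmetric] sum.lessThan_Suc)
  finally show ?case ..
qed simp

text \<open>Summation by parts. With left Riemann sums the weight of the increment at step
  \<open>i\<close> is exactly the coefficient at the remaining time \<open>grid T n (n - i)\<close>;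
  this is what makes the two grid programs exact duals under time reversal.\<close>

lemma grid_obj_increments:
  assumes n: "n \<ge> 1" and V: "\<And>i j. i \<le> n \<Longrightarrow> V i j = (\<Sum>l\<le>i. v l j)"
  shows "grid_obj g c T n V = (\<Sum>i\<le>n. \<Sum>j\<in>UNIV. (g j + c j * grid T n (n - i)) * v i j)"
proof -
  have "g j * V n j + c j * (T / real n * (\<Sum>i<n. V i j)) = (\<Sum>i\<le>n. (g j + c j * grid T n (n - i)) * v i j)" for j
  proof -
    have "(\<Sum>i<n. V i j) = (\<Sum>l\<le>n. (real n - real l) * v l j)"
      using sum_partial_sums[of "\<lambda>l. v l j" n] V by simp
    then have "T / real n * (\<Sum>i<n. V i j) = (\<Sum>l\<le>n. grid T n (n - l) * v l j)"
      by (simp only: sum_distrib_left) (intro sum.cong refl, simp add: grid_def of_nat_diff)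
    then show ?thesis using V[of n j]
      by (simp add: sum_distrib_left sum.distrib[symmetric] algebra_simps)
  qed
  then show ?thesis unfolding grid_obj_def by (simp add: sum.swap[of _ UNIV])
qed

text \<open>Both sides sum over the pairs with \<open>i + l \<le> n\<close>.\<close>

lemma sum_convolution_swap:
  fixes f :: "nat \<Rightarrow> nat \<Rightarrow> real"
  shows "(\<Sum>i\<le>n. \<Sum>l\<le>n - i. f i l) = (\<Sum>l\<le>n. \<Sum>i\<le>n - l. f i l)"
proof -
  have *: "(\<Sum>l\<le>n - i. g l) = (\<Sum>l\<le>n. if i + l \<le> n then g l else 0)" if "i \<le> n" for i and g :: "nat \<Rightarrow> real"
    using that by (intro sum.mono_neutral_cong_left) auto
  have "(\<Sum>i\<le>n. \<Sum>l\<le>n - i. f i l) = (\<Sum>i\<le>n. \<Sum>l\<le>n. if i + l \<le> n then f i l else 0)"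
    by (simp add: *)
  also have "\<dots> = (\<Sum>l\<le>n. \<Sum>i\<le>n. if i + l \<le> n then f i l else 0)" by (rule sum.swap)
  also have "\<dots> = (\<Sum>l\<le>n. \<Sum>i\<le>n - l. f i l)" by (simp add: * add.commute)
  finally show ?thesis .
qed

text \<open>The value at step 0 counts as a jump from 0, like \<open>U(0)\<close> in the Stieltjes
  integral.\<close>

definition increments :: "(nat \<Rightarrow> 'j \<Rightarrow> real) \<Rightarrow> nat \<Rightarrow> 'j \<Rightarrow> real" where
  "increments V i j = V i j - (if i = 0 then 0 else V (i - 1) j)"

lemma sum_increments: "(\<Sum>l\<le>i. increments V l j) = V i j"
  by (induction i) (auto simp: increments_def)

lemma increments_nonneg:
  assumes "\<And>j. V 0 j \<ge> 0" "\<And>i j. V i j \<le> V (Suc i) j"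
  shows "increments V i j \<ge> 0"
  using assms(1)[of j] assms(2)[of "i - 1" j] by (cases i) (auto simp: increments_def)

text \<open>Both objectives are compared with the sum of \<open>q l k * A k j * v i j\<close> over
  \<open>i + l \<le> n\<close>: the dual constraints at \<open>n - i\<close> bound it from below,
  the primal ones at \<open>n - l\<close> from above. Separate factors \<open>\<theta>\<close> and
  \<open>\<theta>'\<close> allow a homogeneous path to be paired with an ordinary one.\<close>

lemma grid_weak_duality:
  fixes A :: "'k::finite \<Rightarrow> 'j::finite \<Rightarrow> real"
  assumes n: "n \<ge> 1"
    and V: "\<And>j. V 0 j \<ge> 0" "\<And>i j. V i j \<le> V (Suc i) j"
    and AV: "\<And>i k. i \<le> n \<Longrightarrow> app A (V i) k \<le> \<theta> * (\<beta> k + b k * grid T n i)"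
    and Q: "\<And>k. Q 0 k \<ge> 0" "\<And>i k. Q i k \<le> Q (Suc i) k"
    and AQ: "\<And>i j. i \<le> n \<Longrightarrow> app (\<lambda>j k. - A k j) (Q i) j \<le> - (\<theta>' * (\<gamma> j + c j * grid T n i))"
  shows "\<theta>' * grid_obj \<gamma> c T n V \<le> \<theta> * grid_obj \<beta> b T n Q"
proof -
  define v where "v = increments V"
  define q where "q = increments Q"
  have Vs: "V i j = (\<Sum>l\<le>i. v l j)" and Qs: "Q i k = (\<Sum>l\<le>i. q l k)" for i j k
    by (simp_all add: v_def q_def sum_increments)
  have nn: "v i j \<ge> 0" "q i k \<ge> 0" for i j k
    using increments_nonneg[of V, OF V] increments_nonneg[of Q, OF Q] by (simp_all add: v_def q_def)
  have "\<theta>' * grid_obj \<gamma> c T n V = (\<Sum>i\<le>n. \<Sum>j\<in>UNIV. (\<theta>' * (\<gamma> j + c j * grid T n (n - i))) * v i j)"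
    by (subst grid_obj_increments[OF n Vs]) (simp add: sum_distrib_left mult.assoc)
  also have "\<dots> \<le> (\<Sum>i\<le>n. \<Sum>j\<in>UNIV. (\<Sum>k\<in>UNIV. A k j * Q (n - i) k) * v i j)"
    using AQ[of "n - i" for i] by (intro sum_mono mult_right_mono nn) (simp add: app_def sum_negf)
  also have "\<dots> = (\<Sum>i\<le>n. \<Sum>l\<le>n - i. \<Sum>k\<in>UNIV. \<Sum>j\<in>UNIV. q l k * (A k j * v i j))"
  proof (rule sum.cong[OF refl])
    fix i
    have "(\<Sum>j\<in>UNIV. (\<Sum>k\<in>UNIV. A k j * Q (n - i) k) * v i j)
        = (\<Sum>j\<in>UNIV. \<Sum>k\<in>UNIV. \<Sum>l\<le>n - i. q l k * (A k j * v i j))"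
      by (simp add: Qs sum_distrib_left sum_distrib_right mult_ac)
    also have "\<dots> = (\<Sum>k\<in>UNIV. \<Sum>j\<in>UNIV. \<Sum>l\<le>n - i. q l k * (A k j * v i j))"
      by (rule sum.swap)
    also have "\<dots> = (\<Sum>k\<in>UNIV. \<Sum>l\<le>n - i. \<Sum>j\<in>UNIV. q l k * (A k j * v i j))"
      by (intro sum.cong refl sum.swap)
    also have "\<dots> = (\<Sum>l\<le>n - i. \<Sum>k\<in>UNIV. \<Sum>j\<in>UNIV. q l k * (A k j * v i j))"
      by (rule sum.swap)
    finally show "(\<Sum>j\<in>UNIV. (\<Sum>k\<in>UNIV. A k j * Q (n - i) k) * v i j) = \<dots>" .
  qed
  also have "\<dots> = (\<Sum>l\<le>n. \<Sum>i\<le>n - l. \<Sum>k\<in>UNIV. \<Sum>j\<in>UNIV. q l k * (A k j * v i j))"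
    by (rule sum_convolution_swap)
  also have "\<dots> = (\<Sum>l\<le>n. \<Sum>k\<in>UNIV. app A (V (n - l)) k * q l k)"
  proof (rule sum.cong[OF refl])
    fix l
    have "(\<Sum>i\<le>n - l. \<Sum>k\<in>UNIV. \<Sum>j\<in>UNIV. q l k * (A k j * v i j))
        = (\<Sum>k\<in>UNIV. \<Sum>i\<le>n - l. \<Sum>j\<in>UNIV. q l k * (A k j * v i j))" by (rule sum.swap)
    also have "\<dots> = (\<Sum>k\<in>UNIV. \<Sum>j\<in>UNIV. \<Sum>i\<le>n - l. q l k * (A k j * v i j))"
      by (intro sum.cong refl sum.swap)
    also have "\<dots> = (\<Sum>k\<in>UNIV. app A (V (n - l)) k * q l k)"
      by (simp add: app_def Vs sum_distrib_left sum_distrib_right mult_ac)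
    finally show "(\<Sum>i\<le>n - l. \<Sum>k\<in>UNIV. \<Sum>j\<in>UNIV. q l k * (A k j * v i j)) = \<dots>" .
  qed
  also have "\<dots> \<le> (\<Sum>l\<le>n. \<Sum>k\<in>UNIV. (\<theta> * (\<beta> k + b k * grid T n (n - l))) * q l k)"
    by (intro sum_mono mult_right_mono nn AV) simp
  also have "\<dots> = \<theta> * grid_obj \<beta> b T n Q"
    by (subst grid_obj_increments[OF n Qs]) (simp add: sum_distrib_left mult.assoc)
  finally show ?thesis .
qed

lemma grid_obj_near:
  assumes n: "n \<ge> 1" and T: "T \<ge> 0" and d: "\<And>i j. \<bar>V i j - W i j\<bar> \<le> d"
  shows "\<bar>grid_obj g c T n V - grid_obj g c T n W\<bar> \<le> (\<Sum>j\<in>UNIV. \<bar>g j\<bar> + T * \<bar>c j\<bar>) * d"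
proof -
  have "\<bar>(g j * V n j + c j * (T / real n * (\<Sum>i<n. V i j))) - (g j * W n j + c j * (T / real n * (\<Sum>i<n. W i j)))\<bar>
      \<le> (\<bar>g j\<bar> + T * \<bar>c j\<bar>) * d" for j
  proof -
    have "\<bar>\<Sum>i<n. V i j - W i j\<bar> \<le> (\<Sum>i<n. d)" by (intro order_trans[OF sum_abs] sum_mono d)
    then have "T / real n * \<bar>\<Sum>i<n. V i j - W i j\<bar> \<le> T / real n * (real n * d)"
      using T by (intro mult_left_mono) auto
    then have "T / real n * \<bar>\<Sum>i<n. V i j - W i j\<bar> \<le> T * d" using n by simp
    then have 1: "\<bar>c j\<bar> * (T / real n * \<bar>\<Sum>i<n. V i j - W i j\<bar>) \<le> \<bar>c j\<bar> * (T * d)" by (rule mult_left_mono) simp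
    have 2: "\<bar>g j\<bar> * \<bar>V n j - W n j\<bar> \<le> \<bar>g j\<bar> * d" by (intro mult_left_mono d) simp
    have "(g j * V n j + c j * (T / real n * (\<Sum>i<n. V i j))) - (g j * W n j + c j * (T / real n * (\<Sum>i<n. W i j)))
      = g j * (V n j - W n j) + c j * (T / real n * (\<Sum>i<n. V i j - W i j))"
      by (simp add: sum_subtractf right_diff_distrib diff_divide_distrib)
    also have "\<bar>\<dots>\<bar> \<le> \<bar>g j\<bar> * \<bar>V n j - W n j\<bar> + \<bar>c j\<bar> * (T / real n * \<bar>\<Sum>i<n. V i j - W i j\<bar>)"
      using T by (intro order_trans[OF abs_triangle_ineq]) (simp add: abs_mult)
    finally show ?thesis using 1 2 by (simp add: algebra_simps)
  qed
  then have "(\<Sum>j\<in>UNIV. \<bar>(g j * V n j + c j * (T / real n * (\<Sum>i<n. V i j))) - (g j * W n j + c j * (T / real n * (\<Sum>i<n. W i j)))\<bar>)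
     \<le> (\<Sum>j\<in>UNIV. (\<bar>g j\<bar> + T * \<bar>c j\<bar>) * d)" by (intro sum_mono)
  then show ?thesis
    unfolding grid_obj_def sum_subtractf[symmetric] sum_distrib_right by (rule order_trans[OF sum_abs])
qed

lemma affine_feasible_app_le:
  assumes T: "T > 0" and x: "affine_feasible A \<beta> b T x0 x1" and s: "0 \<le> s" "s \<le> T"
  shows "app A (\<lambda>j. x0 j + s * x1 j) k \<le> \<beta> k + b k * s"
proof -
  have 1: "app A x0 k \<le> \<beta> k" "app A x0 k + T * app A x1 k \<le> \<beta> k + T * b k"
    using x by (auto simp: affine_feasible_def)
  define r where "r = s / T"
  have r: "0 \<le> r" "r \<le> 1" "s = r * T" using s T by (auto simp: r_def)
  have "(1 - r) * app A x0 k \<le> (1 - r) * \<beta> k"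
    by (rule mult_left_mono[OF 1(1)]) (use r in simp)
  moreover have "r * (app A x0 k + T * app A x1 k) \<le> r * (\<beta> k + T * b k)"
    by (rule mult_left_mono[OF 1(2) r(1)])
  ultimately show ?thesis unfolding app_simps r(3) by (simp add: algebra_simps)
qed

section \<open>Farkas alternative for the grid program with bounded mass\<close>

lemma tail_sum_reverse:
  fixes y :: "nat \<Rightarrow> real"
  assumes "l \<le> n"
  shows "(\<Sum>i\<le>n. if l \<le> i then y i else 0) = (\<Sum>i\<le>n - l. y (n - i))"
proof -
  have "(\<Sum>i\<le>n. if l \<le> i then y i else 0) = (\<Sum>i\<in>{l..n}. y i)"
    by (intro sum.mono_neutral_cong_right) auto
  also have "\<dots> = (\<Sum>i\<le>n - l. y (n - i))"
    using assms by (intro sum.reindex_bij_witness[of _ "\<lambda>i. n - i" "\<lambda>i. n - i"]) auto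
  finally show ?thesis .
qed

lemma grid_props:
  assumes "n \<ge> 1" "T > 0"
  shows "grid T n 0 = 0" "grid T n i \<le> grid T n (Suc i)" "i \<ge> n \<Longrightarrow> grid T n i = T" "0 \<le> grid T n i" "grid T n i \<le> T"
proof -
  show "grid T n i \<le> grid T n (Suc i)"
    using assms unfolding grid_def by (intro divide_right_mono mult_left_mono) auto
  show "grid T n i \<le> T"
    using assms mult_left_mono[of "real (min i n)" "real n" T] by (simp add: grid_def pos_divide_le_eq)
qed (use assms in \<open>auto simp: grid_def\<close>)

text \<open>The increments \<open>u l\<close> with \<open>l \<le> n\<close> are the unknowns of the
  finite program; sums frozen after step \<open>n\<close> make them a path over
  \<open>nat\<close>.\<close>

definition path_sum :: "nat \<Rightarrow> (nat \<Rightarrow> 'j \<Rightarrow> real) \<Rightarrow> nat \<Rightarrow> 'j \<Rightarrow> real" where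
  "path_sum n u i j = (\<Sum>l\<le>min i n. u l j)"

lemma path_sum_props:
  assumes "\<And>l j. l \<le> n \<Longrightarrow> u l j \<ge> 0"
  shows "path_sum n u 0 j \<ge> 0" "path_sum n u i j \<le> path_sum n u (Suc i) j" "i \<ge> n \<Longrightarrow> path_sum n u i = path_sum n u n"
    "path_sum n u i j \<le> (\<Sum>l\<le>n. u l j)"
  using assms by (auto simp: path_sum_def fun_eq_iff intro!: sum_mono2)

lemma app_path_sum: "app A (path_sum n u i) k = (\<Sum>l\<le>min i n. \<Sum>j\<in>UNIV. A k j * u l j)"
proof -
  have "app A (path_sum n u i) k = (\<Sum>j\<in>UNIV. \<Sum>l\<le>min i n. A k j * u l j)"
    by (simp add: app_def path_sum_def sum_distrib_left)
  then show ?thesis by (simp add: sum.swap[of _ UNIV])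
qed

lemma grid_obj_path_sum:
  "n \<ge> 1 \<Longrightarrow> grid_obj g c T n (path_sum n u) = (\<Sum>i\<le>n. \<Sum>j\<in>UNIV. (g j + c j * grid T n (n - i)) * u i j)"
  by (rule grid_obj_increments) (simp_all add: path_sum_def min_absorb1)

text \<open>Multipliers of primal rows become the increments \<open>q\<close> of a dual path, and
  those of dual rows the increments \<open>v\<close> of a primal path. The mass row has coefficient
  1 in every column, so its multiplier \<open>\<zeta>\<close> shows up as the same violation in
  every constraint.\<close>

lemma grid_farkas:
  fixes A :: "'k::finite \<Rightarrow> 'j::finite \<Rightarrow> real"
  assumes n: "n \<ge> 1"
    and none: "\<nexists>u p. (\<forall>i\<le>n. \<forall>j. u i j \<ge> 0) \<and> (\<forall>i\<le>n. \<forall>k. p i k \<ge> 0) \<and>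
      (\<forall>i\<le>n. \<forall>k. app A (path_sum n u i) k \<le> \<beta> k + b k * grid T n i) \<and>
      (\<forall>i\<le>n. \<forall>j. app (\<lambda>j k. - A k j) (path_sum n p i) j \<le> - (\<gamma> j + c j * grid T n i)) \<and>
      grid_obj \<beta> b T n (path_sum n p) - grid_obj \<gamma> c T n (path_sum n u) \<le> 0 \<and>
      (\<Sum>i\<le>n. \<Sum>j\<in>UNIV. u i j) + (\<Sum>i\<le>n. \<Sum>k\<in>UNIV. p i k) \<le> M"
  obtains \<theta> \<zeta> v q where "\<theta> \<ge> 0" "\<zeta> \<ge> 0" "\<And>i j. i \<le> n \<Longrightarrow> v i j \<ge> 0" "\<And>i k. i \<le> n \<Longrightarrow> q i k \<ge> 0"
    "\<And>i k. i \<le> n \<Longrightarrow> app A (path_sum n v i) k \<le> \<theta> * (\<beta> k + b k * grid T n i) + \<zeta>"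
    "\<And>i j. i \<le> n \<Longrightarrow> app (\<lambda>j k. - A k j) (path_sum n q i) j \<le> - (\<theta> * (\<gamma> j + c j * grid T n i)) + \<zeta>"
    "grid_obj \<beta> b T n (path_sum n q) - grid_obj \<gamma> c T n (path_sum n v) + M * \<zeta> < 0"
proof -
  let ?K = "{..n} \<times> (UNIV :: 'k set)" and ?J = "{..n} \<times> (UNIV :: 'j set)"
  let ?I = "?K <+> (?J <+> (UNIV :: bool set))"
  \<comment> \<open>Row tags: \<open>Inl\<close> for primal constraints, \<open>Inr (Inl _)\<close>
    for dual constraints, \<open>True\<close> for the objective comparison, \<open>False\<close> for
    the bound on the mass.\<close>
  define a where "a s w = (case s of
      Inl (i, k) \<Rightarrow> (case w of Inl (l, j) \<Rightarrow> if l \<le> i then A k j else 0 | Inr _ \<Rightarrow> 0)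
    | Inr (Inl (i, j)) \<Rightarrow> (case w of Inl _ \<Rightarrow> 0 | Inr (l, k) \<Rightarrow> if l \<le> i then - A k j else 0)
    | Inr (Inr True) \<Rightarrow> (case w of Inl (l, j) \<Rightarrow> - (\<gamma> j + c j * grid T n (n - l))
         | Inr (l, k) \<Rightarrow> \<beta> k + b k * grid T n (n - l))
    | Inr (Inr False) \<Rightarrow> 1)"
    for s :: "nat \<times> 'k + (nat \<times> 'j + bool)" and w :: "nat \<times> 'j + nat \<times> 'k"
  define f where "f s = (case s of Inl (i, k) \<Rightarrow> \<beta> k + b k * grid T n i
    | Inr (Inl (i, j)) \<Rightarrow> - (\<gamma> j + c j * grid T n i) | Inr (Inr True) \<Rightarrow> 0 | Inr (Inr False) \<Rightarrow> M)"
    for s :: "nat \<times> 'k + (nat \<times> 'j + bool)"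
  have finJK: "finite ?J" "finite ?K" by simp_all
  have sumJ: "(\<Sum>w\<in>?J. g w) = (\<Sum>l\<le>n. \<Sum>j\<in>UNIV. g (l, j))" for g :: "nat \<times> 'j \<Rightarrow> real"
    by (simp add: sum.cartesian_product)
  have sumK: "(\<Sum>w\<in>?K. g w) = (\<Sum>l\<le>n. \<Sum>k\<in>UNIV. g (l, k))" for g :: "nat \<times> 'k \<Rightarrow> real"
    by (simp add: sum.cartesian_product)
  have sumV: "(\<Sum>w\<in>?J <+> ?K. g w) = (\<Sum>l\<le>n. \<Sum>j\<in>UNIV. g (Inl (l, j))) + (\<Sum>l\<le>n. \<Sum>k\<in>UNIV. g (Inr (l, k)))"
    for g :: "nat \<times> 'j + nat \<times> 'k \<Rightarrow> real"
    unfolding sum.Plus[OF finJK] sumJ sumK by simp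
  have sumI: "(\<Sum>s\<in>?I. g s) = (\<Sum>l\<le>n. \<Sum>k\<in>UNIV. g (Inl (l, k))) + (\<Sum>l\<le>n. \<Sum>j\<in>UNIV. g (Inr (Inl (l, j))))
      + g (Inr (Inr True)) + g (Inr (Inr False))" for g :: "nat \<times> 'k + (nat \<times> 'j + bool) \<Rightarrow> real"
    using finJK by (subst sum.Plus, simp, simp, subst sum.Plus, simp, simp) (simp add: sumJ sumK UNIV_bool)
  have trunc: "(\<Sum>l\<le>n. if l \<le> i then g l else 0) = (\<Sum>l\<le>i. g l)" if "i \<le> n" for i and g :: "nat \<Rightarrow> real"
    using that by (intro sum.mono_neutral_cong_right) auto
  have none': "\<nexists>x. (\<forall>w\<in>?J <+> ?K. x w \<ge> 0) \<and> (\<forall>s\<in>?I. (\<Sum>w\<in>?J <+> ?K. a s w * x w) \<le> f s)"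
  proof
    assume "\<exists>x. (\<forall>w\<in>?J <+> ?K. x w \<ge> 0) \<and> (\<forall>s\<in>?I. (\<Sum>w\<in>?J <+> ?K. a s w * x w) \<le> f s)"
    then obtain x where x0: "\<forall>w\<in>?J <+> ?K. x w \<ge> 0" and x: "\<forall>s\<in>?I. (\<Sum>w\<in>?J <+> ?K. a s w * x w) \<le> f s" by blast
    define u where "u i j = x (Inl (i, j))" for i j
    define p where "p i k = x (Inr (i, k))" for i k
    show False
    proof (rule notE[OF none], rule exI[of _ u], rule exI[of _ p], intro conjI allI impI)
      show "u i j \<ge> 0" if "i \<le> n" for i j using x0 that by (auto simp: u_def)
      show "p i k \<ge> 0" if "i \<le> n" for i k using x0 that by (auto simp: p_def)
      show "app A (path_sum n u i) k \<le> \<beta> k + b k * grid T n i" if i: "i \<le> n" for i k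
      proof -
        have "(\<Sum>w\<in>?J <+> ?K. a (Inl (i, k)) w * x w) = (\<Sum>l\<le>n. if l \<le> i then (\<Sum>j\<in>UNIV. A k j * u l j) else 0)"
          unfolding sumV by (simp add: a_def u_def if_distrib[of "\<lambda>z. z * _"] cong: if_cong) (intro sum.cong refl, simp)
        also have "\<dots> = app A (path_sum n u i) k" unfolding app_path_sum trunc[OF i] using i by (simp add: min_absorb1)
        finally show ?thesis using bspec[OF x, of "Inl (i, k)"] i by (auto simp: f_def)
      qed
      show "app (\<lambda>j k. - A k j) (path_sum n p i) j \<le> - (\<gamma> j + c j * grid T n i)" if i: "i \<le> n" for i j
      proof -
        have "(\<Sum>w\<in>?J <+> ?K. a (Inr (Inl (i, j))) w * x w) = (\<Sum>l\<le>n. if l \<le> i then (\<Sum>k\<in>UNIV. - A k j * p l k) else 0)"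
          unfolding sumV by (simp add: a_def p_def if_distrib[of "\<lambda>z. z * _"] cong: if_cong) (intro sum.cong refl, simp)
        also have "\<dots> = app (\<lambda>j k. - A k j) (path_sum n p i) j" unfolding app_path_sum trunc[OF i] using i by (simp add: min_absorb1)
        finally show ?thesis using bspec[OF x, of "Inr (Inl (i, j))"] i by (auto simp: f_def)
      qed
      show "grid_obj \<beta> b T n (path_sum n p) - grid_obj \<gamma> c T n (path_sum n u) \<le> 0"
        using bspec[OF x, OF InrI[OF InrI[OF UNIV_I]], of True] unfolding sumV grid_obj_path_sum[OF n]
        by (simp add: a_def f_def u_def p_def sum_negf del: minus_add_distrib)
      show "(\<Sum>i\<le>n. \<Sum>j\<in>UNIV. u i j) + (\<Sum>i\<le>n. \<Sum>k\<in>UNIV. p i k) \<le> M"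
        using bspec[OF x, OF InrI[OF InrI[OF UNIV_I]], of False] unfolding sumV
        by (simp add: a_def f_def u_def p_def)
    qed
  qed
  have finV: "finite (?J <+> ?K)" and finI: "finite ?I" using finJK by simp_all
  obtain y where y0: "\<And>s. s \<in> ?I \<Longrightarrow> y s \<ge> 0" and y: "\<And>w. w \<in> ?J <+> ?K \<Longrightarrow> (\<Sum>s\<in>?I. y s * a s w) \<ge> 0"
    and yf: "(\<Sum>s\<in>?I. y s * f s) < 0"
    using farkas_nonneg[OF finV finI none'] by blast
  define \<theta> where "\<theta> = y (Inr (Inr True))"
  define \<zeta> where "\<zeta> = y (Inr (Inr False))"
  \<comment> \<open>Column \<open>l\<close> collects the multipliers of all rows at step
    \<open>l\<close> or later. Reading them backwards turns these tail sums into partial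
    sums.\<close>
  define q where "q i k = y (Inl (n - i, k))" for i k
  define v where "v i j = y (Inr (Inl (n - i, j)))" for i j
  have if_sum: "(\<Sum>k\<in>UNIV. if P then g k else 0) = (if P then \<Sum>k\<in>UNIV. g k else 0)"
    for P and g :: "'k \<Rightarrow> real" by simp
  show ?thesis
  proof (rule that[of \<theta> \<zeta> v q])
    show "\<theta> \<ge> 0" "\<zeta> \<ge> 0" unfolding \<theta>_def \<zeta>_def by (rule y0, auto)+
    show "v i j \<ge> 0" if "i \<le> n" for i j unfolding v_def by (rule y0) auto
    show "q i k \<ge> 0" if "i \<le> n" for i k unfolding q_def by (rule y0) auto
    show "app A (path_sum n v i) k \<le> \<theta> * (\<beta> k + b k * grid T n i) + \<zeta>" if i: "i \<le> n" for i k
    proof -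
      let ?l = "n - i"
      have l: "?l \<le> n" "n - ?l = i" using i by auto
      have "0 \<le> (\<Sum>s\<in>?I. y s * a s (Inr (?l, k)))" by (rule y) auto
      also have "\<dots> = (\<Sum>i'\<le>n. if ?l \<le> i' then - (\<Sum>j\<in>UNIV. A k j * y (Inr (Inl (i', j)))) else 0) + \<theta> * (\<beta> k + b k * grid T n i) + \<zeta>"
        unfolding sumI using l
        by (simp add: a_def \<theta>_def \<zeta>_def sum_negf[symmetric] mult.commute if_distrib[of "\<lambda>z. _ * z"] cong: if_cong) (intro sum.cong refl, simp)
      also have "(\<Sum>i'\<le>n. if ?l \<le> i' then - (\<Sum>j\<in>UNIV. A k j * y (Inr (Inl (i', j)))) else 0) = - app A (path_sum n v i) k"
        unfolding tail_sum_reverse[OF l(1)] l(2) app_path_sum using i by (simp add: v_def sum_negf min_absorb1)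
      finally show ?thesis by simp
    qed
    show "app (\<lambda>j k. - A k j) (path_sum n q i) j \<le> - (\<theta> * (\<gamma> j + c j * grid T n i)) + \<zeta>" if i: "i \<le> n" for i j
    proof -
      let ?l = "n - i"
      have l: "?l \<le> n" "n - ?l = i" using i by auto
      have "0 \<le> (\<Sum>s\<in>?I. y s * a s (Inl (?l, j)))" by (rule y) auto
      also have "\<dots> = (\<Sum>i'\<le>n. if ?l \<le> i' then (\<Sum>k\<in>UNIV. A k j * y (Inl (i', k))) else 0) - \<theta> * (\<gamma> j + c j * grid T n i) + \<zeta>"
        unfolding sumI using l
        by (simp add: a_def \<theta>_def \<zeta>_def mult.commute if_sum if_distrib[of "\<lambda>z. _ * z"] right_diff_distrib distrib_left cong: if_cong)
      also have "(\<Sum>i'\<le>n. if ?l \<le> i' then (\<Sum>k\<in>UNIV. A k j * y (Inl (i', k))) else 0) = - app (\<lambda>j k. - A k j) (path_sum n q i) j"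
        unfolding tail_sum_reverse[OF l(1)] l(2) app_path_sum using i by (simp add: q_def sum_negf min_absorb1)
      finally show ?thesis by simp
    qed
    have rev: "(\<Sum>i\<le>n. g i) = (\<Sum>i\<le>n. g (n - i))" for g :: "nat \<Rightarrow> real"
      using tail_sum_reverse[of 0 n g] by simp
    have "(\<Sum>s\<in>?I. y s * f s) = (\<Sum>i\<le>n. \<Sum>k\<in>UNIV. y (Inl (i, k)) * (\<beta> k + b k * grid T n i))
        - (\<Sum>i\<le>n. \<Sum>j\<in>UNIV. y (Inr (Inl (i, j))) * (\<gamma> j + c j * grid T n i)) + M * \<zeta>"
      unfolding sumI by (simp add: f_def \<zeta>_def sum_negf mult.commute del: minus_add_distrib)
    also have "(\<Sum>i\<le>n. \<Sum>k\<in>UNIV. y (Inl (i, k)) * (\<beta> k + b k * grid T n i)) = grid_obj \<beta> b T n (path_sum n q)"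
      unfolding grid_obj_path_sum[OF n] by (subst rev) (simp add: q_def mult.commute)
    also have "(\<Sum>i\<le>n. \<Sum>j\<in>UNIV. y (Inr (Inl (i, j))) * (\<gamma> j + c j * grid T n i)) = grid_obj \<gamma> c T n (path_sum n v)"
      unfolding grid_obj_path_sum[OF n] by (subst rev) (simp add: v_def mult.commute)
    finally show "grid_obj \<beta> b T n (path_sum n q) - grid_obj \<gamma> c T n (path_sum n v) + M * \<zeta> < 0"
      using yf by simp
  qed
qed

definition grid_path :: "nat \<Rightarrow> (nat \<Rightarrow> 'j \<Rightarrow> real) \<Rightarrow> bool" where
  "grid_path n V \<longleftrightarrow> (\<forall>j. V 0 j \<ge> 0) \<and> (\<forall>i j. V i j \<le> V (Suc i) j) \<and> (\<forall>i\<ge>n. V i = V n)"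

lemma grid_path_path_sum:
  "(\<And>l j. l \<le> n \<Longrightarrow> u l j \<ge> 0) \<Longrightarrow> grid_path n (path_sum n u)"
  unfolding grid_path_def using path_sum_props(1-3)[of n u] by metis

lemma path_sum_min: "path_sum n w (min i n) = path_sum n w i"
  by (simp add: path_sum_def fun_eq_iff)

lemma bounded_grid_pair:
  fixes A :: "'k::finite \<Rightarrow> 'j::finite \<Rightarrow> real"
  assumes T: "T > 0" and primal: "affine_feasible A \<beta> b T x0 x1"
    and dual: "affine_feasible (\<lambda>j k. - A k j) (\<lambda>j. - \<gamma> j) (\<lambda>j. - c j) T y0 y1"
  obtains M where "\<And>n. n \<ge> 1 \<Longrightarrow> \<exists>U P. grid_path n U \<and> grid_path n P \<and>
      (\<forall>i k. app A (U i) k \<le> \<beta> k + b k * grid T n i) \<and>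
      (\<forall>i j. app (\<lambda>j k. - A k j) (P i) j \<le> - (\<gamma> j + c j * grid T n i)) \<and>
      grid_obj \<beta> b T n P \<le> grid_obj \<gamma> c T n U \<and> (\<forall>i j. U i j \<le> M) \<and> (\<forall>i k. P i k \<le> M)"
proof (rule repair_path[OF T primal])
  fix C :: real
  assume C: "C \<ge> 0" and rep: "\<And>\<theta> \<xi> V t n. \<lbrakk>\<theta> \<ge> 0; \<xi> \<ge> 0; t 0 = 0; \<And>i::nat. t i \<le> t (Suc i); \<And>i. i \<ge> n \<Longrightarrow> t i = T;
      \<And>j. V 0 j \<ge> 0; \<And>i j. V i j \<le> V (Suc i) j; \<And>i. i \<ge> n \<Longrightarrow> V i = V n;
      \<And>i k. app A (V i) k \<le> \<theta> * (\<beta> k + b k * t i) + \<xi>\<rbrakk> \<Longrightarrow>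
      \<exists>V'. (\<forall>j. V' 0 j \<ge> 0) \<and> (\<forall>i j. V' i j \<le> V' (Suc i) j) \<and>
        (\<forall>i k. app A (V' i) k \<le> \<theta> * (\<beta> k + b k * t i)) \<and> (\<forall>i j. \<bar>V' i j - V i j\<bar> \<le> C * \<xi>)"
  show thesis
  proof (rule repair_path[OF T dual])
    fix C' :: real
    assume C': "C' \<ge> 0" and rep': "\<And>\<theta> \<xi> V t n. \<lbrakk>\<theta> \<ge> 0; \<xi> \<ge> 0; t 0 = 0; \<And>i::nat. t i \<le> t (Suc i); \<And>i. i \<ge> n \<Longrightarrow> t i = T;
      \<And>j. V 0 j \<ge> 0; \<And>i j. V i j \<le> V (Suc i) j; \<And>i. i \<ge> n \<Longrightarrow> V i = V n;
      \<And>i k. app (\<lambda>j k. - A k j) (V i) k \<le> \<theta> * (- \<gamma> k + - c k * t i) + \<xi>\<rbrakk> \<Longrightarrow>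
      \<exists>V'. (\<forall>j. V' 0 j \<ge> 0) \<and> (\<forall>i j. V' i j \<le> V' (Suc i) j) \<and>
        (\<forall>i k. app (\<lambda>j k. - A k j) (V' i) k \<le> \<theta> * (- \<gamma> k + - c k * t i)) \<and> (\<forall>i j. \<bar>V' i j - V i j\<bar> \<le> C' * \<xi>)"
    define K where "K = (\<Sum>j\<in>UNIV. \<bar>\<gamma> j\<bar> + T * \<bar>c j\<bar>)"
    define K' where "K' = (\<Sum>k\<in>UNIV. \<bar>\<beta> k\<bar> + T * \<bar>b k\<bar>)"
    \<comment> \<open>\<open>M * \<zeta>\<close> is the total change of the two objectives under
      repairs of a violation \<open>\<zeta>\<close>, so the certificate would leave a repaired pair
      with dual objective below primal objective.\<close>
    define M where "M = K * C + K' * C'"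
    have ex: "\<exists>u p. (\<forall>i\<le>n. \<forall>j. u i j \<ge> 0) \<and> (\<forall>i\<le>n. \<forall>k. p i k \<ge> 0) \<and>
      (\<forall>i\<le>n. \<forall>k. app A (path_sum n u i) k \<le> \<beta> k + b k * grid T n i) \<and>
      (\<forall>i\<le>n. \<forall>j. app (\<lambda>j k. - A k j) (path_sum n p i) j \<le> - (\<gamma> j + c j * grid T n i)) \<and>
      grid_obj \<beta> b T n (path_sum n p) - grid_obj \<gamma> c T n (path_sum n u) \<le> 0 \<and>
      (\<Sum>i\<le>n. \<Sum>j\<in>UNIV. u i j) + (\<Sum>i\<le>n. \<Sum>k\<in>UNIV. p i k) \<le> M" if n: "n \<ge> 1" for n
    proof (rule ccontr, rule grid_farkas[OF n, of A \<beta> b T \<gamma> c M], assumption)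
      fix \<theta> \<zeta> :: real and v q
      assume \<theta>: "\<theta> \<ge> 0" and \<zeta>: "\<zeta> \<ge> 0" and v: "\<And>i j. i \<le> n \<Longrightarrow> v i j \<ge> 0" and q: "\<And>i k. i \<le> n \<Longrightarrow> q i k \<ge> 0"
        and Av: "\<And>i k. i \<le> n \<Longrightarrow> app A (path_sum n v i) k \<le> \<theta> * (\<beta> k + b k * grid T n i) + \<zeta>"
        and Aq: "\<And>i j. i \<le> n \<Longrightarrow> app (\<lambda>j k. - A k j) (path_sum n q i) j \<le> - (\<theta> * (\<gamma> j + c j * grid T n i)) + \<zeta>"
        and neg: "grid_obj \<beta> b T n (path_sum n q) - grid_obj \<gamma> c T n (path_sum n v) + M * \<zeta> < 0"
      define V where "V = path_sum n v"
      define Q where "Q = path_sum n q"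
      note gp = grid_props[OF n T]
      have V: "V 0 j \<ge> 0" "V i j \<le> V (Suc i) j" "i \<ge> n \<Longrightarrow> V i = V n" for i j
        unfolding V_def by (intro path_sum_props v; assumption)+
      have Q: "Q 0 k \<ge> 0" "Q i k \<le> Q (Suc i) k" "i \<ge> n \<Longrightarrow> Q i = Q n" for i k
        unfolding Q_def by (intro path_sum_props q; assumption)+
      have AV: "app A (V i) k \<le> \<theta> * (\<beta> k + b k * grid T n i) + \<zeta>" for i k
      proof (cases "i \<le> n")
        case False
        then show ?thesis using Av[of n k] V(3)[of i] gp(3)[of i] gp(3)[of n] by (simp add: V_def)
      qed (simp add: V_def Av)
      have AQ: "app (\<lambda>j k. - A k j) (Q i) j \<le> \<theta> * (- \<gamma> j + - c j * grid T n i) + \<zeta>" for i j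
      proof -
        have "app (\<lambda>j k. - A k j) (Q i) j \<le> - (\<theta> * (\<gamma> j + c j * grid T n i)) + \<zeta>"
        proof (cases "i \<le> n")
          case False
          then show ?thesis using Aq[of n j] Q(3)[of i] gp(3)[of i] gp(3)[of n] by (simp add: Q_def)
        next
          case True
          then show ?thesis unfolding Q_def by (rule Aq)
        qed
        then show ?thesis by (simp add: algebra_simps)
      qed
      have "\<exists>V'. (\<forall>j. V' 0 j \<ge> 0) \<and> (\<forall>i j. V' i j \<le> V' (Suc i) j) \<and>
        (\<forall>i k. app A (V' i) k \<le> \<theta> * (\<beta> k + b k * grid T n i)) \<and> (\<forall>i j. \<bar>V' i j - V i j\<bar> \<le> C * \<zeta>)"
        by (rule rep[OF \<theta> \<zeta> gp(1,2,3) V AV])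
      then obtain V' where V': "\<And>j. V' 0 j \<ge> 0" "\<And>i j. V' i j \<le> V' (Suc i) j"
        "\<And>i k. app A (V' i) k \<le> \<theta> * (\<beta> k + b k * grid T n i)" "\<And>i j. \<bar>V' i j - V i j\<bar> \<le> C * \<zeta>" by metis
      have "\<exists>V'. (\<forall>j. V' 0 j \<ge> 0) \<and> (\<forall>i j. V' i j \<le> V' (Suc i) j) \<and>
        (\<forall>i k. app (\<lambda>j k. - A k j) (V' i) k \<le> \<theta> * (- \<gamma> k + - c k * grid T n i)) \<and> (\<forall>i j. \<bar>V' i j - Q i j\<bar> \<le> C' * \<zeta>)"
        by (rule rep'[OF \<theta> \<zeta> gp(1,2,3) Q AQ])
      then obtain Q' where Q': "\<And>j. Q' 0 j \<ge> 0" "\<And>i j. Q' i j \<le> Q' (Suc i) j"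
        "\<And>i k. app (\<lambda>j k. - A k j) (Q' i) k \<le> \<theta> * (- \<gamma> k + - c k * grid T n i)" "\<And>i j. \<bar>Q' i j - Q i j\<bar> \<le> C' * \<zeta>" by metis
      have AQ': "app (\<lambda>j k. - A k j) (Q' i) j \<le> - (\<theta> * (\<gamma> j + c j * grid T n i))" for i j
        using Q'(3)[of i j] by (simp add: algebra_simps)
      have weak: "grid_obj \<gamma> c T n V' \<le> grid_obj \<beta> b T n Q'"
      proof (cases "\<theta> = 0")
        case False
        have "\<theta> * grid_obj \<gamma> c T n V' \<le> \<theta> * grid_obj \<beta> b T n Q'"
          by (rule grid_weak_duality[OF n V'(1,2) V'(3) Q'(1,2) AQ'])
        then show ?thesis using \<theta> False by simp
      next
        \<comment> \<open>Weak duality scaled by \<open>\<theta> = 0\<close> is empty. Instead, each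
          homogeneous path is paired with an affine feasible path of the other problem, which puts 0
          between the two objectives.\<close>
        case True
        define X where "X i j = x0 j + grid T n i * x1 j" for i j
        define Y where "Y i k = y0 k + grid T n i * y1 k" for i k
        have X: "X 0 j \<ge> 0" "X i j \<le> X (Suc i) j" for i j
          using primal gp by (auto simp: X_def affine_feasible_def intro: mult_right_mono)
        have Y: "Y 0 k \<ge> 0" "Y i k \<le> Y (Suc i) k" for i k
          using dual gp by (auto simp: Y_def affine_feasible_def intro: mult_right_mono)
        have AX: "app A (X i) k \<le> 1 * (\<beta> k + b k * grid T n i)" for i k
          unfolding X_def using affine_feasible_app_le[OF T primal gp(4,5)] by simp
        have AY: "app (\<lambda>j k. - A k j) (Y i) j \<le> - (1 * (\<gamma> j + c j * grid T n i))" for i j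
          unfolding Y_def using affine_feasible_app_le[OF T dual gp(4,5)] by (simp add: algebra_simps)
        have Q0: "app (\<lambda>j k. - A k j) (Q' i) j \<le> - (0 * (\<gamma> j + c j * grid T n i))" for i j
          using AQ'[of i j] True by simp
        have V0: "app A (V' i) k \<le> 0 * (\<beta> k + b k * grid T n i)" for i k
          using V'(3)[of i k] True by simp
        have "0 * grid_obj \<gamma> c T n X \<le> 1 * grid_obj \<beta> b T n Q'"
          by (rule grid_weak_duality[OF n X AX Q'(1,2) Q0])
        moreover have "1 * grid_obj \<gamma> c T n V' \<le> 0 * grid_obj \<beta> b T n Y"
          by (rule grid_weak_duality[OF n V'(1,2) V0 Y AY])
        ultimately show ?thesis by simp
      qed
      have "\<bar>grid_obj \<gamma> c T n V' - grid_obj \<gamma> c T n V\<bar> \<le> K * (C * \<zeta>)"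
        unfolding K_def using T by (intro grid_obj_near[OF n _ V'(4)]) simp
      moreover have "\<bar>grid_obj \<beta> b T n Q' - grid_obj \<beta> b T n Q\<bar> \<le> K' * (C' * \<zeta>)"
        unfolding K'_def using T by (intro grid_obj_near[OF n _ Q'(4)]) simp
      moreover have "M * \<zeta> = K * (C * \<zeta>) + K' * (C' * \<zeta>)" by (simp add: M_def algebra_simps)
      ultimately show False using neg weak unfolding V_def Q_def by linarith
    qed
    show thesis
    proof (rule that[of M])
      fix n :: nat assume n: "n \<ge> 1"
      obtain u p where u: "\<forall>i\<le>n. \<forall>j. u i j \<ge> 0" and p: "\<forall>i\<le>n. \<forall>k. p i k \<ge> 0"
        and Au: "\<forall>i\<le>n. \<forall>k. app A (path_sum n u i) k \<le> \<beta> k + b k * grid T n i"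
        and Ap: "\<forall>i\<le>n. \<forall>j. app (\<lambda>j k. - A k j) (path_sum n p i) j \<le> - (\<gamma> j + c j * grid T n i)"
        and obj: "grid_obj \<beta> b T n (path_sum n p) - grid_obj \<gamma> c T n (path_sum n u) \<le> 0"
        and sum: "(\<Sum>i\<le>n. \<Sum>j\<in>UNIV. u i j) + (\<Sum>i\<le>n. \<Sum>k\<in>UNIV. p i k) \<le> M"
        using ex[OF n] by (elim exE conjE)
      note gp = grid_props[OF n T]
      have uG: "grid_path n (path_sum n u)" and pG: "grid_path n (path_sum n p)"
        using u p by (auto intro: grid_path_path_sum)
      have ub: "path_sum n u i j \<le> M" for i j
      proof -
        have "path_sum n u i j \<le> (\<Sum>l\<le>n. u l j)" by (rule path_sum_props(4)) (use u in auto)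
        also have "\<dots> \<le> (\<Sum>l\<le>n. \<Sum>j\<in>UNIV. u l j)" using u by (intro sum_mono member_le_sum) auto
        also have "\<dots> \<le> M"
        proof -
          have "0 \<le> (\<Sum>i\<le>n. \<Sum>k\<in>UNIV. p i k)" using p by (intro sum_nonneg) auto
          then show ?thesis using sum by linarith
        qed
        finally show ?thesis .
      qed
      have pb: "path_sum n p i k \<le> M" for i k
      proof -
        have "path_sum n p i k \<le> (\<Sum>l\<le>n. p l k)" by (rule path_sum_props(4)) (use p in auto)
        also have "\<dots> \<le> (\<Sum>l\<le>n. \<Sum>k\<in>UNIV. p l k)" using p by (intro sum_mono member_le_sum) auto
        also have "\<dots> \<le> M"
        proof -
          have "0 \<le> (\<Sum>i\<le>n. \<Sum>j\<in>UNIV. u i j)" using u by (intro sum_nonneg) auto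
          then show ?thesis using sum by linarith
        qed
        finally show ?thesis .
      qed
      have Au': "app A (path_sum n u i) k \<le> \<beta> k + b k * grid T n i" for i k
        using Au[rule_format, of "min i n" k] by (simp add: path_sum_min grid_def)
      have Ap': "app (\<lambda>j k. - A k j) (path_sum n p i) j \<le> - (\<gamma> j + c j * grid T n i)" for i j
        using Ap[rule_format, of "min i n" j] by (simp add: path_sum_min grid_def)
      show "\<exists>U P. grid_path n U \<and> grid_path n P \<and>
        (\<forall>i k. app A (U i) k \<le> \<beta> k + b k * grid T n i) \<and>
        (\<forall>i j. app (\<lambda>j k. - A k j) (P i) j \<le> - (\<gamma> j + c j * grid T n i)) \<and>
        grid_obj \<beta> b T n P \<le> grid_obj \<gamma> c T n U \<and> (\<forall>i j. U i j \<le> M) \<and> (\<forall>i k. P i k \<le> M)"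
        by (rule exI[of _ "path_sum n u"], rule exI[of _ "path_sum n p"])
          (intro conjI allI uG pG Au' Ap' ub pb, use obj in simp)
    qed
  qed
qed

subsection \<open>Stieltjes integrals and Riemann sums\<close>

text \<open>The interval is closed at 0 and so includes the jump there. The half-open interval from
  -1 to \<open>s\<close> has measure \<open>F s\<close>, and its part below 0 is null, being
  exhausted by half-open intervals on which \<open>F\<close> vanishes.\<close>

lemma emeasure_interval_measure_from_0:
  assumes mono: "mono F" and rc: "\<And>x. continuous (at_right x) F"
    and zero: "\<And>t. t < 0 \<Longrightarrow> F t = 0" and s: "s \<ge> 0"
  shows "emeasure (interval_measure F) {0..s} = ennreal (F s)"
proof -
  let ?\<mu> = "interval_measure F"
  have F: "\<And>x y. x \<le> y \<Longrightarrow> F x \<le> F y" using mono by (rule monoD)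
  have "{- 1 <..< 0 :: real} = (\<Union>n. {- 1 <.. - 1 / real (Suc n)})"
  proof (intro equalityI subsetI)
    fix x :: real assume x: "x \<in> {- 1 <..< 0}"
    obtain n where "inverse (real (Suc n)) < - x" using x reals_Archimedean[of "- x"] by auto
    then have "x \<le> - 1 / real (Suc n)" by (simp add: inverse_eq_divide)
    then show "x \<in> (\<Union>n. {- 1 <.. - 1 / real (Suc n)})" using x by auto
  next
    fix x :: real assume "x \<in> (\<Union>n. {- 1 <.. - 1 / real (Suc n)})"
    then obtain n where "- 1 < x" "x \<le> - 1 / real (Suc n)" by auto
    moreover have "- 1 / real (Suc n) < 0" by simp
    ultimately show "x \<in> {- 1 <..< 0}" by (meson greaterThanLessThan_iff order_le_less_trans)
  qed
  moreover have "(\<Union>n. {- 1 <.. - 1 / real (Suc n)}) \<in> null_sets ?\<mu>"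
  proof (intro null_sets_UN null_setsI)
    fix n :: nat
    have "- 1 / real (Suc n) < 0" by simp
    then show "emeasure ?\<mu> {- 1 <.. - 1 / real (Suc n)} = 0"
      using emeasure_interval_measure_Ioc[of "- 1" "- 1 / real (Suc n)" F, OF _ F rc] zero by (simp add: divide_simps)
  qed simp
  ultimately have null: "{- 1 <..< 0 :: real} \<in> null_sets ?\<mu>" by metis
  have "{- 1 <.. s} = {0..s} \<union> {- 1 <..< 0}" using s by auto
  then have "emeasure ?\<mu> {0..s} = emeasure ?\<mu> {- 1 <.. s}"
    using emeasure_Un_null_set[OF _ null, of "{0..s}"] by simp
  also have "\<dots> = ennreal (F s)"
    using s zero by (subst emeasure_interval_measure_Ioc[OF _ F rc]) auto
  finally show ?thesis .
qed

text \<open>Integration by parts via Fubini on the triangle \<open>S\<close>: its sections have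
  Lebesgue measure \<open>T - t\<close> in one direction and Stieltjes measure \<open>F s\<close> in
  the other.\<close>

lemma set_integral_interval_measure_affine:
  assumes mono: "mono F" and rc: "\<And>x. continuous (at_right x) F"
    and zero: "\<And>t. t < 0 \<Longrightarrow> F t = 0" and T: "T \<ge> 0"
  shows "(\<integral>t\<in>{0..T}. (g + (T - t) * c) \<partial>(interval_measure F)) = g * F T + c * (\<integral>t\<in>{0..T}. F t \<partial>lborel)"
proof -
  let ?\<mu> = "interval_measure F"
  have F: "\<And>x y. x \<le> y \<Longrightarrow> F x \<le> F y" using mono by (rule monoD)
  have Fnn: "F s \<ge> 0" for s
  proof (cases "s < 0")
    case False
    have "F (- 1) \<le> F s" using False by (intro F) simp
    then show ?thesis using zero[of "- 1"] by simp
  qed (simp add: zero)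
  have em: "emeasure ?\<mu> {0..s} = ennreal (F s)" if "0 \<le> s" for s
    by (rule emeasure_interval_measure_from_0[OF mono rc zero that])
  interpret \<mu>: sigma_finite_measure ?\<mu> by (rule sigma_finite_interval_measure[OF F rc])
  interpret P: pair_sigma_finite ?\<mu> lborel ..
  have Fm: "F \<in> borel_measurable borel" by (rule borel_measurable_mono[OF mono])
  define S where "S = {z :: real \<times> real. 0 \<le> fst z \<and> fst z \<le> snd z \<and> snd z \<le> T}"
  have "closed S" unfolding S_def by (intro closed_Collect_conj closed_Collect_le continuous_intros)
  then have S: "S \<in> sets (borel \<Otimes>\<^sub>M borel)" unfolding borel_prod by (rule borel_closed)
  have Sm: "(\<lambda>z. indicator S z :: ennreal) \<in> borel_measurable (?\<mu> \<Otimes>\<^sub>M lborel)"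
    using S by (intro borel_measurable_indicator) (simp cong: sets_pair_measure_cong)
  have "(\<integral>\<^sup>+t. ennreal ((T - t) * indicator {0..T} t) \<partial>?\<mu>) = (\<integral>\<^sup>+t. (\<integral>\<^sup>+s. indicator S (t, s) \<partial>lborel) \<partial>?\<mu>)"
  proof (rule nn_integral_cong)
    fix t
    have "(\<lambda>s. indicator S (t, s) :: ennreal) = (\<lambda>s. indicator {0..T} t * indicator {t..T} s)"
      by (auto simp: S_def fun_eq_iff indicator_def)
    then have "(\<integral>\<^sup>+s. indicator S (t, s) \<partial>lborel) = indicator {0..T} t * emeasure lborel {t..T}"
      by (simp add: nn_integral_cmult)
    then show "ennreal ((T - t) * indicator {0..T} t) = (\<integral>\<^sup>+s. indicator S (t, s) \<partial>lborel)"
      by (auto simp: indicator_def)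
  qed
  also have "\<dots> = (\<integral>\<^sup>+s. (\<integral>\<^sup>+t. indicator S (t, s) \<partial>?\<mu>) \<partial>lborel)"
    by (rule P.Fubini'[symmetric]) (use Sm in \<open>simp add: case_prod_beta'\<close>)
  also have "\<dots> = (\<integral>\<^sup>+s. ennreal (F s * indicator {0..T} s) \<partial>lborel)"
  proof (rule nn_integral_cong)
    fix s
    have "(\<lambda>t. indicator S (t, s) :: ennreal) = (\<lambda>t. indicator {0..T} s * indicator {0..s} t)"
      by (auto simp: S_def fun_eq_iff indicator_def)
    then have "(\<integral>\<^sup>+t. indicator S (t, s) \<partial>?\<mu>) = indicator {0..T} s * emeasure ?\<mu> {0..s}"
      by (simp add: nn_integral_cmult)
    then show "(\<integral>\<^sup>+t. indicator S (t, s) \<partial>?\<mu>) = ennreal (F s * indicator {0..T} s)"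
      by (auto simp: indicator_def em)
  qed
  finally have nn: "(\<integral>\<^sup>+t. ennreal ((T - t) * indicator {0..T} t) \<partial>?\<mu>) = (\<integral>\<^sup>+s. ennreal (F s * indicator {0..T} s) \<partial>lborel)" .
  have "(\<integral>t. (T - t) * indicator {0..T} t \<partial>?\<mu>) = enn2real (\<integral>\<^sup>+t. ennreal ((T - t) * indicator {0..T} t) \<partial>?\<mu>)"
    by (rule integral_eq_nn_integral) (auto simp: indicator_def intro!: AE_I2)
  moreover have "(\<integral>s. F s * indicator {0..T} s \<partial>lborel) = enn2real (\<integral>\<^sup>+s. ennreal (F s * indicator {0..T} s) \<partial>lborel)"
    using Fm Fnn by (intro integral_eq_nn_integral) (auto simp: indicator_def intro!: AE_I2)
  ultimately have eq: "(\<integral>t\<in>{0..T}. (T - t) \<partial>?\<mu>) = (\<integral>t\<in>{0..T}. F t \<partial>lborel)"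
    using nn by (simp add: set_lebesgue_integral_def mult.commute)
  have fin: "emeasure ?\<mu> {0..T} < \<infinity>" using em[OF T] by simp
  have int1: "set_integrable ?\<mu> {0..T} (\<lambda>t. T - t)"
    unfolding set_integrable_def using fin T
    by (intro integrableI_bounded_set_indicator[where B = T]) (auto intro!: AE_I2)
  have int2: "set_integrable ?\<mu> {0..T} (\<lambda>t. g)"
    unfolding set_integrable_def using fin
    by (intro integrableI_bounded_set_indicator[where B = "\<bar>g\<bar>"]) (auto intro!: AE_I2)
  have "measure ?\<mu> {0..T} = F T" using em[OF T] Fnn by (simp add: measure_def)
  then have const: "(\<integral>t\<in>{0..T}. g \<partial>?\<mu>) = g * F T"
    by (simp add: set_lebesgue_integral_def)
  show ?thesis
    using set_integral_add(2)[OF int2 set_integrable_mult_left[OF int1, of c]] const eq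
    by (simp add: mult.commute)
qed

lemma set_integrable_mono:
  fixes F :: "real \<Rightarrow> real"
  assumes mono: "mono F" and S: "S \<in> sets borel" "S \<subseteq> {a..b}"
  shows "set_integrable lborel S F"
  unfolding set_integrable_def
proof (rule integrableI_bounded_set_indicator[where B = "\<bar>F a\<bar> + \<bar>F b\<bar>"])
  show "F \<in> borel_measurable lborel" using borel_measurable_mono[OF mono] by simp
  have "emeasure lborel S \<le> emeasure lborel {a..b}" using S by (intro emeasure_mono) auto
  also have "\<dots> < \<infinity>" by (simp add: emeasure_lborel_Icc_eq)
  finally show "emeasure lborel S < \<infinity>" .
  show "AE x in lborel. x \<in> S \<longrightarrow> norm (F x) \<le> \<bar>F a\<bar> + \<bar>F b\<bar>"
  proof (intro AE_I2 impI)
    fix x assume "x \<in> S"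
    then have "a \<le> x" "x \<le> b" using S(2) by auto
    then have "F a \<le> F x" "F x \<le> F b" by (simp_all add: monoD[OF mono])
    then show "norm (F x) \<le> \<bar>F a\<bar> + \<bar>F b\<bar>" by simp
  qed
qed (use S in simp)

text \<open>Left and right sums enclose the integral, and their difference telescopes. The bound
  involves \<open>F\<close> only through its total increase, hence is uniform over bounded
  families.\<close>

lemma riemann_sum_mono:
  fixes F :: "real \<Rightarrow> real"
  assumes mono: "mono F" and T: "T > 0" and n: "n \<ge> 1"
  shows "\<bar>(\<integral>t\<in>{0..T}. F t \<partial>lborel) - T / real n * (\<Sum>i<n. F (T * real i / real n))\<bar> \<le> T / real n * (F T - F 0)"
proof -
  define h where "h = T / real n"
  define t where "t i = T * real i / real n" for i
  have t: "t 0 = 0" "t n = T" "t (Suc i) = t i + h" "0 \<le> t i" for i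
    using T n by (auto simp: t_def h_def field_simps)
  have h: "h > 0" using T n by (simp add: h_def)
  have step: "h * F (t i) \<le> (\<integral>x\<in>{t i<..t (Suc i)}. F x \<partial>lborel)" "(\<integral>x\<in>{t i<..t (Suc i)}. F x \<partial>lborel) \<le> h * F (t (Suc i))" for i
  proof -
    have i1: "set_integrable lborel {t i<..t (Suc i)} F"
      by (rule set_integrable_mono[OF mono, of _ "t i" "t (Suc i)"]) auto
    have i2: "set_integrable lborel {t i<..t (Suc i)} (\<lambda>_. z)" for z :: real
      by (rule set_integrable_mono[of _ _ "t i" "t (Suc i)"]) (auto simp: mono_def)
    have c: "(\<integral>x\<in>{t i<..t (Suc i)}. z \<partial>lborel) = h * z" for z :: real
      using h by (simp add: set_lebesgue_integral_def t(3))
    show "h * F (t i) \<le> (\<integral>x\<in>{t i<..t (Suc i)}. F x \<partial>lborel)"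
      unfolding c[symmetric] by (rule set_integral_mono[OF i2 i1]) (auto intro: monoD[OF mono])
    show "(\<integral>x\<in>{t i<..t (Suc i)}. F x \<partial>lborel) \<le> h * F (t (Suc i))"
      unfolding c[symmetric] by (rule set_integral_mono[OF i1 i2]) (auto intro: monoD[OF mono])
  qed
  have "h * (\<Sum>i<m. F (t i)) \<le> (\<integral>x\<in>{0..t m}. F x \<partial>lborel) \<and> (\<integral>x\<in>{0..t m}. F x \<partial>lborel) \<le> h * (\<Sum>i<m. F (t (Suc i)))" for m
  proof (induction m)
    case 0
    have "(\<integral>x\<in>{0..0}. F x \<partial>lborel) = 0"
      unfolding set_lebesgue_integral_def
      by (rule integral_eq_zero_AE, rule eventually_mono[OF AE_lborel_singleton[of "0 :: real"]]) (simp add: indicator_def)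
    then show ?case by (simp add: t(1))
  next
    case (Suc m)
    have "{0..t (Suc m)} = {0..t m} \<union> {t m<..t (Suc m)}" using t(3,4)[of m] h by auto
    moreover have "(\<integral>x\<in>{0..t m} \<union> {t m<..t (Suc m)}. F x \<partial>lborel) =
        (\<integral>x\<in>{0..t m}. F x \<partial>lborel) + (\<integral>x\<in>{t m<..t (Suc m)}. F x \<partial>lborel)"
      by (intro set_integral_Un set_integrable_mono[OF mono, of _ 0 "t (Suc m)"]) (use t(3,4)[of m] h in auto)
    ultimately show ?case using Suc step[of m] by (simp add: algebra_simps)
  qed
  from this[of n] have 1: "h * (\<Sum>i<n. F (t i)) \<le> (\<integral>x\<in>{0..T}. F x \<partial>lborel)" "(\<integral>x\<in>{0..T}. F x \<partial>lborel) \<le> h * (\<Sum>i<n. F (t (Suc i)))"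
    by (simp_all add: t(2))
  have "(\<Sum>i<n. F (t (Suc i))) - (\<Sum>i<n. F (t i)) = F T - F 0"
    using sum_lessThan_telescope[of "\<lambda>i. F (t i)" n] t by (simp add: sum_subtractf)
  then have "h * (\<Sum>i<n. F (t (Suc i))) - h * (\<Sum>i<n. F (t i)) = h * (F T - F 0)"
    by (simp add: right_diff_distrib[symmetric])
  with 1 show ?thesis unfolding h_def[symmetric] t_def[symmetric] by (simp add: abs_le_iff)
qed

lemma ext0_mono:
  assumes "\<And>s t. 0 \<le> s \<Longrightarrow> s \<le> t \<Longrightarrow> t \<le> T \<Longrightarrow> u s \<le> u t" "u 0 \<ge> 0" "T \<ge> 0"
  shows "mono (ext0 T u)"
proof (rule monoI)
  fix x y :: real assume xy: "x \<le> y"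
  have nn: "u y \<ge> 0" if "0 \<le> y" "y \<le> T" for y using assms(1)[of 0 y] assms(2) that by simp
  show "ext0 T u x \<le> ext0 T u y"
    using xy assms(1) assms(3) nn[of y] nn[of T] by (auto simp: ext0_def)
qed

lemma ext0_right_continuous:
  assumes rc: "\<And>t. 0 \<le> t \<Longrightarrow> t < T \<Longrightarrow> (u \<longlongrightarrow> u t) (at_right t)" and T: "T \<ge> 0"
  shows "continuous (at_right x) (ext0 T u)"
proof -
  consider "x < 0" | "0 \<le> x" "x < T" | "x \<ge> T" by linarith
  then have "(ext0 T u \<longlongrightarrow> ext0 T u x) (at_right x)"
  proof cases
    case 1
    have "eventually (\<lambda>y. 0 = ext0 T u y) (at_right x)"
      using 1 by (auto simp: eventually_at_right ext0_def intro!: exI[of _ 0])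
    then show ?thesis using 1 by (intro Lim_transform_eventually[OF tendsto_const]) (auto simp: ext0_def elim: eventually_mono)
  next
    case 2
    have "eventually (\<lambda>y. u y = ext0 T u y) (at_right x)"
      using 2 by (auto simp: eventually_at_right ext0_def intro!: exI[of _ T])
    then show ?thesis using 2 rc[OF 2] by (auto intro: Lim_transform_eventually simp: ext0_def)
  next
    case 3
    have "eventually (\<lambda>y. u T = ext0 T u y) (at_right x)"
      using 3 T by (intro eventually_mono[OF eventually_at_right_less[of x]]) (auto simp: ext0_def)
    moreover have "ext0 T u x = u T" using 3 T by (auto simp: ext0_def)
    ultimately show ?thesis by (intro Lim_transform_eventually[OF tendsto_const]) auto
  qed
  then show ?thesis by (simp add: continuous_within)
qed

lemma LS_int_affine:
  assumes "\<And>s t. 0 \<le> s \<Longrightarrow> s \<le> t \<Longrightarrow> t \<le> T \<Longrightarrow> u s \<le> u t" "u 0 \<ge> 0" "T > 0"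
    and "\<And>t. 0 \<le> t \<Longrightarrow> t < T \<Longrightarrow> (u \<longlongrightarrow> u t) (at_right t)"
  shows "LS_int T u (\<lambda>t. g + (T - t) * c) = g * u T + c * (\<integral>t\<in>{0..T}. ext0 T u t \<partial>lborel)"
  unfolding LS_int_def
  using set_integral_interval_measure_affine[of "ext0 T u" T g c] ext0_mono[of T u] ext0_right_continuous[of T u] assms
  by (simp add: ext0_def)

subsection \<open>Passage to the limit\<close>

text \<open>Passing to a further subsequence keeps the limits already obtained, so the components
  can be treated one after another.\<close>

lemma helly_selection_family:
  fixes f :: "nat \<Rightarrow> 'i \<Rightarrow> real \<Rightarrow> real"
  assumes S: "finite S"
    and f: "\<And>n i x. continuous (at_right x) (f n i)" "\<And>n i. mono (f n i)" "\<And>n i x. \<bar>f n i x\<bar> \<le> M"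
  shows "\<exists>s F. strict_mono (s :: nat \<Rightarrow> nat) \<and> (\<forall>i\<in>S. (\<forall>x. continuous (at_right x) (F i)) \<and> mono (F i) \<and>
    (\<forall>x. isCont (F i) x \<longrightarrow> (\<lambda>n. f (s n) i x) \<longlonglongrightarrow> F i x))"
  using S
proof (induction S rule: finite_induct)
  case empty
  show ?case by (rule exI[of _ id]) (simp add: strict_mono_def)
next
  case (insert i S)
  from insert.IH obtain s F where s: "strict_mono (s :: nat \<Rightarrow> nat)" and F: "\<forall>i\<in>S. (\<forall>x. continuous (at_right x) (F i)) \<and> mono (F i) \<and>
    (\<forall>x. isCont (F i) x \<longrightarrow> (\<lambda>n. f (s n) i x) \<longlonglongrightarrow> F i x)"
    by (elim exE conjE)
  obtain r G where r: "strict_mono (r :: nat \<Rightarrow> nat)" and G: "\<forall>x. continuous (at_right x) G" "mono G"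
    "\<forall>x. isCont G x \<longrightarrow> (\<lambda>n. f (s (r n)) i x) \<longlonglongrightarrow> G x"
    using Helly_selection[of "\<lambda>n. f (s n) i" M, OF f] by blast
  have "(\<lambda>n. f (s (r n)) l x) \<longlonglongrightarrow> F l x" if "l \<in> S" "isCont (F l) x" for l x
    using LIMSEQ_subseq_LIMSEQ[OF _ r, of "\<lambda>n. f (s n) l x"] F that by (auto simp: comp_def)
  moreover have "strict_mono (\<lambda>n. s (r n))" using strict_mono_o[OF s r] by (simp add: comp_def)
  ultimately show ?case using F G insert.hyps(2)
    by (intro exI[of _ "\<lambda>n. s (r n)"] exI[of _ "F(i := G)"]) auto
qed

section \<open>Step functions of grid paths and their limits\<close>

definition step_path :: "real \<Rightarrow> nat \<Rightarrow> (nat \<Rightarrow> 'j \<Rightarrow> real) \<Rightarrow> 'j \<Rightarrow> real \<Rightarrow> real" where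
  "step_path T n U j x = (if x < 0 then 0 else U (nat \<lfloor>x * real n / T\<rfloor>) j)"

lemma grid_path_mono:
  assumes "grid_path n U" "i \<le> i'"
  shows "U i j \<le> U i' j"
  using lift_Suc_mono_le[of "\<lambda>i. U i j" i i'] assms by (simp add: grid_path_def)

lemma grid_path_nonneg: "grid_path n U \<Longrightarrow> U i j \<ge> 0"
  using grid_path_mono[of n U 0 i j] order_trans unfolding grid_path_def by blast

lemma step_path_mono:
  assumes "grid_path n U" "T > 0"
  shows "mono (step_path T n U j)"
proof (rule monoI)
  fix x y :: real assume "x \<le> y"
  then have "nat \<lfloor>x * real n / T\<rfloor> \<le> nat \<lfloor>y * real n / T\<rfloor>"
    using assms(2) by (intro nat_mono floor_mono divide_right_mono mult_right_mono) auto
  then show "step_path T n U j x \<le> step_path T n U j y"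
    using \<open>x \<le> y\<close> grid_path_mono[OF assms(1)] grid_path_nonneg[OF assms(1)] by (auto simp: step_path_def)
qed

lemma step_path_right_continuous:
  assumes T: "T > 0" and n: "n \<ge> 1"
  shows "continuous (at_right x) (step_path T n U j)"
proof -
  have "eventually (\<lambda>y. step_path T n U j x = step_path T n U j y) (at_right x)"
  proof (cases "x < 0")
    case True
    then show ?thesis by (auto simp: eventually_at_right step_path_def intro!: exI[of _ 0])
  next
    case False
    define m where "m = \<lfloor>x * real n / T\<rfloor>"
    define z where "z = T * (real_of_int m + 1) / real n"
    have m: "real_of_int m \<le> x * real n / T" "x * real n / T < real_of_int m + 1" by (simp_all add: m_def)
    have "x < z" using m(2) T n by (simp add: z_def field_simps)
    moreover have "step_path T n U j x = step_path T n U j y" if y: "x < y" "y < z" for y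
    proof -
      have "x * real n / T \<le> y * real n / T" using y T by (intro divide_right_mono mult_right_mono) auto
      moreover have "y * real n / T < real_of_int m + 1" using y(2) T n by (simp add: z_def field_simps)
      ultimately have "\<lfloor>y * real n / T\<rfloor> = m" using m(1) by (intro floor_unique) auto
      then show ?thesis using False y by (simp add: step_path_def m_def)
    qed
    ultimately show ?thesis unfolding eventually_at_right_field by blast
  qed
  then have "(step_path T n U j \<longlongrightarrow> step_path T n U j x) (at_right x)"
    by (intro Lim_transform_eventually[OF tendsto_const])
  then show ?thesis by (simp add: continuous_within)
qed

lemma step_path_grid:
  assumes "T > 0" "n \<ge> 1"
  shows "step_path T n U j (T * real i / real n) = U i j"
proof -
  have "\<not> T * real i / real n < 0" using assms by (simp add: not_less)
  then show ?thesis using assms by (simp add: step_path_def)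
qed

lemma step_path_end:
  assumes "grid_path n U" "T > 0" "n \<ge> 1" "x \<ge> T"
  shows "step_path T n U j x = U n j"
proof -
  have "real n \<le> x * real n / T" using assms by (simp add: field_simps)
  then have "n \<le> nat \<lfloor>x * real n / T\<rfloor>" by linarith
  then have "U (nat \<lfloor>x * real n / T\<rfloor>) = U n" using assms(1) unfolding grid_path_def by blast
  moreover have "\<not> x < 0" using assms by simp
  ultimately show ?thesis by (simp add: step_path_def)
qed

text \<open>The grid time at which the value was taken differs from \<open>min x T\<close> by at
  most one mesh width, which accounts for the last term.\<close>

lemma step_path_feasible:
  assumes T: "T > 0" and n: "n \<ge> 1" and x: "x \<ge> 0"
    and U: "\<And>i. app A (U i) k \<le> \<beta> k + b k * grid T n i"
  shows "app A (\<lambda>j. step_path T n U j x) k \<le> \<beta> k + b k * min x T + \<bar>b k\<bar> * (T / real n)"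
proof -
  define i where "i = nat \<lfloor>x * real n / T\<rfloor>"
  have "0 \<le> x * real n / T" using x T by simp
  then have i: "real i \<le> x * real n / T" "x * real n / T < real i + 1" unfolding i_def by linarith+
  have i': "T * real i \<le> x * real n" "x * real n < T * real i + T"
    using i T by (simp_all add: field_simps)
  have "\<bar>grid T n i - min x T\<bar> \<le> T / real n"
  proof (cases "i < n")
    case True
    then have "T * real i + T \<le> T * real n"
      using T mult_left_mono[of "real i + 1" "real n" T] by (simp add: algebra_simps)
    then have "x * real n < T * real n" using i'(2) by simp
    then have "x < T" using n by simp
    have "grid T n i = T * real i / real n" using True by (simp add: grid_def)
    moreover have "T * real i / real n \<le> x" "x < T * real i / real n + T / real n"
      using i' n by (simp_all add: field_simps)
    ultimately show ?thesis using \<open>x < T\<close> by (simp add: abs_le_iff)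
  next
    case False
    then have "T * real n \<le> T * real i" using T by simp
    then have "T * real n \<le> x * real n" using i'(1) by linarith
    then have "T \<le> x" using n by simp
    then show ?thesis using False T n by (simp add: grid_def)
  qed
  then have "\<bar>b k\<bar> * \<bar>grid T n i - min x T\<bar> \<le> \<bar>b k\<bar> * (T / real n)" by (intro mult_left_mono) auto
  then have "b k * (grid T n i - min x T) \<le> \<bar>b k\<bar> * (T / real n)" by (metis abs_ge_self abs_mult order_trans)
  then have "b k * grid T n i \<le> b k * min x T + \<bar>b k\<bar> * (T / real n)" by (simp add: right_diff_distrib)
  moreover have "app A (\<lambda>j. step_path T n U j x) k = app A (U i) k" using x by (simp add: step_path_def i_def)
  ultimately show ?thesis using U[of i] by simp
qed

text \<open>The functions change along with the mesh; the common bound \<open>K\<close> on their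
  increase still drives the error to 0.\<close>

lemma riemann_sums_tendsto:
  fixes f :: "nat \<Rightarrow> real \<Rightarrow> real"
  assumes mono: "\<And>m. mono (f m)" and bnd: "\<And>m. f m T - f m 0 \<le> K" and T: "T > 0"
    and N: "\<And>m. N m \<ge> 1" "filterlim N at_top sequentially"
    and I: "(\<lambda>m. \<integral>t\<in>{0..T}. f m t \<partial>lborel) \<longlonglongrightarrow> I"
  shows "(\<lambda>m. T / real (N m) * (\<Sum>i<N m. f m (T * real i / real (N m)))) \<longlonglongrightarrow> I"
proof -
  let ?d = "\<lambda>m. (\<integral>t\<in>{0..T}. f m t \<partial>lborel) - T / real (N m) * (\<Sum>i<N m. f m (T * real i / real (N m)))"
  have "(\<lambda>m. T / real (N m) * K) \<longlonglongrightarrow> 0"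
  proof -
    have "filterlim (\<lambda>m. real (N m)) at_top sequentially"
      using filterlim_compose[OF filterlim_real_sequentially N(2)] .
    then have "(\<lambda>m. T / real (N m)) \<longlonglongrightarrow> 0"
      by (intro tendsto_divide_0[OF tendsto_const] filterlim_at_top_imp_at_infinity)
    then show ?thesis using tendsto_mult_left_zero by blast
  qed
  moreover have "\<bar>?d m\<bar> \<le> T / real (N m) * K" for m
  proof -
    have "T / real (N m) * (f m T - f m 0) \<le> T / real (N m) * K" using T bnd by (intro mult_left_mono) auto
    then show ?thesis using riemann_sum_mono[OF mono T N(1), of m m] by linarith
  qed
  ultimately have "?d \<longlonglongrightarrow> 0" by (intro Lim_null_comparison[of ?d "\<lambda>m. T / real (N m) * K"]) auto
  from tendsto_diff[OF I this] show ?thesis by simp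
qed

text \<open>The Stieltjes objective after integration by parts, the limit form of
  \<open>grid_obj\<close>.\<close>

definition path_obj :: "('j::finite \<Rightarrow> real) \<Rightarrow> ('j \<Rightarrow> real) \<Rightarrow> real \<Rightarrow> ('j \<Rightarrow> real \<Rightarrow> real) \<Rightarrow> real" where
  "path_obj g c T F = (\<Sum>j\<in>UNIV. g j * F j T + c j * (\<integral>t\<in>{0..T}. F j t \<partial>lborel))"

text \<open>Helly's theorem gives convergence only at continuity points. The exceptions for finitely
  many monotone functions are countable, so every point is a limit from the right of good
  ones.\<close>

lemma right_continuous_le:
  fixes G :: "real \<Rightarrow> real"
  assumes "continuous (at_right x) G" "countable C" "\<And>y. y > x \<Longrightarrow> y \<notin> C \<Longrightarrow> G y \<le> z"
  shows "G x \<le> z"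
proof (rule ccontr)
  assume "\<not> G x \<le> z"
  then have "eventually (\<lambda>y. z < G y) (at_right x)"
    using assms(1) by (intro order_tendstoD(1)[of G "G x"]) (auto simp: continuous_within)
  then obtain e where e: "e > x" "\<And>y. x < y \<Longrightarrow> y < e \<Longrightarrow> z < G y"
    unfolding eventually_at_right_field by blast
  obtain y where "y \<in> {x<..<e}" "y \<notin> C"
    using open_minus_countable[OF assms(2), of "{x<..<e}"] e(1) by auto
  then show False using e(2)[of y] assms(3)[of y] by force
qed

lemma step_path_limit:
  fixes A :: "'k \<Rightarrow> 'j::finite \<Rightarrow> real"
  assumes T: "T > 0" and s: "strict_mono (s :: nat \<Rightarrow> nat)"
    and U: "\<And>m. grid_path (Suc m) (U m)" "\<And>m i j. U m i j \<le> M"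
    and AU: "\<And>m i k. app A (U m i) k \<le> \<beta> k + b k * grid T (Suc m) i"
    and F: "\<And>j x. continuous (at_right x) (F j)" "\<And>j. mono (F j)"
      "\<forall>j x. isCont (F j) x \<longrightarrow> (\<lambda>m. step_path T (Suc (s m)) (U (s m)) j x) \<longlonglongrightarrow> F j x"
  shows "F j x \<ge> 0"
    and "x \<ge> 0 \<Longrightarrow> app A (\<lambda>j. F j x) k \<le> \<beta> k + b k * min x T"
    and "(\<lambda>m. grid_obj g c T (Suc (s m)) (U (s m))) \<longlonglongrightarrow> path_obj g c T F"
proof -
  let ?f = "\<lambda>m j. step_path T (Suc (s m)) (U (s m)) j"
  define C where "C = (\<Union>j. {x. \<not> isCont (F j) x})"
  have C: "countable C" unfolding C_def using F(2) by (intro countable_UN mono_ctble_discont) auto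
  have conv: "(\<lambda>m. ?f m j x) \<longlonglongrightarrow> F j x" if "x \<notin> C" for j x using F(3) that by (auto simp: C_def)
  have f: "mono (?f m j)" "0 \<le> ?f m j x" "?f m j x \<le> max 0 M" for m j x
    using step_path_mono[OF U(1) T] grid_path_nonneg[OF U(1)] U(2)
    by (auto simp: step_path_def max.coboundedI2)
  have Fnn: "F j x \<ge> 0" for j x
  proof -
    have "- F j x \<le> 0"
    proof (rule right_continuous_le[OF _ C, of x "\<lambda>x. - F j x"])
      show "continuous (at_right x) (\<lambda>x. - F j x)" using F(1) by (intro continuous_intros)
      show "- F j y \<le> 0" if "y \<notin> C" for y
        using LIMSEQ_le_const[OF conv[OF that], of 0 j] f(2) by simp
    qed
    then show ?thesis by simp
  qed
  then show "F j x \<ge> 0" .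
  have inv0: "(\<lambda>m. T / real (Suc (s m))) \<longlonglongrightarrow> 0"
  proof -
    have "(\<lambda>m. T / real (Suc m)) \<longlonglongrightarrow> 0" using LIMSEQ_Suc[OF lim_const_over_n[of T]] by simp
    from LIMSEQ_subseq_LIMSEQ[OF this s] show ?thesis by (simp add: comp_def)
  qed
  show "app A (\<lambda>j. F j x) k \<le> \<beta> k + b k * min x T" if x: "x \<ge> 0"
  proof -
    have "app A (\<lambda>j. F j x) k - b k * min x T \<le> \<beta> k"
    proof (rule right_continuous_le[OF _ C, of x "\<lambda>x. app A (\<lambda>j. F j x) k - b k * min x T"])
      show "continuous (at_right x) (\<lambda>x. app A (\<lambda>j. F j x) k - b k * min x T)"
        unfolding app_def using F(1) by (intro continuous_intros)
      show "app A (\<lambda>j. F j y) k - b k * min y T \<le> \<beta> k" if y: "y > x" "y \<notin> C" for y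
      proof -
        have "(\<lambda>m. app A (\<lambda>j. ?f m j y) k) \<longlonglongrightarrow> app A (\<lambda>j. F j y) k"
          unfolding app_def by (intro tendsto_intros conv y)
        moreover have "(\<lambda>m. \<beta> k + b k * min y T + \<bar>b k\<bar> * (T / real (Suc (s m)))) \<longlonglongrightarrow> \<beta> k + b k * min y T + \<bar>b k\<bar> * 0"
          by (intro tendsto_intros inv0)
        moreover have "app A (\<lambda>j. ?f m j y) k \<le> \<beta> k + b k * min y T + \<bar>b k\<bar> * (T / real (Suc (s m)))" for m
          using x y by (intro step_path_feasible[OF T _ _ AU]) auto
        ultimately have "app A (\<lambda>j. F j y) k \<le> \<beta> k + b k * min y T + \<bar>b k\<bar> * 0"
          by (intro LIMSEQ_le) auto
        then show ?thesis by simp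
      qed
    qed
    then show ?thesis by simp
  qed
  \<comment> \<open>\<open>T\<close> may be a discontinuity of the limit. But step paths are
    constant from \<open>T\<close> on, so they converge at good points beyond \<open>T\<close>, the
    limit takes one value at all of these, and right-continuity carries it back to
    \<open>T\<close>.\<close>
  have end_conv: "(\<lambda>m. U (s m) (Suc (s m)) j) \<longlonglongrightarrow> F j T" for j
  proof -
    have at_end: "?f m j y = U (s m) (Suc (s m)) j" if "y \<ge> T" for m y
      by (rule step_path_end[OF U(1) T _ that]) simp
    obtain y where y: "y > T" "y \<notin> C"
      using open_minus_countable[OF C, of "{T<..}"] by auto
    have lim: "(\<lambda>m. U (s m) (Suc (s m)) j) \<longlonglongrightarrow> F j y'" if "y' > T" "y' \<notin> C" for y'
      using conv[OF that(2), of j] at_end that(1) by simp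
    then have eq: "F j y' = F j y" if "y' > T" "y' \<notin> C" for y' using LIMSEQ_unique y that by blast
    have "F j T \<le> F j y" by (rule right_continuous_le[OF F(1) C]) (simp add: eq)
    moreover have "- F j T \<le> - F j y"
      by (rule right_continuous_le[OF _ C, of T "\<lambda>x. - F j x"]) (use F(1) in \<open>auto simp: eq intro: continuous_intros\<close>)
    ultimately show ?thesis using lim[OF y] by simp
  qed
  have int_conv: "(\<lambda>m. \<integral>t\<in>{0..T}. ?f m j t \<partial>lborel) \<longlonglongrightarrow> (\<integral>t\<in>{0..T}. F j t \<partial>lborel)" for j
    unfolding set_lebesgue_integral_def
  proof (rule integral_dominated_convergence[where w = "\<lambda>t. indicator {0..T} t *\<^sub>R max 0 M"])
    show "(\<lambda>t. indicator {0..T} t *\<^sub>R F j t) \<in> borel_measurable lborel"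
      using borel_measurable_mono[OF F(2)] by simp
    show "(\<lambda>t. indicator {0..T} t *\<^sub>R ?f m j t) \<in> borel_measurable lborel" for m
      using borel_measurable_mono[OF f(1)] by simp
    show "integrable lborel (\<lambda>t. indicator {0..T} t *\<^sub>R max 0 M)"
      by (intro integrable_scaleR_left integrable_real_indicator) (auto simp: emeasure_lborel_Icc_eq)
    have "AE t in lborel. t \<notin> C" using C by (intro AE_not_in countable_imp_null_set_lborel)
    then show "AE t in lborel. (\<lambda>m. indicator {0..T} t *\<^sub>R ?f m j t) \<longlonglongrightarrow> indicator {0..T} t *\<^sub>R F j t"
      by (rule eventually_mono) (intro tendsto_intros conv)
    show "AE t in lborel. norm (indicator {0..T} t *\<^sub>R ?f m j t) \<le> indicator {0..T} t *\<^sub>R max 0 M" for m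
      using f(2,3) by (intro AE_I2) (simp add: indicator_def)
  qed
  have sum_conv: "(\<lambda>m. T / real (Suc (s m)) * (\<Sum>i<Suc (s m). U (s m) i j)) \<longlonglongrightarrow> (\<integral>t\<in>{0..T}. F j t \<partial>lborel)" for j
  proof -
    have K: "?f m j T - ?f m j 0 \<le> max 0 M" for m using f(2)[of m j 0] f(3)[of m j T] by linarith
    have "filterlim (\<lambda>m. Suc (s m)) at_top sequentially"
      by (rule filterlim_compose[OF filterlim_Suc filterlim_subseq[OF s]])
    then have "(\<lambda>m. T / real (Suc (s m)) * (\<Sum>i<Suc (s m). ?f m j (T * real i / real (Suc (s m))))) \<longlonglongrightarrow> (\<integral>t\<in>{0..T}. F j t \<partial>lborel)"
      by (intro riemann_sums_tendsto[OF f(1) K T _ _ int_conv]) simp_all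
    moreover have "?f m j (T * real i / real (Suc (s m))) = U (s m) i j" for m i
      by (rule step_path_grid[OF T]) simp
    ultimately show ?thesis by simp
  qed
  show "(\<lambda>m. grid_obj g c T (Suc (s m)) (U (s m))) \<longlonglongrightarrow> path_obj g c T F"
    unfolding grid_obj_def path_obj_def by (intro tendsto_intros end_conv sum_conv)
qed


section \<open>Return to the continuous problems\<close>

lemma admissible_ext0:
  assumes "admissible T U" "T > 0"
  shows "mono (ext0 T (\<lambda>t. U t $ j))" "continuous (at_right x) (ext0 T (\<lambda>t. U t $ j))"
    "LS_int T (\<lambda>t. U t $ j) (\<lambda>t. g + (T - t) * c) = g * ext0 T (\<lambda>t. U t $ j) T + c * (\<integral>t\<in>{0..T}. ext0 T (\<lambda>t. U t $ j) t \<partial>lborel)"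
proof -
  have m: "\<And>s t. 0 \<le> s \<Longrightarrow> s \<le> t \<Longrightarrow> t \<le> T \<Longrightarrow> U s $ j \<le> U t $ j" and nn: "0 \<le> U 0 $ j"
    using assms by (auto simp: admissible_def)
  have rc: "\<And>t. 0 \<le> t \<Longrightarrow> t < T \<Longrightarrow> ((\<lambda>t. U t $ j) \<longlongrightarrow> U t $ j) (at_right t)"
    using assms(1) unfolding admissible_def by (auto intro: tendsto_vec_nth)
  show "mono (ext0 T (\<lambda>t. U t $ j))" using m nn assms(2) by (intro ext0_mono) auto
  show "continuous (at_right x) (ext0 T (\<lambda>t. U t $ j))" using rc assms(2) by (intro ext0_right_continuous) auto
  show "LS_int T (\<lambda>t. U t $ j) (\<lambda>t. g + (T - t) * c) = g * ext0 T (\<lambda>t. U t $ j) T + c * (\<integral>t\<in>{0..T}. ext0 T (\<lambda>t. U t $ j) t \<partial>lborel)"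
    using LS_int_affine[of T "\<lambda>t. U t $ j" g c, OF m nn assms(2) rc] assms(2) by (simp add: ext0_def)
qed

lemma MCLP_obj_path_obj:
  "admissible T U \<Longrightarrow> T > 0 \<Longrightarrow> MCLP_obj \<gamma> c T U = path_obj (($) \<gamma>) (($) c) T (\<lambda>j. ext0 T (\<lambda>t. U t $ j))"
  by (simp add: MCLP_obj_def path_obj_def admissible_ext0)

lemma MCLP_dual_obj_path_obj:
  "admissible T P \<Longrightarrow> T > 0 \<Longrightarrow> MCLP_dual_obj \<beta> b T P = path_obj (($) \<beta>) (($) b) T (\<lambda>k. ext0 T (\<lambda>t. P t $ k))"
  by (simp add: MCLP_dual_obj_def path_obj_def admissible_ext0)

lemma path_samples_tendsto:
  assumes F: "\<And>j. mono (F j)" and T: "T > 0"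
  shows "(\<lambda>m. grid_obj g c T (Suc m) (\<lambda>i j. F j (T * real i / real (Suc m)))) \<longlonglongrightarrow> path_obj g c T F"
proof -
  have "(\<lambda>m. T / real (Suc m) * (\<Sum>i<Suc m. F j (T * real i / real (Suc m)))) \<longlonglongrightarrow> (\<integral>t\<in>{0..T}. F j t \<partial>lborel)" for j
    by (rule riemann_sums_tendsto[OF F order_refl T _ filterlim_Suc tendsto_const]) simp
  then have "(\<lambda>m. \<Sum>j\<in>UNIV. g j * F j T + c j * (T / real (Suc m) * (\<Sum>i<Suc m. F j (T * real i / real (Suc m))))) \<longlonglongrightarrow> path_obj g c T F"
    unfolding path_obj_def by (intro tendsto_intros)
  moreover have "T * real (Suc m) / real (Suc m) = T" for m by simp
  ultimately show ?thesis unfolding grid_obj_def by simp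
qed

lemma MCLP_feasible_app:
  "MCLP_feasible A \<beta> b T U \<longleftrightarrow> admissible T U \<and>
     (\<forall>t\<in>{0..T}. \<forall>k. app (\<lambda>k j. A $ k $ j) (($) (U t)) k \<le> \<beta> $ k + b $ k * t)"
  by (simp add: MCLP_feasible_def app_def matrix_vector_mult_def)

lemma MCLP_dual_feasible_app:
  "MCLP_dual_feasible A \<gamma> c T P \<longleftrightarrow> admissible T P \<and>
     (\<forall>t\<in>{0..T}. \<forall>j. app (\<lambda>j k. - A $ k $ j) (($) (P t)) j \<le> - (\<gamma> $ j + c $ j * t))"
  by (simp add: MCLP_dual_feasible_def app_def matrix_vector_mult_def transpose_def sum_negf del: minus_add_distrib)

text \<open>Sampled feasible paths satisfy the grid constraints exactly, and the grid inequality
  holds for every mesh. Only the objectives are approximate, and they converge.\<close>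

lemma MCLP_weak_duality:
  fixes A :: "real^'j^'k"
  assumes T: "T > 0" and U: "MCLP_feasible A \<beta> b T U" and P: "MCLP_dual_feasible A \<gamma> c T P"
  shows "MCLP_obj \<gamma> c T U \<le> MCLP_dual_obj \<beta> b T P"
proof -
  have aU: "admissible T U" and aP: "admissible T P"
    using U P by (auto simp: MCLP_feasible_def MCLP_dual_feasible_def)
  define F where "F j = ext0 T (\<lambda>t. U t $ j)" for j
  define G where "G k = ext0 T (\<lambda>t. P t $ k)" for k
  have mono: "mono (F j)" "mono (G k)" for j k
    unfolding F_def G_def using admissible_ext0(1) aU aP T by auto
  have weak: "grid_obj (($) \<gamma>) (($) c) T (Suc m) (\<lambda>i j. F j (T * real i / real (Suc m)))
      \<le> grid_obj (($) \<beta>) (($) b) T (Suc m) (\<lambda>i k. G k (T * real i / real (Suc m)))" for m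
  proof -
    have le: "T * real i / real (Suc m) \<le> T * real (Suc i) / real (Suc m)" for i
      using T by (intro divide_right_mono mult_left_mono) auto
    have grid: "grid T (Suc m) i = T * real i / real (Suc m)" "T * real i / real (Suc m) \<in> {0..T}" if "i \<le> Suc m" for i
      using that grid_props(4,5)[of "Suc m" T i, OF _ T] by (auto simp: grid_def min_absorb1)
    have Fx: "(\<lambda>j. F j x) = ($) (U x)" "(\<lambda>k. G k x) = ($) (P x)" if "x \<in> {0..T}" for x
      using that by (auto simp: F_def G_def ext0_def)
    have "1 * grid_obj (($) \<gamma>) (($) c) T (Suc m) (\<lambda>i j. F j (T * real i / real (Suc m)))
      \<le> 1 * grid_obj (($) \<beta>) (($) b) T (Suc m) (\<lambda>i k. G k (T * real i / real (Suc m)))"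
    proof (rule grid_weak_duality[where A = "\<lambda>k j. A $ k $ j"])
      show "0 \<le> F j (T * real 0 / real (Suc m))" for j
        using aU T by (simp add: F_def ext0_def admissible_def)
      show "0 \<le> G k (T * real 0 / real (Suc m))" for k
        using aP T by (simp add: G_def ext0_def admissible_def)
      show "F j (T * real i / real (Suc m)) \<le> F j (T * real (Suc i) / real (Suc m))" for i j
        by (rule monoD[OF mono(1) le])
      show "G k (T * real i / real (Suc m)) \<le> G k (T * real (Suc i) / real (Suc m))" for i k
        by (rule monoD[OF mono(2) le])
      show "app (\<lambda>k j. A $ k $ j) (\<lambda>j. F j (T * real i / real (Suc m))) k \<le> 1 * (\<beta> $ k + b $ k * grid T (Suc m) i)"
        if "i \<le> Suc m" for i k
        using U grid[OF that] Fx(1)[OF grid(2)[OF that]] by (simp only: MCLP_feasible_app mult_1)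
      show "app (\<lambda>j k. - A $ k $ j) (\<lambda>k. G k (T * real i / real (Suc m))) j \<le> - (1 * (\<gamma> $ j + c $ j * grid T (Suc m) i))"
        if "i \<le> Suc m" for i j
        using P grid[OF that] Fx(2)[OF grid(2)[OF that]] by (simp only: MCLP_dual_feasible_app mult_1)
    qed simp
    then show ?thesis by simp
  qed
  have "path_obj (($) \<gamma>) (($) c) T F \<le> path_obj (($) \<beta>) (($) b) T G"
    by (rule LIMSEQ_le[OF path_samples_tendsto[OF mono(1) T] path_samples_tendsto[OF mono(2) T]]) (intro exI[of _ 0] allI impI weak)
  then show ?thesis
    using MCLP_obj_path_obj[OF aU T] MCLP_dual_obj_path_obj[OF aP T] unfolding F_def G_def by metis
qed

text \<open>The witness is the chord of \<open>U\<close>, which agrees with \<open>U\<close> at the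
  two times where affine feasibility is tested.\<close>

lemma affine_feasible_of_admissible:
  fixes U :: "real \<Rightarrow> real^'j"
  assumes T: "T > 0" and U: "admissible T U"
    and AU: "\<And>t k. t \<in> {0..T} \<Longrightarrow> app A (($) (U t)) k \<le> \<beta> k + b k * t"
  shows "affine_feasible A \<beta> b T (($) (U 0)) (\<lambda>j. (1 / T) * (U T $ j - U 0 $ j))"
proof -
  have "T * app A (\<lambda>j. (1 / T) * (U T $ j - U 0 $ j)) k = app A (($) (U T)) k - app A (($) (U 0)) k" for k
    unfolding app_simps using T by simp
  then show ?thesis
    using U T AU[of 0] AU[of T] by (simp add: affine_feasible_def admissible_def mult.commute)
qed

lemma admissible_of_limit:
  fixes F :: "'j::finite \<Rightarrow> real \<Rightarrow> real"
  assumes T: "T > 0" and F: "\<And>j x. continuous (at_right x) (F j)" "\<And>j. mono (F j)" "\<And>j x. F j x \<ge> 0"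
  shows "admissible T (\<lambda>t. \<chi> j. F j t)"
    and "path_obj g c T (\<lambda>j. ext0 T (\<lambda>t. (\<chi> j. F j t) $ j)) = path_obj g c T F"
proof -
  show "admissible T (\<lambda>t. \<chi> j. F j t)"
    unfolding admissible_def
  proof (intro conjI ballI allI impI)
    show "0 \<le> (\<chi> j. F j t) $ i" if "t \<in> {0..T}" for t i using F(3) by simp
    show "(\<chi> j. F j s) $ i \<le> (\<chi> j. F j t) $ i" if "s \<le> t" for s t i using monoD[OF F(2) that] by simp
    show "((\<lambda>s. \<chi> j. F j s) \<longlongrightarrow> (\<chi> j. F j t)) (at_right t)" for t
      using F(1) by (intro vec_tendstoI) (simp add: continuous_within)
  qed
  have "ext0 T (F j) T = F j T" for j using T by (simp add: ext0_def)
  moreover have "(\<integral>t\<in>{0..T}. ext0 T (F j) t \<partial>lborel) = (\<integral>t\<in>{0..T}. F j t \<partial>lborel)" for j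
    by (rule set_lebesgue_integral_cong) (auto simp: ext0_def)
  ultimately show "path_obj g c T (\<lambda>j. ext0 T (\<lambda>t. (\<chi> j. F j t) $ j)) = path_obj g c T F"
    by (simp add: path_obj_def)
qed

theorem mainTheorem8:
  fixes A :: "real^'j^'k" and \<beta> b :: "real^'k" and \<gamma> c :: "real^'j" and T :: real
  assumes "T > 0"
    and "\<exists>U. MCLP_feasible A \<beta> b T U"
    and "\<exists>P. MCLP_dual_feasible A \<gamma> c T P"
  shows "\<exists>U P. MCLP_optimal A \<beta> b \<gamma> c T U \<and> MCLP_dual_optimal A \<beta> b \<gamma> c T P \<and>
           MCLP_obj \<gamma> c T U = MCLP_dual_obj \<beta> b T P"
proof -
  note T = assms(1)
  let ?A = "\<lambda>k j. A $ k $ j" and ?B = "\<lambda>j k. - A $ k $ j"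
  obtain U0 P0 where U0: "MCLP_feasible A \<beta> b T U0" and P0: "MCLP_dual_feasible A \<gamma> c T P0"
    using assms(2,3) by blast
  have primal: "affine_feasible ?A (($) \<beta>) (($) b) T (($) (U0 0)) (\<lambda>j. (1 / T) * (U0 T $ j - U0 0 $ j))"
    using U0 by (intro affine_feasible_of_admissible T) (auto simp: MCLP_feasible_app)
  have dual: "affine_feasible ?B (\<lambda>j. - \<gamma> $ j) (\<lambda>j. - c $ j) T (($) (P0 0)) (\<lambda>k. (1 / T) * (P0 T $ k - P0 0 $ k))"
    using P0 by (intro affine_feasible_of_admissible T) (auto simp: MCLP_dual_feasible_app)
  show ?thesis
  proof (rule bounded_grid_pair[OF T primal dual])
    fix M :: real
    assume M: "\<And>n. n \<ge> 1 \<Longrightarrow> \<exists>U P. grid_path n U \<and> grid_path n P \<and>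
      (\<forall>i k. app ?A (U i) k \<le> \<beta> $ k + b $ k * grid T n i) \<and>
      (\<forall>i j. app ?B (P i) j \<le> - (\<gamma> $ j + c $ j * grid T n i)) \<and>
      grid_obj (($) \<beta>) (($) b) T n P \<le> grid_obj (($) \<gamma>) (($) c) T n U \<and> (\<forall>i j. U i j \<le> M) \<and> (\<forall>i k. P i k \<le> M)"
    have "\<forall>m. \<exists>U P. grid_path (Suc m) U \<and> grid_path (Suc m) P \<and>
        (\<forall>i k. app ?A (U i) k \<le> \<beta> $ k + b $ k * grid T (Suc m) i) \<and>
        (\<forall>i j. app ?B (P i) j \<le> - (\<gamma> $ j + c $ j * grid T (Suc m) i)) \<and>
        grid_obj (($) \<beta>) (($) b) T (Suc m) P \<le> grid_obj (($) \<gamma>) (($) c) T (Suc m) U \<and> (\<forall>i j. U i j \<le> M) \<and> (\<forall>i k. P i k \<le> M)"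
      by (intro allI M) simp
    from choice[OF this] obtain U where "\<forall>m. \<exists>P. grid_path (Suc m) (U m) \<and> grid_path (Suc m) P \<and>
        (\<forall>i k. app ?A (U m i) k \<le> \<beta> $ k + b $ k * grid T (Suc m) i) \<and>
        (\<forall>i j. app ?B (P i) j \<le> - (\<gamma> $ j + c $ j * grid T (Suc m) i)) \<and>
        grid_obj (($) \<beta>) (($) b) T (Suc m) P \<le> grid_obj (($) \<gamma>) (($) c) T (Suc m) (U m) \<and> (\<forall>i j. U m i j \<le> M) \<and> (\<forall>i k. P i k \<le> M)" ..
    from choice[OF this] obtain P where UP: "\<forall>m. grid_path (Suc m) (U m) \<and> grid_path (Suc m) (P m) \<and>
        (\<forall>i k. app ?A (U m i) k \<le> \<beta> $ k + b $ k * grid T (Suc m) i) \<and>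
        (\<forall>i j. app ?B (P m i) j \<le> - (\<gamma> $ j + c $ j * grid T (Suc m) i)) \<and>
        grid_obj (($) \<beta>) (($) b) T (Suc m) (P m) \<le> grid_obj (($) \<gamma>) (($) c) T (Suc m) (U m) \<and> (\<forall>i j. U m i j \<le> M) \<and> (\<forall>i k. P m i k \<le> M)" ..
    have gU: "grid_path (Suc m) (U m)" and gP: "grid_path (Suc m) (P m)"
      and AU: "app ?A (U m i) k \<le> \<beta> $ k + b $ k * grid T (Suc m) i"
      and BP: "app ?B (P m i) j \<le> - \<gamma> $ j + - c $ j * grid T (Suc m) i"
      and obj: "grid_obj (($) \<beta>) (($) b) T (Suc m) (P m) \<le> grid_obj (($) \<gamma>) (($) c) T (Suc m) (U m)"
      and UM: "U m i j \<le> M" and PM: "P m i k \<le> M" for m i j k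
      using UP[rule_format, of m] by auto
    \<comment> \<open>Primal and dual components form one family, so that a common subsequence
      serves both and their objectives can be compared in the limit.\<close>
    define f where "f m v = (case v of Inl j \<Rightarrow> step_path T (Suc m) (U m) j | Inr k \<Rightarrow> step_path T (Suc m) (P m) k)"
      for m and v :: "'j + 'k"
    have f: "continuous (at_right x) (f m v)" "mono (f m v)" "\<bar>f m v x\<bar> \<le> max 0 M" for m v x
      using step_path_right_continuous[OF T, of "Suc m" x "U m"] step_path_right_continuous[OF T, of "Suc m" x "P m"]
        step_path_mono[OF gU T] step_path_mono[OF gP T]
        grid_path_nonneg[OF gU] grid_path_nonneg[OF gP] UM PM
      by (auto simp: f_def step_path_def max.coboundedI2 split: sum.split)
    from helly_selection_family[of UNIV f, OF finite f]
    obtain s H where s: "strict_mono (s :: nat \<Rightarrow> nat)" and H_all: "\<forall>v\<in>UNIV. (\<forall>x. continuous (at_right x) (H v)) \<and>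
      mono (H v) \<and> (\<forall>x. isCont (H v) x \<longrightarrow> (\<lambda>m. f (s m) v x) \<longlonglongrightarrow> H v x)"
      by (elim exE conjE)
    have H: "continuous (at_right x) (H v)" "mono (H v)" "isCont (H v) x \<Longrightarrow> (\<lambda>m. f (s m) v x) \<longlonglongrightarrow> H v x" for v x
      using H_all by auto
    define F where "F j = H (Inl j)" for j
    define G where "G k = H (Inr k)" for k
    have F: "continuous (at_right x) (F j)" "mono (F j)"
        "\<forall>j x. isCont (F j) x \<longrightarrow> (\<lambda>m. step_path T (Suc (s m)) (U (s m)) j x) \<longlonglongrightarrow> F j x" for j x
      using H(1,2)[where v = "Inl j"] H(3)[where v = "Inl j" for j] by (auto simp: F_def f_def)
    have G: "continuous (at_right x) (G k)" "mono (G k)"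
        "\<forall>k x. isCont (G k) x \<longrightarrow> (\<lambda>m. step_path T (Suc (s m)) (P (s m)) k x) \<longlonglongrightarrow> G k x" for k x
      using H(1,2)[where v = "Inr k"] H(3)[where v = "Inr k" for k] by (auto simp: G_def f_def)
    note limU = step_path_limit[OF T s gU UM AU F]
    \<comment> \<open>The dual is treated as a primal with matrix \<open>?B\<close> and data
      \<open>- \<gamma>\<close>, \<open>- c\<close>, hence the form of \<open>BP\<close>.\<close>
    note limP = step_path_limit[OF T s gP PM BP G]
    have le: "path_obj (($) \<beta>) (($) b) T G \<le> path_obj (($) \<gamma>) (($) c) T F"
      by (rule LIMSEQ_le[OF limP(3) limU(3)]) (intro exI[of _ 0] allI impI obj)
    define u where "u t = (\<chi> j. F j t)" for t
    define p where "p t = (\<chi> k. G k t)" for t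
    have admU: "admissible T u" "path_obj (($) \<gamma>) (($) c) T (\<lambda>j. ext0 T (\<lambda>t. u t $ j)) = path_obj (($) \<gamma>) (($) c) T F"
      unfolding u_def by (rule admissible_of_limit[OF T F(1) F(2) limU(1)])+
    have admP: "admissible T p" "path_obj (($) \<beta>) (($) b) T (\<lambda>k. ext0 T (\<lambda>t. p t $ k)) = path_obj (($) \<beta>) (($) b) T G"
      unfolding p_def by (rule admissible_of_limit[OF T G(1) G(2) limP(1)])+
    have u: "MCLP_feasible A \<beta> b T u"
      unfolding MCLP_feasible_app
    proof (intro conjI ballI allI)
      show "admissible T u" by (rule admU(1))
    next
      fix t k assume t: "t \<in> {0..T}"
      have "($) (u t) = (\<lambda>j. F j t)" by (simp add: u_def fun_eq_iff)
      then show "app ?A (($) (u t)) k \<le> \<beta> $ k + b $ k * t" using limU(2)[of t k] t by simp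
    qed
    have p: "MCLP_dual_feasible A \<gamma> c T p"
      unfolding MCLP_dual_feasible_app
    proof (intro conjI ballI allI)
      show "admissible T p" by (rule admP(1))
    next
      fix t j assume t: "t \<in> {0..T}"
      have "($) (p t) = (\<lambda>k. G k t)" by (simp add: p_def fun_eq_iff)
      then show "app ?B (($) (p t)) j \<le> - (\<gamma> $ j + c $ j * t)" using limP(2)[of t j] t by simp
    qed
    \<comment> \<open>This inequality is what the limit provides; weak duality supplies the reverse,
      and equality then certifies both paths as optimal.\<close>
    have "MCLP_dual_obj \<beta> b T p \<le> MCLP_obj \<gamma> c T u"
      unfolding MCLP_obj_path_obj[OF admU(1) T] MCLP_dual_obj_path_obj[OF admP(1) T] admU(2) admP(2) by (rule le)
    then have eq: "MCLP_obj \<gamma> c T u = MCLP_dual_obj \<beta> b T p"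
      using MCLP_weak_duality[OF T u p] by simp
    show ?thesis
    proof (intro exI conjI)
      show "MCLP_optimal A \<beta> b \<gamma> c T u"
        unfolding MCLP_optimal_def using u MCLP_weak_duality[OF T _ p] by (auto simp: eq)
      show "MCLP_dual_optimal A \<beta> b \<gamma> c T p"
        unfolding MCLP_dual_optimal_def using p MCLP_weak_duality[OF T u] by (auto simp: eq[symmetric])
    qed (rule eq)
  qed
qed

end
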